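(* Let $M$ be a closed smooth manifold and let $f:M\to M$ be a diffeomorphism whose nonwandering set $\Omega(f)$ is hyperbolic. Then $f$ has the ergodic inverse shadowing property (EIS).
   Context: $\mathrm{dist}$ is the distance on $M$ induced by a Riemannian metric; $\mathbb{Z}_+=\{0,1,2,\dots\}$. $C(M,M)$ is the space of continuous mappings $M\to M$ with the metric $\mathrm{dist}_{C^0}(g,h)=\max_{x\in M}\mathrm{dist}(g(x),h(x))$. A method is a sequence $g=\{g_k\in C(M,M)\}_{k\in\mathbb{Z}_+}$; a trajectory of $g$ is a sequence $\{y_k\}_{k\in\mathbb{Z}_+}$ in $M$ with $y_{k+1}=g_k(y_k)$ for all $k$. For $d>0$, $g$ is a $d$-method for $f$ if $\mathrm{dist}_{C^0}(g_k,f)\le d$ for all $k\in\mathbb{Z}_+$. $\mathrm{Lip}_1$ is the set of functions $\varphi:M\to\mathbb{R}$ that are Lipschitz with constant at most $1$. A surjective continuous mapping $f:M\to M$ has the ergodic inverse shadowing property (EIS) if for any $\varepsilon>0$ there exists a $d>0$ such that for any trajectory $\{x_k=f^k(x):k\in\mathbb{Z}_+\}$ of $f$ and for any $d$-method $g$ for $f$ there exists a trajectory $\{y_k:k\in\mathbb{Z}_+\}$ of $g$ such that $\limsup_{n\to\infty}\frac1n\sum_{k=1}^n(\varphi(x_k)-\varphi(y_k))\le\varepsilon$ for every $\varphi\in\mathrm{Lip}_1$. *)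

theory Defs
  imports "HOL-Analysis.Analysis"
begin

section \<open>Smooth manifolds\<close>

text \<open>The following is the usual notion of a \<open>C\<^sup>k\<close> map when \<open>S\<close> is open, which is the only
  case in which it is used below.\<close>

primrec Ck_on :: "nat \<Rightarrow> ('a::euclidean_space \<Rightarrow> 'b::euclidean_space) \<Rightarrow> 'a set \<Rightarrow> bool" where
  "Ck_on 0 f S \<longleftrightarrow> continuous_on S f"
| "Ck_on (Suc k) f S \<longleftrightarrow>
     f differentiable_on S \<and> (\<forall>v. Ck_on k (\<lambda>x. frechet_derivative f (at x) v) S)"

definition smooth_on :: "('a::euclidean_space \<Rightarrow> 'b::euclidean_space) \<Rightarrow> 'a set \<Rightarrow> bool" where
  "smooth_on f S \<longleftrightarrow> (\<forall>k. Ck_on k f S)"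

text \<open>The manifold is a whole type \<open>'m\<close>. A chart is a pair of its domain and its coordinate map,
  whose values outside the domain are irrelevant.\<close>

type_synonym ('m, 'e) chart = "'m set \<times> ('m \<Rightarrow> 'e)"

definition chart_inv :: "('m, 'e) chart \<Rightarrow> 'e \<Rightarrow> 'm" where
  "chart_inv c = inv_into (fst c) (snd c)"

definition is_chart :: "('m::topological_space, 'e::euclidean_space) chart \<Rightarrow> bool" where
  "is_chart c \<longleftrightarrow> open (fst c) \<and> open (snd c ` fst c) \<and>
     homeomorphism (fst c) (snd c ` fst c) (snd c) (chart_inv c)"

definition smooth_atlas :: "('m::topological_space, 'e::euclidean_space) chart set \<Rightarrow> bool" where
  "smooth_atlas A \<longleftrightarrow>
     (\<forall>c\<in>A. is_chart c) \<and> (\<Union>c\<in>A. fst c) = UNIV \<and>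
     (\<forall>c\<in>A. \<forall>c'\<in>A. smooth_on (snd c' \<circ> chart_inv c) (snd c ` (fst c \<inter> fst c')))"

text \<open>Compact, without boundary. Hausdorffness is the sort constraint, and second countability
  follows from compactness. Connectedness is not required.\<close>

definition closed_smooth_manifold ::
    "('m::t2_space, 'e::euclidean_space) chart set \<Rightarrow> bool" where
  "closed_smooth_manifold A \<longleftrightarrow> compact (UNIV :: 'm set) \<and> smooth_atlas A"

definition C1_map ::
    "('m::topological_space, 'e::euclidean_space) chart set \<Rightarrow> ('m \<Rightarrow> 'm) \<Rightarrow> bool" where
  "C1_map A f \<longleftrightarrow> continuous_on UNIV f \<and>
     (\<forall>c\<in>A. \<forall>c'\<in>A. Ck_on 1 (snd c' \<circ> f \<circ> chart_inv c) (snd c ` (fst c \<inter> f -` fst c')))"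

definition diffeomorphism ::
    "('m::topological_space, 'e::euclidean_space) chart set \<Rightarrow> ('m \<Rightarrow> 'm) \<Rightarrow> bool" where
  "diffeomorphism A f \<longleftrightarrow> bij f \<and> C1_map A f \<and> C1_map A (inv f)"


section \<open>Tangent spaces and Riemannian metrics\<close>

text \<open>A chart \<open>chart_at A p\<close> around \<open>p\<close> is chosen once and for all, and the tangent space at \<open>p\<close> is
  identified with the model space \<open>'e\<close> by the differential of that chart. The linear map
  \<open>from_coords A c p\<close> turns the coordinates of a tangent vector at \<open>p\<close> with respect to a chart \<open>c\<close>
  into the corresponding element of the tangent space at \<open>p\<close>.\<close>

definition chart_at :: "('m, 'e) chart set \<Rightarrow> 'm \<Rightarrow> ('m, 'e) chart" where
  "chart_at A p = (SOME c. c \<in> A \<and> p \<in> fst c)"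

definition from_coords ::
    "('m, 'e::euclidean_space) chart set \<Rightarrow> ('m, 'e) chart \<Rightarrow> 'm \<Rightarrow> 'e \<Rightarrow> 'e" where
  "from_coords A c p =
     frechet_derivative (snd (chart_at A p) \<circ> chart_inv c) (at (snd c p))"

definition tangent_map ::
    "('m, 'e::euclidean_space) chart set \<Rightarrow> ('m \<Rightarrow> 'm) \<Rightarrow> 'm \<Rightarrow> 'e \<Rightarrow> 'e" where
  "tangent_map A f p =
     frechet_derivative (snd (chart_at A (f p)) \<circ> f \<circ> chart_inv (chart_at A p))
       (at (snd (chart_at A p) p))"

definition riemannian_metric ::
    "('m, 'e::euclidean_space) chart set \<Rightarrow> ('m \<Rightarrow> 'e \<Rightarrow> 'e \<Rightarrow> real) \<Rightarrow> bool" where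
  "riemannian_metric A G \<longleftrightarrow>
     (\<forall>p. bilinear (G p) \<and> (\<forall>u v. G p u v = G p v u) \<and> (\<forall>v. v \<noteq> 0 \<longrightarrow> G p v v > 0)) \<and>
     (\<forall>c\<in>A. \<forall>u v. smooth_on
        (\<lambda>x. G (chart_inv c x) (from_coords A c (chart_inv c x) u)
                               (from_coords A c (chart_inv c x) v))
        (snd c ` fst c))"

definition tangent_norm :: "('m \<Rightarrow> 'e \<Rightarrow> 'e \<Rightarrow> real) \<Rightarrow> 'm \<Rightarrow> 'e \<Rightarrow> real" where
  "tangent_norm G p v = sqrt (G p v v)"

definition C1_curve_on ::
    "('m::topological_space, 'e::euclidean_space) chart set \<Rightarrow> real set \<Rightarrow> (real \<Rightarrow> 'm) \<Rightarrow> bool" where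
  "C1_curve_on A I \<gamma> \<longleftrightarrow> continuous_on I \<gamma> \<and>
     (\<forall>c\<in>A. \<exists>D. continuous_on (I \<inter> \<gamma> -` fst c) D \<and>
        (\<forall>t \<in> I \<inter> \<gamma> -` fst c. ((snd c \<circ> \<gamma>) has_vector_derivative D t) (at t within I)))"

text \<open>Here \<open>T\<close> is the set of points of a partition of the unit interval.\<close>

definition piecewise_C1_curve ::
    "('m::topological_space, 'e::euclidean_space) chart set \<Rightarrow> (real \<Rightarrow> 'm) \<Rightarrow> bool" where
  "piecewise_C1_curve A \<gamma> \<longleftrightarrow>
     (\<exists>T. finite T \<and> {0, 1} \<subseteq> T \<and> T \<subseteq> {0..1} \<and>
        (\<forall>a\<in>T. \<forall>b\<in>T. a < b \<and> {a<..<b} \<inter> T = {} \<longrightarrow> C1_curve_on A {a..b} \<gamma>))"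

definition velocity ::
    "('m, 'e::euclidean_space) chart set \<Rightarrow> (real \<Rightarrow> 'm) \<Rightarrow> real \<Rightarrow> 'e" where
  "velocity A \<gamma> t = vector_derivative (snd (chart_at A (\<gamma> t)) \<circ> \<gamma>) (at t)"

text \<open>For a piecewise \<open>C\<^sup>1\<close> curve the integrand is bounded and piecewise continuous up to its values
  at finitely many points.\<close>

definition curve_length ::
    "('m, 'e::euclidean_space) chart set \<Rightarrow> ('m \<Rightarrow> 'e \<Rightarrow> 'e \<Rightarrow> real) \<Rightarrow> (real \<Rightarrow> 'm) \<Rightarrow> real" where
  "curve_length A G \<gamma> = integral {0..1} (\<lambda>t. tangent_norm G (\<gamma> t) (velocity A \<gamma> t))"

text \<open>The distance takes values in \<^typ>\<open>ennreal\<close> because it is infinite between points of different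
  components; on a connected manifold it is finite.\<close>

definition riem_dist ::
    "('m::topological_space, 'e::euclidean_space) chart set \<Rightarrow> ('m \<Rightarrow> 'e \<Rightarrow> 'e \<Rightarrow> real)
      \<Rightarrow> 'm \<Rightarrow> 'm \<Rightarrow> ennreal" where
  "riem_dist A G p q =
     (INF \<gamma>\<in>{\<gamma>. piecewise_C1_curve A \<gamma> \<and> \<gamma> 0 = p \<and> \<gamma> 1 = q}. ennreal (curve_length A G \<gamma>))"


section \<open>Nonwandering points and hyperbolicity\<close>

definition nonwandering_set :: "('m::topological_space \<Rightarrow> 'm) \<Rightarrow> 'm set" where
  "nonwandering_set f =
     {p. \<forall>U. open U \<and> p \<in> U \<longrightarrow> (\<exists>n\<ge>1. (f ^^ n) ` U \<inter> U \<noteq> {})}"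

definition hyperbolic_set ::
    "('m::topological_space, 'e::euclidean_space) chart set \<Rightarrow> ('m \<Rightarrow> 'e \<Rightarrow> 'e \<Rightarrow> real)
      \<Rightarrow> ('m \<Rightarrow> 'm) \<Rightarrow> 'm set \<Rightarrow> bool" where
  "hyperbolic_set A G f \<Lambda> \<longleftrightarrow> compact \<Lambda> \<and> f ` \<Lambda> = \<Lambda> \<and>
     (\<exists>(Es :: 'm \<Rightarrow> 'e set) (Eu :: 'm \<Rightarrow> 'e set) (C :: real) (\<mu> :: real).
        C > 0 \<and> 0 < \<mu> \<and> \<mu> < 1 \<and>
        (\<forall>p\<in>\<Lambda>.
           subspace (Es p) \<and> subspace (Eu p) \<and>
           Es p \<inter> Eu p = {0} \<and> (\<forall>w. \<exists>u\<in>Es p. \<exists>v\<in>Eu p. w = u + v) \<and>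
           tangent_map A f p ` Es p = Es (f p) \<and>
           tangent_map A f p ` Eu p = Eu (f p) \<and>
           (\<forall>n. \<forall>v\<in>Es p.
              tangent_norm G ((f ^^ n) p) (tangent_map A (f ^^ n) p v)
                \<le> C * \<mu> ^ n * tangent_norm G p v) \<and>
           (\<forall>n. \<forall>v\<in>Eu p.
              tangent_norm G ((inv f ^^ n) p) (tangent_map A (inv f ^^ n) p v)
                \<le> C * \<mu> ^ n * tangent_norm G p v)))"


section \<open>Ergodic inverse shadowing\<close>

text \<open>From here on \<open>\<rho>\<close> is an extended distance function on \<open>'m\<close>. On a compact manifold the supremum
  below is attained for continuous mappings.\<close>

definition dist_C0 :: "('m \<Rightarrow> 'm \<Rightarrow> ennreal) \<Rightarrow> ('m \<Rightarrow> 'm) \<Rightarrow> ('m \<Rightarrow> 'm) \<Rightarrow> ennreal" where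
  "dist_C0 \<rho> g h = (SUP x. \<rho> (g x) (h x))"

definition is_method :: "(nat \<Rightarrow> 'm::topological_space \<Rightarrow> 'm) \<Rightarrow> bool" where
  "is_method g \<longleftrightarrow> (\<forall>k. continuous_on UNIV (g k))"

definition is_trajectory :: "(nat \<Rightarrow> 'm \<Rightarrow> 'm) \<Rightarrow> (nat \<Rightarrow> 'm) \<Rightarrow> bool" where
  "is_trajectory g y \<longleftrightarrow> (\<forall>k. y (Suc k) = g k (y k))"

definition d_method ::
    "('m \<Rightarrow> 'm \<Rightarrow> ennreal) \<Rightarrow> real \<Rightarrow> ('m::topological_space \<Rightarrow> 'm) \<Rightarrow> (nat \<Rightarrow> 'm \<Rightarrow> 'm) \<Rightarrow> bool" where
  "d_method \<rho> d f g \<longleftrightarrow> is_method g \<and> (\<forall>k. dist_C0 \<rho> (g k) f \<le> ennreal d)"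

definition Lip1 :: "('m \<Rightarrow> 'm \<Rightarrow> ennreal) \<Rightarrow> ('m \<Rightarrow> real) set" where
  "Lip1 \<rho> = {\<phi>. \<forall>p q. ennreal \<bar>\<phi> p - \<phi> q\<bar> \<le> \<rho> p q}"

definition EIS :: "('m \<Rightarrow> 'm \<Rightarrow> ennreal) \<Rightarrow> ('m::topological_space \<Rightarrow> 'm) \<Rightarrow> bool" where
  "EIS \<rho> f \<longleftrightarrow> surj f \<and> continuous_on UNIV f \<and>
     (\<forall>\<epsilon>::real. \<epsilon> > 0 \<longrightarrow> (\<exists>d::real. d > 0 \<and>
        (\<forall>x g. d_method \<rho> d f g \<longrightarrow>
           (\<exists>y. is_trajectory g y \<and>
              (\<forall>\<phi>\<in>Lip1 \<rho>.
                 limsup (\<lambda>n. ereal (1 / real n * (\<Sum>k=1..n. \<phi> ((f ^^ k) x) - \<phi> (y k))))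
                   \<le> ereal \<epsilon>)))))"

end

theory Submission
  imports Defs
begin

text \<open>Every trajectory of \<open>f\<close> converges to the nonwandering set \<open>\<Omega>\<close>, and averages ignore finitely many
  times, so it suffices to follow the trajectory while it stays in a small neighbourhood of \<open>\<Omega>\<close>. The
  time at which it enters that neighbourhood is not bounded, but a continuous map close to a
  homeomorphism of a closed manifold is surjective, so the point of the method at that time can be
  prescribed. Near \<open>\<Omega>\<close> an iterate \<open>f\<^sup>m\<close> contracts and expands strongly in finitely many charts, and its
  coordinate representatives along the trajectory are close to linear maps which almost preserve the
  hyperbolic splittings. On a finite time interval Brouwer's theorem then gives a trajectory of the
  method close to the given one, and compactness extends this to all times.\<close>

section \<open>Inverse shadowing along a hyperbolic sequence of linear maps\<close>

text \<open>The maps of a method are merely continuous: they need be neither injective nor close to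
  \<open>f\<close> in the C1 sense. The fixed point argument is therefore topological, and the
  shadowing trajectory need not be unique. A second obstacle is that the splitting lives only over
  \<Omega> and that its continuity is not part of the hypothesis. It is recovered from closedness of
  the two bundles, since stable vectors are exactly those satisfying the decay estimates, and time
  reversal treats the unstable ones. The splitting is not extended to a neighbourhood: each point of
  the trajectory borrows the splitting of a nearby point of \<Omega>. The borrowed points need not
  form an orbit, so the derivatives respect their splittings only up to small off-diagonal blocks,
  and \<open>hyp_block\<close> is designed to tolerate these. Instead of adapting the metric,
  \<open>m\<close> is taken so large that \<open>C * \<mu> ^ m\<close> is small against the
  distortion of the charts.\<close>

lemma linear_right_inverse_on:
  fixes M Q :: "'e::euclidean_space \<Rightarrow> 'e"
  assumes "linear M" "linear Q" "\<And>y. \<exists>v. M v = Q y"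
  obtains R where "linear R" "\<And>y. M (R y) = Q y"
proof -
  obtain v where v: "\<And>y. M (v y) = Q y" using assms(3) by metis
  \<comment> \<open>Preimages are picked on \<open>Basis\<close> only and extended linearly: a
    linear right inverse has a norm bound, which later gives the radius of the Brouwer ball.\<close>
  define R where "R y = (\<Sum>b\<in>Basis. (y \<bullet> b) *\<^sub>R v b)" for y
  have "linear R" unfolding R_def
    by (rule linearI) (simp_all add: inner_add_left scaleR_add_left sum.distrib scaleR_sum_right)
  moreover have "M (R y) = Q y" for y
  proof -
    have "M (R y) = (\<Sum>b\<in>Basis. (y \<bullet> b) *\<^sub>R Q b)"
      unfolding R_def using assms(1) by (simp add: linear_sum linear_scale v)
    also have "\<dots> = Q (\<Sum>b\<in>Basis. (y \<bullet> b) *\<^sub>R b)"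
      using assms(2) by (simp add: linear_sum linear_scale)
    finally show ?thesis by (simp add: euclidean_representation)
  qed
  ultimately show ?thesis using that by blast
qed

text \<open>A product of two balls rather than a single ball, because the component
  \<open>P v\<close> and its complement are controlled by different arguments, one running forwards
  and one backwards in time.\<close>

definition split_box :: "('e::euclidean_space \<Rightarrow> 'e) \<Rightarrow> real \<Rightarrow> 'e set" where
  "split_box P r = {v. norm (P v) \<le> r \<and> norm (v - P v) \<le> r}"

lemma split_box_norm: "v \<in> split_box P r \<Longrightarrow> norm v \<le> 2 * r"
  using norm_triangle_ineq[of "P v" "v - P v"] by (simp add: split_box_def)

lemma split_box_compact_convex:
  fixes P :: "'e::euclidean_space \<Rightarrow> 'e"
  assumes "linear P" "r \<ge> 0"
  shows "compact (split_box P r)" "convex (split_box P r)" "0 \<in> split_box P r"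
proof -
  have e: "split_box P r = P -` cball 0 r \<inter> (\<lambda>v. v - P v) -` cball 0 r"
    by (auto simp: split_box_def)
  have l: "linear (\<lambda>v. v - P v)" using assms(1) by (intro linear_compose_sub) (auto intro: linear_id[unfolded id_def])
  have "closed (split_box P r)" unfolding e
    using assms(1) l by (intro closed_Int closed_vimage closed_cball linear_continuous_on linear_conv_bounded_linear[THEN iffD1]) auto
  moreover have "bounded (split_box P r)"
    using split_box_norm unfolding bounded_iff by blast
  ultimately show "compact (split_box P r)" by (simp add: compact_eq_bounded_closed)
  show "convex (split_box P r)" unfolding e
    using assms(1) l by (intro convex_Int convex_linear_vimage convex_cball)
  show "0 \<in> split_box P r" using assms by (simp add: split_box_def linear_0)
qed

lemma linear_norm_bound:
  fixes L :: "'e::euclidean_space \<Rightarrow> 'f::euclidean_space"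
  assumes "linear L" obtains K where "K > 0" "\<And>x. norm (L x) \<le> K * norm x"
  using linear_bounded_pos[OF assms] by blast

text \<open>The nonlinear part of the dynamics is frozen outside the boxes. The frozen dynamics is globally
  defined, its unstable component at time \<open>n\<close> is a bounded perturbation of a surjective linear map,
  so by Brouwer's theorem it can be made to vanish. Expansion read backwards in time and contraction
  read forwards then keep that solution in the boxes, where nothing was frozen.\<close>

lemma hyperbolic_segment_exists:
  fixes P A \<Phi> :: "nat \<Rightarrow> 'e::euclidean_space \<Rightarrow> 'e" and n :: nat
  assumes r: "r > 0"
    and linP: "\<And>j. linear (P j)" and idem: "\<And>j v. P j (P j v) = P j v"
    and linA: "\<And>j. linear (A j)"
    and PAP: "\<And>j v. norm (P (Suc j) (A j (P j v))) \<le> norm (P j v) / 4"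
    and QAP: "\<And>j v. norm (A j (P j v) - P (Suc j) (A j (P j v))) \<le> norm (P j v) / 4"
    and PAQ: "\<And>j v. norm (P (Suc j) (A j (v - P j v))) \<le> norm (v - P j v) / 4"
    and QAQ: "\<And>j v. 4 * norm (v - P j v) \<le> norm (A j (v - P j v) - P (Suc j) (A j (v - P j v)))"
    and surj: "\<And>j w. \<exists>v. A j (v - P j v) - P (Suc j) (A j (v - P j v)) = w - P (Suc j) w"
    and cont: "\<And>j. continuous_on (split_box (P j) r) (\<Phi> j)"
    and errP: "\<And>j v. v \<in> split_box (P j) r \<Longrightarrow> norm (P (Suc j) (\<Phi> j v - A j v)) \<le> r / 4"
    and errQ: "\<And>j v. v \<in> split_box (P j) r \<Longrightarrow>
                 norm ((\<Phi> j v - A j v) - P (Suc j) (\<Phi> j v - A j v)) \<le> r / 4"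
  shows "\<exists>v. (\<forall>j\<le>n. v j \<in> split_box (P j) r) \<and> (\<forall>j<n. v (Suc j) = \<Phi> j (v j))"
proof -
  define Q where "Q j v = v - P j v" for j v
  have linQ: "linear (Q j)" for j
    unfolding Q_def using linP by (intro linear_compose_sub) (auto intro: linear_id[unfolded id_def])
  have PQ: "P j (Q j v) = 0" and QP: "Q j (P j v) = 0" and QQ: "Q j (Q j v) = Q j v"
    and dec: "v = P j v + Q j v" for j v
    using idem linP by (simp_all add: Q_def linear_diff)
  \<comment> \<open>\<open>B\<close> is the block-diagonal part of \<open>A\<close>; the
    off-diagonal blocks are moved into the error \<open>e\<close>. The unstable component of
    \<open>B j x\<close> then depends only on the unstable component of \<open>x\<close>.\<close>
  define B where "B j x = P (Suc j) (A j (P j x)) + Q (Suc j) (A j (Q j x))" for j x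
  define e where "e j v = \<Phi> j v - B j v" for j v
  \<comment> \<open>The nearest-point retraction onto the convex box; evaluating \<open>e\<close>
    after it is the freezing.\<close>
  define cl where "cl j = closest_point (split_box (P j) r)" for j
  note bx = split_box_compact_convex[OF linP, of r]
  have cl_in: "cl j x \<in> split_box (P j) r" for j x
    unfolding cl_def using bx[of j] r by (intro closest_point_in_set compact_imp_closed) auto
  have cl_id: "cl j x = x" if "x \<in> split_box (P j) r" for j x
    unfolding cl_def using that by (rule closest_point_self)
  have cl_cont: "continuous_on UNIV (cl j)" for j
    unfolding cl_def using bx[of j] r by (intro continuous_on_closest_point compact_imp_closed) auto
  have linc: "continuous_on T L" if "linear L" for L :: "'e \<Rightarrow> 'e" and T
    using that by (simp add: linear_continuous_on linear_conv_bounded_linear)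
  have linB: "linear (B j)" for j
  proof -
    have "B j = (\<lambda>x. (P (Suc j) \<circ> A j \<circ> P j) x + (Q (Suc j) \<circ> A j \<circ> Q j) x)"
      by (auto simp: B_def)
    then show ?thesis
      using linP linQ linA by (metis linear_compose linear_compose_add)
  qed
  have PB: "P (Suc j) (B j v) = P (Suc j) (A j (P j v))" and QB: "Q (Suc j) (B j v) = Q (Suc j) (A j (Q j v))" for j v
    using linP linQ by (simp_all add: B_def linear_add idem PQ QP QQ)
  \<comment> \<open>Half of the bound comes from the nonlinear error, the other half from an
    off-diagonal block of \<open>A\<close>.\<close>
  have Pe: "norm (P (Suc j) (e j v)) \<le> r / 2" if "v \<in> split_box (P j) r" for j v
  proof -
    have "A j v = A j (P j v) + A j (Q j v)" using dec[of v j] linA by (metis linear_add)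
    then have "P (Suc j) (e j v) = P (Suc j) (\<Phi> j v - A j v) + P (Suc j) (A j (Q j v))"
      using linP by (simp add: e_def linear_diff linear_add PB)
    moreover have "norm (P (Suc j) (A j (Q j v))) \<le> r / 4"
      using PAQ[of j v] that by (simp add: Q_def split_box_def)
    ultimately show ?thesis using errP[OF that] norm_triangle_ineq[of "P (Suc j) (\<Phi> j v - A j v)" "P (Suc j) (A j (Q j v))"] by simp
  qed
  have Qe: "norm (Q (Suc j) (e j v)) \<le> r / 2" if "v \<in> split_box (P j) r" for j v
  proof -
    have "A j v = A j (P j v) + A j (Q j v)" using dec[of v j] linA by (metis linear_add)
    then have "Q (Suc j) (e j v) = Q (Suc j) (\<Phi> j v - A j v) + Q (Suc j) (A j (P j v))"
      using linQ by (simp add: e_def linear_diff linear_add QB)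
    moreover have "norm (Q (Suc j) (A j (P j v))) \<le> r / 4"
      using QAP[of j v] that by (simp add: Q_def split_box_def)
    ultimately show ?thesis using errQ[OF that] norm_triangle_ineq[of "Q (Suc j) (\<Phi> j v - A j v)" "Q (Suc j) (A j (P j v))"] by (simp add: Q_def)
  qed
  define W where "W = (\<lambda>j u. rec_nat (Q 0 u) (\<lambda>j w. B j w + e j (cl j w)) j)"
  have W0: "W 0 u = Q 0 u" and WS: "W (Suc j) u = B j (W j u) + e j (cl j (W j u))" for j u
    by (simp_all add: W_def)
  define M where "M = (\<lambda>j u. rec_nat (Q 0 u) (\<lambda>j w. Q (Suc j) (A j w)) j)"
  have M0: "M 0 u = Q 0 u" and MS: "M (Suc j) u = Q (Suc j) (A j (M j u))" for j u
    by (simp_all add: M_def)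
  have QM: "Q j (M j u) = M j u" for j u
    by (cases j) (simp_all add: M0 MS QQ)
  have linM: "linear (M j)" for j
  proof (induction j)
    case 0 then show ?case using linQ by (simp add: M0[abs_def])
  next
    case (Suc j)
    have "M (Suc j) = Q (Suc j) \<circ> A j \<circ> M j" by (auto simp: MS)
    then show ?case using Suc linQ linA by (metis linear_compose)
  qed
  have e_cont: "continuous_on (split_box (P j) r) (e j)" for j
    unfolding e_def[abs_def] by (intro continuous_intros cont linc linB)
  have ecl_cont: "continuous_on UNIV (\<lambda>x. e j (cl j x))" for j
    using continuous_on_compose2[OF e_cont cl_cont] cl_in by blast
  have W_cont: "continuous_on UNIV (W j)" for j
  proof (induction j)
    case 0 then show ?case using linc linQ by (simp add: W0[abs_def])
  next
    case (Suc j)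
    show ?case unfolding WS[abs_def]
      using Suc by (intro continuous_intros continuous_on_compose2[OF linc[OF linB]] continuous_on_compose2[OF ecl_cont]) auto
  qed
  \<comment> \<open>The bound is uniform in \<open>u\<close>, although \<open>W j u\<close> and
    \<open>M j u\<close> are in general unbounded: their unstable difference starts at 0 and is
    driven only by errors of size at most \<open>r / 2\<close>.\<close>
  have E_bd: "\<exists>b. \<forall>u. norm (Q j (W j u) - M j u) \<le> b" for j
  proof (induction j)
    case 0 then show ?case by (auto simp: W0 M0 QQ)
  next
    case (Suc j)
    then obtain b where b: "\<And>u. norm (Q j (W j u) - M j u) \<le> b" by blast
    have lin: "linear (Q (Suc j) \<circ> A j)" using linQ linA by (metis linear_compose)
    obtain K where K: "K > 0" "\<And>x. norm (Q (Suc j) (A j x)) \<le> K * norm x"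
      using linear_norm_bound[OF lin] by auto
    have "norm (Q (Suc j) (W (Suc j) u) - M (Suc j) u) \<le> K * b + r / 2" for u
    proof -
      have "Q (Suc j) (W (Suc j) u) - M (Suc j) u
          = Q (Suc j) (A j (Q j (W j u) - M j u)) + Q (Suc j) (e j (cl j (W j u)))"
        using linQ linA by (simp add: WS MS linear_add linear_diff QB)
      moreover have "norm (Q (Suc j) (A j (Q j (W j u) - M j u))) \<le> K * b"
        using K b by (meson mult_left_mono order_trans less_imp_le)
      ultimately show ?thesis
        using Qe[OF cl_in, of j "W j u"] norm_triangle_ineq[of "Q (Suc j) (A j (Q j (W j u) - M j u))" "Q (Suc j) (e j (cl j (W j u)))"] by simp
    qed
    then show ?case by blast
  qed
  have M_surj: "\<exists>v. M j v = Q j y" for j y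
  proof (induction j arbitrary: y)
    case 0 then show ?case by (auto simp: M0)
  next
    case (Suc j)
    obtain v where "Q (Suc j) (A j (Q j v)) = Q (Suc j) y" using surj[of j y] by (auto simp: Q_def)
    moreover obtain v' where "M j v' = Q j v" using Suc by blast
    ultimately show ?case by (metis MS)
  qed
  obtain R where R: "linear R" "\<And>y. M n (R y) = Q n y"
    using linear_right_inverse_on[OF linM linQ M_surj] by blast
  obtain K where K: "K > 0" "\<And>x. norm (R x) \<le> K * norm x" using linear_norm_bound[OF R(1)] by blast
  define E where "E u = Q n (W n u) - M n u" for u
  obtain b where b: "\<And>u. norm (E u) \<le> b" using E_bd[of n] unfolding E_def by blast
  then have b0: "b \<ge> 0" using norm_ge_zero order_trans by blast
  have E_cont: "continuous_on UNIV E" unfolding E_def[abs_def]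
    by (intro continuous_intros continuous_on_compose2[OF linc[OF linQ] W_cont] linc linM) auto
  \<comment> \<open>The condition \<open>Q n (W n u) = 0\<close> reads \<open>M n u = - E u\<close>.
    It holds when \<open>u = - R (E u)\<close>, and the right-hand side always lies in the ball of
    radius \<open>K * b\<close>.\<close>
  have "\<exists>u. - R (E u) = u"
  proof (rule brouwer[of "cball 0 (K * b)" "\<lambda>u. - R (E u)"])
    show "continuous_on (cball 0 (K * b)) (\<lambda>u. - R (E u))"
      by (intro continuous_intros continuous_on_compose2[OF linc[OF R(1)]] continuous_on_subset[OF E_cont]) auto
    have "norm (R (E u)) \<le> K * b" for u using K b by (meson mult_left_mono order_trans less_imp_le)
    then show "(\<lambda>u. - R (E u)) \<in> cball 0 (K * b) \<rightarrow> cball 0 (K * b)" by auto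
    show "cball 0 (K * b) \<noteq> {}" using mult_nonneg_nonneg[OF less_imp_le[OF K(1)] b0] by auto
  qed auto
  then obtain u where u': "- R (E u) = u" by (rule exE)
  have u: "u = - R (E u)" by (rule u'[symmetric])
  have QE: "Q n (E u) = E u"
    unfolding E_def linear_diff[OF linQ] by (simp only: QQ QM)
  have "M n u = M n (- R (E u))" using u by (rule arg_cong)
  also have "\<dots> = - E u" by (simp only: linear_neg[OF linM] R QE)
  finally have fin: "Q n (W n u) = 0" by (simp add: E_def)
  \<comment> \<open>Forwards in time: contraction leaves \<open>r / 4\<close> and the error adds
    \<open>r / 2\<close>.\<close>
  have Pw: "norm (P j (W j u)) \<le> r" for j
  proof (induction j)
    case 0 then show ?case using r by (simp add: W0 PQ)
  next
    case (Suc j)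
    have "norm (P (Suc j) (W (Suc j) u)) \<le> norm (P (Suc j) (A j (P j (W j u)))) + norm (P (Suc j) (e j (cl j (W j u))))"
      using linP by (simp add: WS linear_add PB norm_triangle_ineq)
    also have "\<dots> \<le> r / 4 + r / 2"
      using PAP[of j "W j u"] Suc Pe[OF cl_in, of j "W j u"] by linarith
    finally show ?case using r by linarith
  qed
  \<comment> \<open>Backwards from the zero value at time \<open>n\<close>: the next unstable part
    and its error together give at most \<open>r + r / 2\<close>, and expansion divides this by
    4.\<close>
  have Qw: "norm (Q j (W j u)) \<le> r" if "j \<le> n" for j
    using that
  proof (induction rule: inc_induct)
    case base then show ?case using r by (simp add: fin)
  next
    case (step j)
    have "Q (Suc j) (A j (Q j (W j u))) = Q (Suc j) (W (Suc j) u) - Q (Suc j) (e j (cl j (W j u)))"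
      using linQ by (simp add: WS linear_add QB)
    then have "norm (Q (Suc j) (A j (Q j (W j u)))) \<le> r + r / 2"
      using step Qe[OF cl_in, of j "W j u"] norm_triangle_ineq4[of "Q (Suc j) (W (Suc j) u)" "Q (Suc j) (e j (cl j (W j u)))"] by simp
    then show ?case using QAQ[of "W j u" j] r by (simp add: Q_def)
  qed
  have box: "W j u \<in> split_box (P j) r" if "j \<le> n" for j
    using Pw[of j] Qw[OF that] by (simp add: split_box_def Q_def)
  moreover have "W (Suc j) u = \<Phi> j (W j u)" if "j < n" for j
    unfolding WS cl_id[OF box[OF less_imp_le[OF that]]] e_def by simp
  ultimately show ?thesis by (intro exI[of _ "\<lambda>j. W j u"]) simp
qed

section \<open>Continuity of splittings\<close>

lemma continuous_on_local:
  fixes f :: "'a::t2_space \<Rightarrow> 'b::topological_space"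
  assumes "\<And>x. x \<in> S \<Longrightarrow> \<exists>U. open U \<and> x \<in> U \<and> continuous_on (S \<inter> U) f"
  shows "continuous_on S f"
  unfolding continuous_on_eq_continuous_within
proof
  fix x assume "x \<in> S"
  then obtain U where U: "open U" "x \<in> U" "continuous_on (S \<inter> U) f" using assms by blast
  then have "continuous (at x within (S \<inter> U)) f"
    using \<open>x \<in> S\<close> by (simp add: continuous_on_eq_continuous_within)
  moreover have "at x within (S \<inter> U) = at x within S"
    by (rule at_within_nhd[of _ U]) (use U in auto)
  ultimately show "continuous (at x within S) f" by simp
qed

definition splitting :: "'e::euclidean_space set \<Rightarrow> 'e set \<Rightarrow> bool" where
  "splitting E F \<longleftrightarrow> subspace E \<and> subspace F \<and> E \<inter> F = {0} \<and> (\<forall>w. \<exists>u\<in>E. \<exists>v\<in>F. w = u + v)"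

definition split_proj :: "'e::euclidean_space set \<Rightarrow> 'e set \<Rightarrow> 'e \<Rightarrow> 'e" where
  "split_proj E F w = (THE u. u \<in> E \<and> w - u \<in> F)"

lemma split_proj_unique:
  assumes "splitting E F" "u \<in> E" "w - u \<in> F"
  shows "split_proj E F w = u"
  unfolding split_proj_def
proof (rule the_equality)
  fix u' assume u': "u' \<in> E \<and> w - u' \<in> F"
  have "u - u' \<in> E" "u - u' = (w - u') - (w - u)"
    using assms u' by (auto simp: splitting_def subspace_diff)
  then have "u - u' \<in> E \<inter> F" using assms u' by (metis IntI splitting_def subspace_diff)
  then have "u - u' = 0" using assms(1) unfolding splitting_def by blast
  then show "u' = u" by simp
qed (use assms in simp)

lemma split_proj:
  assumes "splitting E F"
  shows "split_proj E F w \<in> E" "w - split_proj E F w \<in> F"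
proof -
  obtain u v where "u \<in> E" "v \<in> F" "w = u + v" using assms unfolding splitting_def by blast
  then have "split_proj E F w = u" by (intro split_proj_unique assms) auto
  then show "split_proj E F w \<in> E" "w - split_proj E F w \<in> F"
    using \<open>u \<in> E\<close> \<open>v \<in> F\<close> \<open>w = u + v\<close> by auto
qed

lemma split_proj_id: "splitting E F \<Longrightarrow> u \<in> E \<Longrightarrow> split_proj E F u = u"
  by (rule split_proj_unique) (auto simp: splitting_def subspace_0)

lemma split_proj_zero: "splitting E F \<Longrightarrow> u \<in> F \<Longrightarrow> split_proj E F u = 0"
  by (rule split_proj_unique) (auto simp: splitting_def subspace_0)

lemma split_proj_linear:
  assumes "splitting E F" shows "linear (split_proj E F)"
proof (rule linearI)
  fix x y :: 'a and c :: real
  note s = split_proj[OF assms]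
  have "x + y - (split_proj E F x + split_proj E F y) = (x - split_proj E F x) + (y - split_proj E F y)"
    by simp
  then show "split_proj E F (x + y) = split_proj E F x + split_proj E F y"
    using assms s by (intro split_proj_unique) (metis splitting_def subspace_add)+
  have "c *\<^sub>R x - c *\<^sub>R split_proj E F x = c *\<^sub>R (x - split_proj E F x)" by (simp add: algebra_simps)
  then show "split_proj E F (c *\<^sub>R x) = c *\<^sub>R split_proj E F x"
    using assms s by (intro split_proj_unique) (metis splitting_def subspace_scale)+
qed

lemma compact_unit_graph:
  fixes E :: "'a::euclidean_space \<Rightarrow> 'e::euclidean_space set"
  assumes "compact S" "closed {(y, v). y \<in> S \<and> v \<in> E y}"
  shows "compact {(y, v). y \<in> S \<and> v \<in> E y \<and> norm v = r}"
proof -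
  have "{(y, v). y \<in> S \<and> v \<in> E y \<and> norm v = r} = {(y, v). y \<in> S \<and> v \<in> E y} \<inter> (S \<times> sphere 0 r)"
    by auto
  then show ?thesis using assms by (simp add: closed_Int_compact compact_Times)
qed

text \<open>The angle between the two subspaces is bounded below: if unit vectors of
  \<open>E y\<close> could be almost cancelled by vectors of \<open>F y\<close>, compactness and
  closedness of the bundles would give a nonzero vector in both.\<close>

lemma split_proj_bounded:
  fixes E F :: "'a::euclidean_space \<Rightarrow> 'e::euclidean_space set"
  assumes S: "compact S" and spl: "\<And>y. y \<in> S \<Longrightarrow> splitting (E y) (F y)"
    and cE: "closed {(y, v). y \<in> S \<and> v \<in> E y}" and cF: "closed {(y, v). y \<in> S \<and> v \<in> F y}"
  obtains K where "K > 0" "\<And>y v. y \<in> S \<Longrightarrow> norm (split_proj (E y) (F y) v) \<le> K * norm v"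
proof -
  \<comment> \<open>Components of a vector, scaled so that \<open>norm s = 1\<close>. The radius 2
    makes the set compact; if \<open>u\<close> is longer than \<open>2 * norm s\<close>, the
    triangle inequality alone bounds \<open>s\<close>.\<close>
  define Z where "Z = ({(y, v). y \<in> S \<and> v \<in> E y} \<times> UNIV) \<inter>
     ((\<lambda>((y, s), u). (y, u)) -` {(y, v). y \<in> S \<and> v \<in> F y}) \<inter> ((S \<times> sphere 0 1) \<times> cball 0 2)"
  have "continuous_on UNIV (\<lambda>((y::'a, s::'e), u::'e). (y, u))"
    unfolding case_prod_unfold by (intro continuous_intros)
  then have "closed ((\<lambda>((y::'a, s::'e), u::'e). (y, u)) -` {(y, v). y \<in> S \<and> v \<in> F y})"
    using cF by (intro closed_vimage) auto
  then have Z: "compact Z" unfolding Z_def using cE S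
    by (intro closed_Int_compact closed_Int closed_Times compact_Times) auto
  have pos: "norm (s + u) > 0" if "((y, s), u) \<in> Z" for y s u
  proof (rule ccontr)
    assume "\<not> norm (s + u) > 0"
    then have "s = - u" by (simp add: eq_neg_iff_add_eq_0)
    moreover have "u \<in> F y" "s \<in> E y" "y \<in> S" "norm s = 1" using that by (auto simp: Z_def)
    ultimately have "s \<in> E y \<inter> F y" using spl[of y] unfolding splitting_def by (metis IntI subspace_neg)
    moreover have "E y \<inter> F y = {0}" using spl[OF \<open>y \<in> S\<close>] by (simp add: splitting_def)
    ultimately have "s = 0" by simp
    then show False using \<open>norm s = 1\<close> by simp
  qed
  have "\<exists>m>0. \<forall>((y, s), u)\<in>Z. m \<le> norm (s + u)"
  proof (cases "Z = {}")
    case True then show ?thesis by (auto intro: exI[of _ 1])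
  next
    case False
    have "continuous_on Z (\<lambda>((y, s), u). norm (s + u))"
      unfolding case_prod_unfold by (intro continuous_intros)
    from continuous_attains_inf[OF Z False this] obtain y s u
      where z: "((y, s), u) \<in> Z" "\<forall>w\<in>Z. norm (s + u) \<le> (\<lambda>((y, s), u). norm (s + u)) w"
      by (auto simp: case_prod_unfold)
    then show ?thesis by (intro exI[of _ "norm (s + u)"]) (use pos[OF z(1)] in \<open>auto simp: case_prod_unfold\<close>)
  qed
  then obtain m where m: "m > 0" "\<And>y s u. ((y, s), u) \<in> Z \<Longrightarrow> m \<le> norm (s + u)" by fast
  have "norm (split_proj (E y) (F y) v) \<le> max 1 (1 / m) * norm v" if y: "y \<in> S" for y v
  proof -
    define s u where "s = split_proj (E y) (F y) v" and "u = v - s"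
    have su: "s \<in> E y" "u \<in> F y" "v = s + u" using split_proj[OF spl[OF y]] by (auto simp: s_def u_def)
    show ?thesis
    proof (cases "norm u \<le> 2 * norm s")
      case False
      have "norm s \<le> norm v" using False norm_triangle_ineq4[of v s] su(3) by auto
      also have "\<dots> \<le> max 1 (1 / m) * norm v" by (simp add: mult_right_le_one_le mult_le_cancel_right1)
      finally show ?thesis by (simp add: s_def)
    next
      case True
      show ?thesis
      proof (cases "s = 0")
        case True then show ?thesis using m by (simp add: s_def[symmetric])
      next
        case False
        have "((y, s /\<^sub>R norm s), u /\<^sub>R norm s) \<in> Z"
          using True False y su spl[OF y] by (auto simp: Z_def splitting_def subspace_scale field_simps)
        then have "m \<le> norm (s /\<^sub>R norm s + u /\<^sub>R norm s)" by (rule m)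
        also have "s /\<^sub>R norm s + u /\<^sub>R norm s = v /\<^sub>R norm s" by (simp add: su scaleR_add_right)
        finally have "m * norm s \<le> norm v" using False by (simp add: field_simps)
        then have "norm s \<le> 1 / m * norm v" using m by (simp add: field_simps)
        also have "\<dots> \<le> max 1 (1 / m) * norm v" by (intro mult_right_mono) auto
        finally show ?thesis by (simp add: s_def)
      qed
    qed
  qed
  then show ?thesis using that[of "max 1 (1 / m)"] by simp
qed

text \<open>The graph of the projection is cut out by the closed conditions
  \<open>s \<in> E y\<close> and \<open>v - s \<in> F y\<close>. For bounded \<open>v\<close> the
  values stay in a compact ball, and a map into a compact set with closed graph is
  continuous.\<close>

lemma split_proj_continuous:
  fixes E F :: "'a::euclidean_space \<Rightarrow> 'e::euclidean_space set"
  assumes S: "compact S" and spl: "\<And>y. y \<in> S \<Longrightarrow> splitting (E y) (F y)"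
    and cE: "closed {(y, v). y \<in> S \<and> v \<in> E y}" and cF: "closed {(y, v). y \<in> S \<and> v \<in> F y}"
  shows "continuous_on (S \<times> UNIV) (\<lambda>(y, v). split_proj (E y) (F y) v)"
proof (rule continuous_on_local)
  let ?f = "\<lambda>(y, v). split_proj (E y) (F y) v"
  obtain K where K: "K > 0" "\<And>y v. y \<in> S \<Longrightarrow> norm (split_proj (E y) (F y) v) \<le> K * norm v"
    using split_proj_bounded[OF assms] by blast
  fix x :: "'a \<times> 'e" assume "x \<in> S \<times> UNIV"
  define R where "R = norm (snd x) + 1"
  define T where "T = S \<times> cball (0::'e) R"
  have "continuous_on T ?f"
  proof (rule continuous_from_closed_graph)
    show "compact (cball 0 (K * R) :: 'e set)" by simp
    show "?f \<in> T \<rightarrow> cball 0 (K * R)"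
    proof
      fix t assume "t \<in> T"
      then obtain y v where t: "t = (y, v)" "y \<in> S" "norm v \<le> R" by (auto simp: T_def)
      then have "norm (?f t) \<le> K * norm v" using K by simp
      also have "\<dots> \<le> K * R" using t K by (intro mult_left_mono) auto
      finally show "?f t \<in> cball 0 (K * R)" by simp
    qed
    have eq: "(\<lambda>x. (x, ?f x)) ` T = ((\<lambda>((y, v), s). (y, s)) -` {(y, v). y \<in> S \<and> v \<in> E y}) \<inter>
       ((\<lambda>((y, v), s). (y, v - s)) -` {(y, v). y \<in> S \<and> v \<in> F y}) \<inter> (T \<times> UNIV)" (is "?L = ?R")
    proof
      show "?L \<subseteq> ?R" using split_proj[OF spl] by (auto simp: T_def)
      show "?R \<subseteq> ?L"
      proof
        fix z assume "z \<in> ?R"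
        then obtain y v s where z: "z = ((y, v), s)" "y \<in> S" "s \<in> E y" "v - s \<in> F y" "(y, v) \<in> T" by auto
        then have "split_proj (E y) (F y) v = s" by (intro split_proj_unique spl)
        then show "z \<in> ?L" using z by (auto intro!: image_eqI[of _ _ "(y, v)"])
      qed
    qed
    have c1: "continuous_on UNIV (\<lambda>((y::'a, v::'e), s::'e). (y, s))"
      and c2: "continuous_on UNIV (\<lambda>((y::'a, v::'e), s::'e). (y, v - s))"
      unfolding case_prod_unfold by (intro continuous_intros)+
    have "closed T" using S by (simp add: T_def closed_Times compact_imp_closed)
    then show "closed ((\<lambda>x. (x, ?f x)) ` T)"
      unfolding eq using c1 c2 cE cF by (intro closed_Int closed_vimage closed_Times) auto
  qed
  moreover have "(S \<times> UNIV) \<inter> (UNIV \<times> ball 0 R) \<subseteq> T" by (auto simp: T_def)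
  ultimately have "continuous_on ((S \<times> UNIV) \<inter> (UNIV \<times> ball 0 R)) ?f" by (rule continuous_on_subset)
  moreover have "open (UNIV \<times> ball (0::'e) R :: ('a \<times> 'e) set)" "x \<in> UNIV \<times> ball 0 R"
    by (auto simp: open_Times R_def mem_Times_iff)
  ultimately show "\<exists>U. open U \<and> x \<in> U \<and> continuous_on ((S \<times> UNIV) \<inter> U) ?f" by blast
qed

section \<open>Hyperbolic linear maps between slightly mismatched splittings\<close>

text \<open>The points of \<open>K\<close> where the strict inequality fails form a compact set
  missing the graph of \<open>F\<close>, so \<open>dist (F y) y'\<close> has a positive minimum on
  it. In this way an estimate at \<open>y' = F y\<close> is carried over to nearby
  \<open>y'\<close>.\<close>

lemma strict_ineq_near_graph:
  fixes K :: "('a::metric_space \<times> 'b::metric_space \<times> 'c::metric_space) set" and \<psi> :: "_ \<Rightarrow> real"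
  assumes K: "compact K" and F: "continuous_on X F" and X: "\<And>y y' s. (y, y', s) \<in> K \<Longrightarrow> y \<in> X"
    and \<psi>: "continuous_on K \<psi>" and neg: "\<And>y s. (y, F y, s) \<in> K \<Longrightarrow> \<psi> (y, F y, s) < 0"
  obtains \<eta> where "\<eta> > 0" "\<And>y y' s. (y, y', s) \<in> K \<Longrightarrow> dist (F y) y' < \<eta> \<Longrightarrow> \<psi> (y, y', s) < 0"
proof -
  define Z where "Z = {k \<in> K. 0 \<le> \<psi> k}"
  have "closedin (top_of_set K) Z"
    unfolding Z_def using continuous_closedin_preimage[OF \<psi>, of "{0..}"]
    by (simp add: vimage_def Int_def)
  then have Z: "compact Z" using K closedin_compact by blast
  let ?d = "\<lambda>(y, y', s). dist (F y) y'"
  have cd: "continuous_on Z ?d" unfolding case_prod_unfold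
    using X by (intro continuous_intros continuous_on_compose2[OF F]) (auto simp: Z_def)
  have "\<exists>\<eta>>0. \<forall>z\<in>Z. \<eta> \<le> ?d z"
  proof (cases "Z = {}")
    case True then show ?thesis by (auto intro: exI[of _ 1])
  next
    case False
    from continuous_attains_inf[OF Z False cd] obtain z where z: "z \<in> Z" "\<forall>w\<in>Z. ?d z \<le> ?d w" by blast
    have "?d z > 0"
    proof (rule ccontr)
      assume n: "\<not> ?d z > 0"
      obtain y y' s where zz: "z = (y, y', s)" by (cases z)
      with n have "y' = F y" by simp
      then show False using neg[of y s] z(1) zz by (auto simp: Z_def)
    qed
    then show ?thesis using z by blast
  qed
  then obtain \<eta> where "\<eta> > 0" "\<forall>z\<in>Z. \<eta> \<le> ?d z" by blast
  then show ?thesis by (intro that[of \<eta>]) (force simp: Z_def)+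
qed

lemma finite_uniform:
  fixes Q :: "'i \<Rightarrow> real \<Rightarrow> bool"
  assumes "finite I" "\<And>i. i \<in> I \<Longrightarrow> \<exists>\<delta>>0. Q i \<delta>" "\<And>i \<delta> \<delta>'. Q i \<delta> \<Longrightarrow> 0 < \<delta>' \<Longrightarrow> \<delta>' \<le> \<delta> \<Longrightarrow> Q i \<delta>'"
  shows "\<exists>\<delta>>0. \<forall>i\<in>I. Q i \<delta>"
  using assms(1,2)
proof (induction I)
  case empty then show ?case by (auto intro: exI[of _ 1])
next
  case (insert x F)
  then obtain \<delta> \<delta>' where "\<delta> > 0" "\<forall>i\<in>F. Q i \<delta>" "\<delta>' > 0" "Q x \<delta>'" by (metis insertCI)
  then show ?case using assms(3) by (intro exI[of _ "min \<delta> \<delta>'"]) (auto intro: assms(3)[of _ \<delta>] assms(3)[of _ \<delta>'])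
qed

text \<open>The hypotheses on the linear part in \<open>hyperbolic_segment_exists\<close>, for a
  single step: bounds for the four blocks of \<open>A\<close> with respect to the splittings of
  \<open>P\<close> and \<open>P'\<close>, and surjectivity of the unstable block.\<close>

definition hyp_block :: "('e::euclidean_space \<Rightarrow> 'e) \<Rightarrow> ('e \<Rightarrow> 'e) \<Rightarrow> ('e \<Rightarrow> 'e) \<Rightarrow> bool" where
  "hyp_block P P' A \<longleftrightarrow> (\<forall>v.
     norm (P' (A (P v))) \<le> norm (P v) / 4 \<and>
     norm (A (P v) - P' (A (P v))) \<le> norm (P v) / 4 \<and>
     norm (P' (A (v - P v))) \<le> norm (v - P v) / 4 \<and>
     4 * norm (v - P v) \<le> norm (A (v - P v) - P' (A (v - P v)))) \<and>
     (\<forall>w. \<exists>v. A (v - P v) - P' (A (v - P v)) = w - P' w)"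

text \<open>At \<open>y' = F y\<close> the off-diagonal blocks vanish, and the diagonal ones beat
  1/4 and 4 strictly because \<open>l < 1/4\<close>. Strict inequalities on compact sets of unit
  vectors persist for nearby \<open>y'\<close>, and homogeneity removes the normalisation.
  Surjectivity of the unstable block is a dimension count.\<close>

lemma near_hyp_block:
  fixes X S' :: "'e::euclidean_space set" and Es Eu Es' Eu' :: "'e \<Rightarrow> 'e set" and F :: "'e \<Rightarrow> 'e"
    and A B :: "'e \<Rightarrow> 'e \<Rightarrow>\<^sub>L 'e"
  assumes X: "compact X" and spl: "\<And>y. y \<in> X \<Longrightarrow> splitting (Es y) (Eu y)"
    and cEs: "closed {(y, v). y \<in> X \<and> v \<in> Es y}" and cEu: "closed {(y, v). y \<in> X \<and> v \<in> Eu y}"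
    and S': "compact S'" and spl': "\<And>y. y \<in> S' \<Longrightarrow> splitting (Es' y) (Eu' y)"
    and cEs': "closed {(y, v). y \<in> S' \<and> v \<in> Es' y}" and cEu': "closed {(y, v). y \<in> S' \<and> v \<in> Eu' y}"
    and F: "continuous_on X F" and FX: "\<And>y. y \<in> X \<Longrightarrow> F y \<in> S'"
    and A: "continuous_on X A" and B: "continuous_on X B"
    and BA: "\<And>y w. y \<in> X \<Longrightarrow> B y (A y w) = w" and AB: "\<And>y w. y \<in> X \<Longrightarrow> A y (B y w) = w"
    and As: "\<And>y v. y \<in> X \<Longrightarrow> v \<in> Es y \<Longrightarrow> A y v \<in> Es' (F y)"
    and Au: "\<And>y v. y \<in> X \<Longrightarrow> v \<in> Eu y \<Longrightarrow> A y v \<in> Eu' (F y)"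
    and l: "0 < l" "l < 1/4"
    and contr: "\<And>y v. y \<in> X \<Longrightarrow> v \<in> Es y \<Longrightarrow> norm (A y v) \<le> l * norm v"
    and expa: "\<And>y v. y \<in> X \<Longrightarrow> v \<in> Eu y \<Longrightarrow> norm v \<le> l * norm (A y v)"
  obtains \<eta> where "\<eta> > 0" "\<And>y y'. y \<in> X \<Longrightarrow> y' \<in> S' \<Longrightarrow> dist (F y) y' < \<eta> \<Longrightarrow>
     hyp_block (split_proj (Es y) (Eu y)) (split_proj (Es' y') (Eu' y')) (A y)"
proof -
  define P where "P y = split_proj (Es y) (Eu y)" for y
  define P' where "P' y = split_proj (Es' y) (Eu' y)" for y
  have cP: "continuous_on (X \<times> UNIV) (\<lambda>z. P (fst z) (snd z))"
    using split_proj_continuous[OF X spl cEs cEu] by (simp add: P_def case_prod_unfold)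
  have cP': "continuous_on (S' \<times> UNIV) (\<lambda>z. P' (fst z) (snd z))"
    using split_proj_continuous[OF S' spl' cEs' cEu'] by (simp add: P'_def case_prod_unfold)
  note cP2 = continuous_on_compose2[OF cP, of _ "\<lambda>z. (f z, g z)" for f g, simplified]
  note cP2' = continuous_on_compose2[OF cP', of _ "\<lambda>z. (f z, g z)" for f g, simplified]
  \<comment> \<open>\<open>A y\<close> is only known to map \<open>Eu y\<close> into
    \<open>Eu' (F y)\<close>. That the inverse maps back follows because the stable part of
    \<open>B y u\<close> has its image in both target subspaces.\<close>
  have Bu: "B y u \<in> Eu y" if "y \<in> X" "u \<in> Eu' (F y)" for y u
  proof -
    define s where "s = P y (B y u)"
    have s: "s \<in> Es y" "B y u - s \<in> Eu y" using split_proj[OF spl[OF that(1)]] by (auto simp: s_def P_def)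
    have "A y s = u - A y (B y u - s)" using that by (simp add: blinfun.diff_right AB)
    moreover have "A y (B y u - s) \<in> Eu' (F y)" using Au that s by blast
    ultimately have "A y s \<in> Eu' (F y)"
      using that spl'[OF FX[OF that(1)]] by (simp add: splitting_def subspace_diff)
    then have "A y s \<in> Es' (F y) \<inter> Eu' (F y)" using As s that by blast
    then have "A y s = 0" using spl'[OF FX[OF that(1)]] by (auto simp: splitting_def)
    then have "s = 0" using BA[OF that(1), of s] by (simp add: blinfun.zero_right)
    then show ?thesis using s by simp
  qed
  \<comment> \<open>Triples of base point, candidate for the image point, and unit vector; in
    \<open>Kv\<close> the vector sits over the candidate, for estimating the inverse
    \<open>B\<close>.\<close>
  define Ks where "Ks = (\<lambda>((y, v), y'). (y, y', v)) ` ({(y, v). y \<in> X \<and> v \<in> Es y \<and> norm v = 1} \<times> S')"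
  define Ku where "Ku = (\<lambda>((y, v), y'). (y, y', v)) ` ({(y, v). y \<in> X \<and> v \<in> Eu y \<and> norm v = 1} \<times> S')"
  define Kv where "Kv = (\<lambda>((y', v), y). (y, y', v)) ` ({(y, v). y \<in> S' \<and> v \<in> Eu' y \<and> norm v = 1} \<times> X)"
  have Ks: "compact Ks" "\<And>y y' v. (y, y', v) \<in> Ks \<longleftrightarrow> y \<in> X \<and> y' \<in> S' \<and> v \<in> Es y \<and> norm v = 1"
    unfolding Ks_def by (intro compact_continuous_image compact_Times compact_unit_graph X S' cEs)
      (auto simp: split_beta' image_iff intro!: continuous_intros)
  have Ku: "compact Ku" "\<And>y y' v. (y, y', v) \<in> Ku \<longleftrightarrow> y \<in> X \<and> y' \<in> S' \<and> v \<in> Eu y \<and> norm v = 1"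
    unfolding Ku_def by (intro compact_continuous_image compact_Times compact_unit_graph X S' cEu)
      (auto simp: split_beta' image_iff intro!: continuous_intros)
  have Kv: "compact Kv" "\<And>y y' v. (y, y', v) \<in> Kv \<longleftrightarrow> y \<in> X \<and> y' \<in> S' \<and> v \<in> Eu' y' \<and> norm v = 1"
    unfolding Kv_def by (intro compact_continuous_image compact_Times compact_unit_graph X S' cEu')
      (auto simp: split_beta' image_iff intro!: continuous_intros)
  have near: "\<exists>\<eta>>0. \<forall>y y' v. (y, y', v) \<in> K \<longrightarrow> dist (F y) y' < \<eta> \<longrightarrow> \<psi> (y, y', v) < 0"
    if "compact K" "K = Ks \<or> K = Ku \<or> K = Kv" "continuous_on K \<psi>"
      "\<And>y v. (y, F y, v) \<in> K \<Longrightarrow> \<psi> (y, F y, v) < 0" for K and \<psi> :: "'e \<times> 'e \<times> 'e \<Rightarrow> real"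
    by (rule strict_ineq_near_graph[OF that(1) F _ that(3,4)]) (use that(2) Ks(2) Ku(2) Kv(2) in \<open>blast+\<close>)
  have KX: "fst z \<in> X \<and> fst (snd z) \<in> S'" if "z \<in> Ks \<union> Ku \<union> Kv" for z
    using that Ks(2) Ku(2) Kv(2) by (metis UnE prod.collapse)
  have cA: "continuous_on K (\<lambda>z. A (fst z) (snd (snd z)))" if "K \<subseteq> Ks \<union> Ku \<union> Kv" for K
    using that KX by (intro blinfun.continuous_on continuous_intros continuous_on_compose2[OF A]) auto
  have cB: "continuous_on K (\<lambda>z. B (fst z) (snd (snd z)))" if "K \<subseteq> Ks \<union> Ku \<union> Kv" for K
    using that KX by (intro blinfun.continuous_on continuous_intros continuous_on_compose2[OF B]) auto
  have cPA: "continuous_on K (\<lambda>z. P' (fst (snd z)) (A (fst z) (snd (snd z))))" if "K \<subseteq> Ks \<union> Ku \<union> Kv" for K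
    using that by (intro cP2' cA continuous_intros) (auto dest!: subsetD[OF that] simp: Ks(2) Ku(2) Kv(2))
  have cPB: "continuous_on K (\<lambda>z. P (fst z) (B (fst z) (snd (snd z))))" if "K \<subseteq> Ks \<union> Ku \<union> Kv" for K
    using that by (intro cP2 cB continuous_intros) (auto dest!: subsetD[OF that] simp: Ks(2) Ku(2) Kv(2))
  note spF = spl'[OF FX]
  have small: "norm (A y v) < 1/4" if "y \<in> X" "v \<in> Es y" "norm v = 1" for y v
    using contr[OF that(1,2)] that l by simp
  have large: "norm (A y v) > 4" if "y \<in> X" "v \<in> Eu y" "norm v = 1" for y v
  proof -
    have "1 \<le> l * norm (A y v)" using expa[OF that(1,2)] that by simp
    moreover have "l * norm (A y v) \<le> l * 4" if "norm (A y v) \<le> 4" using that l by (intro mult_left_mono) auto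
    ultimately show ?thesis using l by (cases "norm (A y v) \<le> 4") linarith+
  qed
  obtain e1 where e1: "e1 > 0" "\<And>y y' v. (y, y', v) \<in> Ks \<Longrightarrow> dist (F y) y' < e1 \<Longrightarrow> norm (P' y' (A y v)) < 1/4"
  proof -
    have "continuous_on Ks (\<lambda>z. norm (P' (fst (snd z)) (A (fst z) (snd (snd z)))) - 1/4)"
      by (intro continuous_intros cPA) auto
    from near[OF Ks(1) _ this] show ?thesis
      using that small by (fastforce simp: Ks(2) P'_def split_proj_id[OF spF As])
  qed
  obtain e2 where e2: "e2 > 0" "\<And>y y' v. (y, y', v) \<in> Ks \<Longrightarrow> dist (F y) y' < e2 \<Longrightarrow> norm (A y v - P' y' (A y v)) < 1/4"
  proof -
    have "continuous_on Ks (\<lambda>z. norm (A (fst z) (snd (snd z)) - P' (fst (snd z)) (A (fst z) (snd (snd z)))) - 1/4)"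
      by (intro continuous_intros cPA cA) auto
    from near[OF Ks(1) _ this] show ?thesis
      using that by (fastforce simp: Ks(2) P'_def split_proj_id[OF spF As])
  qed
  obtain e3 where e3: "e3 > 0" "\<And>y y' v. (y, y', v) \<in> Ku \<Longrightarrow> dist (F y) y' < e3 \<Longrightarrow> norm (P' y' (A y v)) < 1/4"
  proof -
    have "continuous_on Ku (\<lambda>z. norm (P' (fst (snd z)) (A (fst z) (snd (snd z)))) - 1/4)"
      by (intro continuous_intros cPA) auto
    from near[OF Ku(1) _ this] show ?thesis
      using that by (fastforce simp: Ku(2) P'_def split_proj_zero[OF spF Au])
  qed
  obtain e4 where e4: "e4 > 0" "\<And>y y' v. (y, y', v) \<in> Ku \<Longrightarrow> dist (F y) y' < e4 \<Longrightarrow> 4 < norm (A y v - P' y' (A y v))"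
  proof -
    have "continuous_on Ku (\<lambda>z. 4 - norm (A (fst z) (snd (snd z)) - P' (fst (snd z)) (A (fst z) (snd (snd z)))))"
      by (intro continuous_intros cPA cA) auto
    from near[OF Ku(1) _ this] show ?thesis
      using that large by (fastforce simp: Ku(2) P'_def split_proj_zero[OF spF Au])
  qed
  \<comment> \<open>Only injectivity of the unstable block of \<open>B\<close> is wanted here, hence
    nonvanishing instead of a quantitative bound.\<close>
  obtain e5 where e5: "e5 > 0" "\<And>y y' v. (y, y', v) \<in> Kv \<Longrightarrow> dist (F y) y' < e5 \<Longrightarrow> 0 < norm (B y v - P y (B y v))"
  proof -
    have c: "continuous_on Kv (\<lambda>z. - norm (B (fst z) (snd (snd z)) - P (fst z) (B (fst z) (snd (snd z)))))"
      by (intro continuous_intros cPB cB) auto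
    have "B y v \<noteq> 0" if "y \<in> X" "norm v = 1" for y v using AB[OF that(1), of v] that by (auto simp: blinfun.zero_right)
    then have "norm (B y v - P y (B y v)) > 0" if "y \<in> X" "v \<in> Eu' (F y)" "norm v = 1" for y v
      using that Bu by (simp add: P_def split_proj_zero[OF spl])
    with near[OF Kv(1) _ c] show ?thesis using that by (fastforce simp: Kv(2))
  qed
  define \<eta> where "\<eta> = Min {e1, e2, e3, e4, e5}"
  have \<eta>: "\<eta> > 0" "\<eta> \<le> e1" "\<eta> \<le> e2" "\<eta> \<le> e3" "\<eta> \<le> e4" "\<eta> \<le> e5"
    using e1(1) e2(1) e3(1) e4(1) e5(1) by (auto simp: \<eta>_def)
  have "hyp_block (P y) (P' y') (A y)" if y: "y \<in> X" "y' \<in> S'" "dist (F y) y' < \<eta>" for y y'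
  proof -
    note sp = spl[OF y(1)] and sp' = spl'[OF y(2)]
    have linP: "linear (P y)" "linear (P' y')" unfolding P_def P'_def using sp sp' split_proj_linear by auto
    have linA: "linear (A y)" "linear (B y)" by (auto intro: bounded_linear.linear blinfun.bounded_linear_right)
    have subs: "subspace (Es y)" "subspace (Eu y)" "subspace (Eu' y')" using sp sp' by (auto simp: splitting_def)
    have unit: "norm (v /\<^sub>R norm v) = 1" if "v \<noteq> 0" for v :: 'e using that by simp
    have s1: "norm (P' y' (A y v)) \<le> norm v / 4" "norm (A y v - P' y' (A y v)) \<le> norm v / 4" if "v \<in> Es y" for v
    proof (atomize (full), cases "v = 0")
      case True then show "norm (P' y' (A y v)) \<le> norm v / 4 \<and> norm (A y v - P' y' (A y v)) \<le> norm v / 4"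
        using linP by (simp add: linear_0 blinfun.zero_right)
    next
      case False
      have k: "(y, y', v /\<^sub>R norm v) \<in> Ks" using unit[OF False] y that subs by (simp add: Ks(2) subspace_scale)
      show "norm (P' y' (A y v)) \<le> norm v / 4 \<and> norm (A y v - P' y' (A y v)) \<le> norm v / 4"
        using e1(2)[OF k] e2(2)[OF k] y \<eta> False linP linA
        by (simp add: linear_scale scaleR_diff_right[symmetric] divide_simps)
    qed
    have u1: "norm (P' y' (A y v)) \<le> norm v / 4" "4 * norm v \<le> norm (A y v - P' y' (A y v))" if "v \<in> Eu y" for v
    proof (atomize (full), cases "v = 0")
      case True then show "norm (P' y' (A y v)) \<le> norm v / 4 \<and> 4 * norm v \<le> norm (A y v - P' y' (A y v))"
        using linP by (simp add: linear_0 blinfun.zero_right)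
    next
      case False
      have k: "(y, y', v /\<^sub>R norm v) \<in> Ku" using unit[OF False] y that subs by (simp add: Ku(2) subspace_scale)
      show "norm (P' y' (A y v)) \<le> norm v / 4 \<and> 4 * norm v \<le> norm (A y v - P' y' (A y v))"
        using e3(2)[OF k] e4(2)[OF k] y \<eta> False linP linA
        by (simp add: linear_scale scaleR_diff_right[symmetric] divide_simps)
    qed
    have v1: "B y v - P y (B y v) \<noteq> 0" if "v \<in> Eu' y'" "v \<noteq> 0" for v
    proof -
      have k: "(y, y', v /\<^sub>R norm v) \<in> Kv" using unit[OF that(2)] y that subs by (simp add: Kv(2) subspace_scale)
      show ?thesis
        using e5(2)[OF k] y \<eta> that linP linA by (simp add: linear_scale scaleR_diff_right[symmetric] zero_less_mult_iff)
    qed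
    define M where "M v = A y v - P' y' (A y v)" for v
    define N where "N v = B y v - P y (B y v)" for v
    have "M = (\<lambda>v. A y v - (P' y' \<circ> A y) v)" "N = (\<lambda>v. B y v - (P y \<circ> B y) v)"
      by (auto simp: M_def N_def)
    then have linM: "linear M" and linN: "linear N"
      using linP linA by (metis linear_compose linear_compose_sub)+
    have MI: "M ` Eu y \<subseteq> Eu' y'" and NI: "N ` Eu' y' \<subseteq> Eu y"
      using split_proj[OF sp] split_proj[OF sp'] by (auto simp: M_def N_def P_def P'_def)
    have injM: "inj_on M (Eu y)"
      using u1 subs by (subst linear_injective_on_subspace_0[OF linM subs(2)]) (fastforce simp: M_def)
    have injN: "inj_on N (Eu' y')"
      using v1 subs by (subst linear_injective_on_subspace_0[OF linN subs(3)]) (auto simp: N_def)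
    \<comment> \<open>The block \<open>N\<close> of the inverse serves to compare dimensions:
      injectivity of \<open>N\<close> and \<open>M\<close> forces equal dimensions, so
      \<open>M\<close> maps onto \<open>Eu' y'\<close>.\<close>
    have "dim (Eu' y') = dim (N ` Eu' y')" using injN subs by (subst dim_image_eq[OF linN]) (auto simp: span_eq_iff[THEN iffD2])
    also have "\<dots> \<le> dim (Eu y)" using NI by (rule dim_subset)
    also have "\<dots> = dim (M ` Eu y)" using injM subs by (subst dim_image_eq[OF linM]) (auto simp: span_eq_iff[THEN iffD2])
    finally have "M ` Eu y = Eu' y'" using MI subs linM by (intro subspace_dim_equal linear_subspace_image)
    then have surj: "\<exists>v. A y (v - P y v) - P' y' (A y (v - P y v)) = w - P' y' w" for w
    proof -
      have "w - P' y' w \<in> M ` Eu y" using \<open>M ` Eu y = Eu' y'\<close> split_proj[OF sp'] by (simp add: P'_def)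
      then obtain v where "v \<in> Eu y" "M v = w - P' y' w" by auto
      then show ?thesis by (intro exI[of _ v]) (simp add: M_def P_def split_proj_zero[OF sp])
    qed
    have "P y v \<in> Es y" "v - P y v \<in> Eu y" for v using split_proj[OF sp] by (auto simp: P_def)
    then show ?thesis unfolding hyp_block_def using s1 u1 surj by blast
  qed
  then show ?thesis using that \<eta>(1) unfolding P_def P'_def by blast
qed

section \<open>Differential calculus in charts\<close>

definition chart_rep :: "('m \<Rightarrow> 'm) \<Rightarrow> ('m, 'e::euclidean_space) chart \<Rightarrow> ('m, 'e) chart \<Rightarrow> 'e \<Rightarrow> 'e" where
  "chart_rep \<phi> c c' = snd c' \<circ> \<phi> \<circ> chart_inv c"

definition rep_dom :: "('m \<Rightarrow> 'm) \<Rightarrow> ('m, 'e::euclidean_space) chart \<Rightarrow> ('m, 'e) chart \<Rightarrow> 'e set" where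
  "rep_dom \<phi> c c' = snd c ` (fst c \<inter> \<phi> -` fst c')"

text \<open>Bundling the derivative as a bounded linear map lets its dependence on \<open>y\<close>
  be continuous in operator norm. The value is meaningful only where the representative is
  differentiable.\<close>

definition rep_deriv ::
    "('m \<Rightarrow> 'm) \<Rightarrow> ('m, 'e::euclidean_space) chart \<Rightarrow> ('m, 'e) chart \<Rightarrow> 'e \<Rightarrow> 'e \<Rightarrow>\<^sub>L 'e" where
  "rep_deriv \<phi> c c' y = Blinfun (frechet_derivative (chart_rep \<phi> c c') (at y))"

locale riemannian_manifold =
  fixes A :: "('m::t2_space, 'e::euclidean_space) chart set"
    and G :: "'m \<Rightarrow> 'e \<Rightarrow> 'e \<Rightarrow> real"
  assumes closed_manifold: "closed_smooth_manifold A"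
    and metric: "riemannian_metric A G"
begin

lemma compact_UNIV_manifold: "compact (UNIV :: 'm set)"
  using closed_manifold by (simp add: closed_smooth_manifold_def)

lemma atlas: "smooth_atlas A"
  using closed_manifold by (simp add: closed_smooth_manifold_def)

lemma chart_at: "chart_at A p \<in> A" "p \<in> fst (chart_at A p)"
proof -
  have "\<exists>c. c \<in> A \<and> p \<in> fst c" using atlas by (fastforce simp: smooth_atlas_def)
  then have "chart_at A p \<in> A \<and> p \<in> fst (chart_at A p)" unfolding chart_at_def by (rule someI_ex)
  then show "chart_at A p \<in> A" "p \<in> fst (chart_at A p)" by auto
qed

lemma chart:
  assumes "c \<in> A"
  shows open_chart: "open (fst c)" and open_chart_image: "open (snd c ` fst c)"
    and chart_homeo: "homeomorphism (fst c) (snd c ` fst c) (snd c) (chart_inv c)"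
  using assms atlas by (auto simp: smooth_atlas_def is_chart_def)

lemma chart_inv_chart: "c \<in> A \<Longrightarrow> p \<in> fst c \<Longrightarrow> chart_inv c (snd c p) = p"
  using chart_homeo by (simp add: homeomorphism_def)

lemma chart_chart_inv: "c \<in> A \<Longrightarrow> y \<in> snd c ` fst c \<Longrightarrow> snd c (chart_inv c y) = y"
  by (rule homeomorphism_apply2[OF chart_homeo])

lemma chart_inv_mem: "c \<in> A \<Longrightarrow> y \<in> snd c ` fst c \<Longrightarrow> chart_inv c y \<in> fst c"
  using chart_inv_chart by fastforce

lemma chart_cont: "c \<in> A \<Longrightarrow> continuous_on (fst c) (snd c)"
  using chart_homeo by (simp add: homeomorphism_def)

lemma chart_inv_cont: "c \<in> A \<Longrightarrow> continuous_on (snd c ` fst c) (chart_inv c)"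
  using chart_homeo by (simp add: homeomorphism_def)

lemma open_chart_preimage:
  assumes "c \<in> A" "open S" shows "open (fst c \<inter> snd c -` S)"
  using continuous_open_preimage[OF chart_cont open_chart] assms by blast

lemma open_chart_image_subset:
  assumes "c \<in> A" "open S" "S \<subseteq> fst c" shows "open (snd c ` S)"
proof -
  have "snd c ` S = snd c ` fst c \<inter> chart_inv c -` S"
  proof (intro equalityI subsetI)
    show "y \<in> snd c ` fst c \<inter> chart_inv c -` S" if y: "y \<in> snd c ` S" for y
      using y assms(3) by (auto simp: chart_inv_chart[OF assms(1) subsetD[OF assms(3)]])
    show "y \<in> snd c ` S" if y: "y \<in> snd c ` fst c \<inter> chart_inv c -` S" for y
      using y by (metis IntD1 IntD2 chart_chart_inv[OF assms(1)] imageI vimageD)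
  qed
  then show ?thesis
    using continuous_open_preimage[OF chart_inv_cont[OF assms(1)] open_chart_image[OF assms(1)] assms(2)] by simp
qed

lemma rep_dom_iff: "c \<in> A \<Longrightarrow> y \<in> rep_dom \<phi> c c' \<longleftrightarrow>
    y \<in> snd c ` fst c \<and> \<phi> (chart_inv c y) \<in> fst c'"
  by (auto simp: rep_dom_def chart_inv_chart)

lemma chart_in_rep_dom: "c \<in> A \<Longrightarrow> p \<in> fst c \<Longrightarrow> \<phi> p \<in> fst c' \<Longrightarrow> snd c p \<in> rep_dom \<phi> c c'"
  by (auto simp: rep_dom_def)

lemma open_rep_dom:
  assumes "c \<in> A" "c' \<in> A" "continuous_on UNIV \<phi>" shows "open (rep_dom \<phi> c c')"
  unfolding rep_dom_def
proof (rule open_chart_image_subset[OF assms(1)])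
  show "open (fst c \<inter> \<phi> -` fst c')"
    using open_chart[OF assms(1)] open_vimage[OF open_chart[OF assms(2)] assms(3)] by (rule open_Int)
qed auto

text \<open>\<open>Ck_on\<close> provides continuity of the derivative in each fixed direction; in
  finite dimension this upgrades to continuity in operator norm.\<close>

lemma C1_map_derivative:
  assumes "C1_map A \<phi>" "c \<in> A" "c' \<in> A"
  shows "y \<in> rep_dom \<phi> c c' \<Longrightarrow> (chart_rep \<phi> c c' has_derivative rep_deriv \<phi> c c' y) (at y)"
    and "continuous_on (rep_dom \<phi> c c') (rep_deriv \<phi> c c')"
proof -
  have op: "open (rep_dom \<phi> c c')" using assms by (intro open_rep_dom) (auto simp: C1_map_def)
  have ck: "Ck_on 1 (chart_rep \<phi> c c') (rep_dom \<phi> c c')"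
    using assms by (auto simp: C1_map_def chart_rep_def rep_dom_def)
  then have d: "chart_rep \<phi> c c' differentiable (at y)" if "y \<in> rep_dom \<phi> c c'" for y
    using that op by (auto simp: differentiable_on_eq_differentiable_at)
  have ap: "blinfun_apply (rep_deriv \<phi> c c' y) = frechet_derivative (chart_rep \<phi> c c') (at y)"
    if "y \<in> rep_dom \<phi> c c'" for y
    unfolding rep_deriv_def using d[OF that]
    by (intro bounded_linear_Blinfun_apply has_derivative_bounded_linear) (auto simp: frechet_derivative_works)
  show "y \<in> rep_dom \<phi> c c' \<Longrightarrow> (chart_rep \<phi> c c' has_derivative rep_deriv \<phi> c c' y) (at y)"
    using d ap by (simp add: frechet_derivative_works[symmetric])
  have "continuous_on (rep_dom \<phi> c c') (\<lambda>y. rep_deriv \<phi> c c' y v)" for v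
    using ck ap by (simp cong: continuous_on_cong)
  then show "continuous_on (rep_dom \<phi> c c') (rep_deriv \<phi> c c')"
    by (intro continuous_on_blinfun_componentwise)
qed

lemma rep_deriv_eqI:
  assumes "(chart_rep \<phi> c c' has_derivative blinfun_apply D) (at y)"
  shows "rep_deriv \<phi> c c' y = D"
  unfolding rep_deriv_def using frechet_derivative_at[OF assms, symmetric] by (simp add: blinfun_apply_inverse)

lemma C1_map_id: "C1_map A id"
proof -
  have "Ck_on 1 (snd c' \<circ> id \<circ> chart_inv c) (snd c ` (fst c \<inter> id -` fst c'))" if "c \<in> A" "c' \<in> A" for c c'
  proof -
    have "smooth_on (snd c' \<circ> chart_inv c) (snd c ` (fst c \<inter> fst c'))"
      using atlas that by (auto simp: smooth_atlas_def)
    then show ?thesis unfolding smooth_on_def by (simp only: comp_id vimage_id id_apply)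
  qed
  then show ?thesis by (auto simp: C1_map_def id_def continuous_on_id)
qed

lemma chart_rep_comp_derivative:
  assumes "C1_map A \<phi>" "C1_map A \<psi>" "c \<in> A" "c' \<in> A" "c'' \<in> A"
    and p: "p \<in> fst c" "\<phi> p \<in> fst c'" "\<psi> (\<phi> p) \<in> fst c''"
  shows "(chart_rep (\<psi> \<circ> \<phi>) c c'' has_derivative
      blinfun_apply (rep_deriv \<psi> c' c'' (snd c' (\<phi> p)) o\<^sub>L rep_deriv \<phi> c c' (snd c p))) (at (snd c p))"
proof -
  let ?y = "snd c p"
  have y: "?y \<in> rep_dom \<phi> c c'" using assms by (intro chart_in_rep_dom)
  have e: "chart_rep \<phi> c c' ?y = snd c' (\<phi> p)" using assms by (simp add: chart_rep_def chart_inv_chart)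
  have d1: "(chart_rep \<phi> c c' has_derivative rep_deriv \<phi> c c' ?y) (at ?y)"
    using assms y by (intro C1_map_derivative)
  have d2: "(chart_rep \<psi> c' c'' has_derivative rep_deriv \<psi> c' c'' (snd c' (\<phi> p))) (at (chart_rep \<phi> c c' ?y))"
    unfolding e using assms by (intro C1_map_derivative chart_in_rep_dom)
  have "(chart_rep \<psi> c' c'' \<circ> chart_rep \<phi> c c' has_derivative
      blinfun_apply (rep_deriv \<psi> c' c'' (snd c' (\<phi> p)) o\<^sub>L rep_deriv \<phi> c c' ?y)) (at ?y)"
    using diff_chain_at[OF d1 d2] by (simp add: blinfun_compose.rep_eq o_def)
  then show ?thesis
  proof (rule has_derivative_transform_within_open)
    show "open (rep_dom \<phi> c c')" using assms by (intro open_rep_dom) (auto simp: C1_map_def)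
    show "(chart_rep \<psi> c' c'' \<circ> chart_rep \<phi> c c') x = chart_rep (\<psi> \<circ> \<phi>) c c'' x" if "x \<in> rep_dom \<phi> c c'" for x
      using that assms by (simp add: chart_rep_def rep_dom_iff chart_inv_chart)
  qed (use y in auto)
qed

lemma rep_deriv_comp:
  assumes "C1_map A \<phi>" "C1_map A \<psi>" "c \<in> A" "c' \<in> A" "c'' \<in> A"
    "p \<in> fst c" "\<phi> p \<in> fst c'" "\<psi> (\<phi> p) \<in> fst c''"
  shows "rep_deriv (\<psi> \<circ> \<phi>) c c'' (snd c p) =
      rep_deriv \<psi> c' c'' (snd c' (\<phi> p)) o\<^sub>L rep_deriv \<phi> c c' (snd c p)"
  by (rule rep_deriv_eqI[OF chart_rep_comp_derivative[OF assms]])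

lemma continuous_on_chart_comp:
  assumes "c \<in> A" "continuous_on UNIV \<phi>" shows "continuous_on (snd c ` fst c) (\<lambda>y. \<phi> (chart_inv c y))"
  using assms by (intro continuous_on_compose2[OF assms(2) chart_inv_cont]) auto

lemma continuous_on_chart_rep:
  assumes "c \<in> A" "c' \<in> A" "continuous_on UNIV \<phi>" shows "continuous_on (rep_dom \<phi> c c') (chart_rep \<phi> c c')"
  unfolding chart_rep_def o_def using assms
  by (intro continuous_on_compose2[OF chart_cont[OF assms(2)]]
      continuous_on_subset[OF continuous_on_chart_comp]) (auto simp: rep_dom_iff)

text \<open>The chart around the intermediate point varies with the base point, so continuity of the
  derivative is checked locally, with one intermediate chart at a time. This makes all iterates of
  \<open>f\<close> and of its inverse C1.\<close>

lemma C1_map_comp: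
  assumes \<phi>: "C1_map A \<phi>" and \<psi>: "C1_map A \<psi>" shows "C1_map A (\<psi> \<circ> \<phi>)"
proof -
  have cont: "continuous_on UNIV \<phi>" "continuous_on UNIV \<psi>" using assms by (auto simp: C1_map_def)
  have cont': "continuous_on UNIV (\<psi> \<circ> \<phi>)" using cont by (metis continuous_on_compose continuous_on_subset subset_UNIV)
  have "Ck_on 1 (chart_rep (\<psi> \<circ> \<phi>) c c'') (rep_dom (\<psi> \<circ> \<phi>) c c'')" if c: "c \<in> A" "c'' \<in> A" for c c''
  proof -
    let ?S = "rep_dom (\<psi> \<circ> \<phi>) c c''"
    have pt: "\<exists>p. y = snd c p \<and> p \<in> fst c \<and> \<psi> (\<phi> p) \<in> fst c''" if "y \<in> ?S" for y
      using that by (auto simp: rep_dom_def)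
    have op: "open ?S" using c cont' by (intro open_rep_dom)
    have "chart_rep (\<psi> \<circ> \<phi>) c c'' differentiable (at y)" if "y \<in> ?S" for y
      using pt[OF that] chart_rep_comp_derivative[OF \<phi> \<psi> c(1) chart_at(1) c(2) _ chart_at(2)]
      unfolding differentiable_def by blast
    then have "chart_rep (\<psi> \<circ> \<phi>) c c'' differentiable_on ?S"
      by (simp add: differentiable_on_eq_differentiable_at[OF op])
    moreover have "continuous_on ?S (\<lambda>y. frechet_derivative (chart_rep (\<psi> \<circ> \<phi>) c c'') (at y) v)" for v
    proof (rule continuous_on_local)
      fix y assume y: "y \<in> ?S"
      then obtain p where p: "y = snd c p" "p \<in> fst c" "\<psi> (\<phi> p) \<in> fst c''" using pt by blast
      define c' where "c' = chart_at A (\<phi> p)"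
      have c': "c' \<in> A" "\<phi> p \<in> fst c'" by (auto simp: c'_def chart_at)
      let ?U = "rep_dom \<phi> c c'"
      have eq: "frechet_derivative (chart_rep (\<psi> \<circ> \<phi>) c c'') (at z) v
          = rep_deriv \<psi> c' c'' (chart_rep \<phi> c c' z) (rep_deriv \<phi> c c' z v)" if "z \<in> ?S \<inter> ?U" for z
      proof -
        define q where "q = chart_inv c z"
        have q: "z = snd c q" "q \<in> fst c" "\<psi> (\<phi> q) \<in> fst c''" "\<phi> q \<in> fst c'"
          using that chart_chart_inv[OF c(1)] chart_inv_mem[OF c(1)]
          unfolding q_def Int_iff rep_dom_iff[OF c(1)] by auto
        have "chart_rep \<phi> c c' z = snd c' (\<phi> q)" using q c by (simp add: chart_rep_def chart_inv_chart)
        then show ?thesis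
          using frechet_derivative_at[OF chart_rep_comp_derivative[OF \<phi> \<psi> c(1) c'(1) c(2) q(2,4,3)], symmetric] q
          by simp
      qed
      have "continuous_on (?S \<inter> ?U) (\<lambda>z. rep_deriv \<psi> c' c'' (chart_rep \<phi> c c' z) (rep_deriv \<phi> c c' z v))"
        using c c' \<phi> \<psi> cont
        by (intro blinfun.continuous_on continuous_intros
              continuous_on_compose2[OF C1_map_derivative(2)[OF \<psi> c'(1) c(2)]]
              continuous_on_subset[OF continuous_on_chart_rep] continuous_on_subset[OF C1_map_derivative(2)])
           (auto simp: rep_dom_iff chart_rep_def chart_inv_chart)
      then have "continuous_on (?S \<inter> ?U) (\<lambda>y. frechet_derivative (chart_rep (\<psi> \<circ> \<phi>) c c'') (at y) v)"
        by (rule continuous_on_eq) (simp add: eq)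
      moreover have "open ?U" "y \<in> ?U" using c c' cont p by (auto intro: open_rep_dom chart_in_rep_dom)
      ultimately show "\<exists>U. open U \<and> y \<in> U \<and> continuous_on (?S \<inter> U) (\<lambda>y. frechet_derivative (chart_rep (\<psi> \<circ> \<phi>) c c'') (at y) v)"
        by blast
    qed
    ultimately show ?thesis by simp
  qed
  then show ?thesis using cont' unfolding C1_map_def chart_rep_def rep_dom_def by blast
qed

lemma C1_map_funpow: "C1_map A \<phi> \<Longrightarrow> C1_map A (\<phi> ^^ n)"
  by (induction n) (auto intro: C1_map_comp C1_map_id)

lemma tangent_map_rep_deriv:
  assumes "C1_map A \<phi>"
  shows "tangent_map A \<phi> p = rep_deriv \<phi> (chart_at A p) (chart_at A (\<phi> p)) (snd (chart_at A p) p)"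
  unfolding tangent_map_def chart_rep_def[symmetric]
  by (rule frechet_derivative_at[symmetric], intro C1_map_derivative assms chart_at chart_in_rep_dom)

text \<open>Coordinate changes are representatives of \<open>id\<close>, so the chain rule
  \<open>rep_deriv_comp\<close> serves them and the dynamics alike.\<close>

lemma from_coords_rep_deriv:
  assumes "c \<in> A" "p \<in> fst c"
  shows "from_coords A c p = rep_deriv id c (chart_at A p) (snd c p)"
proof -
  have "from_coords A c p = frechet_derivative (chart_rep id c (chart_at A p)) (at (snd c p))"
    by (simp add: from_coords_def chart_rep_def)
  also have "\<dots> = rep_deriv id c (chart_at A p) (snd c p)"
    by (rule frechet_derivative_at[symmetric], intro C1_map_derivative C1_map_id assms chart_at chart_in_rep_dom)
      (simp add: chart_at)
  finally show ?thesis .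
qed

lemma from_coords_linear: "c \<in> A \<Longrightarrow> p \<in> fst c \<Longrightarrow> linear (from_coords A c p)"
  by (simp add: from_coords_rep_deriv bounded_linear.linear blinfun.bounded_linear_right)

lemma rep_deriv_id:
  assumes "c \<in> A" "p \<in> fst c" shows "rep_deriv id c c (snd c p) = id_blinfun"
proof (rule rep_deriv_eqI)
  show "(chart_rep id c c has_derivative blinfun_apply id_blinfun) (at (snd c p))"
  proof (rule has_derivative_transform_within_open[of "\<lambda>x. x"])
    show "open (snd c ` fst c)" using assms open_chart_image by blast
  qed (use assms in \<open>auto simp: chart_rep_def chart_inv_chart id_def\<close>)
qed

lemma from_coords_inverse:
  assumes "c \<in> A" "p \<in> fst c"
  shows "rep_deriv id (chart_at A p) c (snd (chart_at A p) p) (from_coords A c p v) = v"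
    and "from_coords A c p (rep_deriv id (chart_at A p) c (snd (chart_at A p) p) v) = v"
  using rep_deriv_comp[OF C1_map_id C1_map_id assms(1) chart_at(1) assms(1), of p p]
    rep_deriv_comp[OF C1_map_id C1_map_id chart_at(1) assms(1) chart_at(1), of p p p]
    assms chart_at
  by (simp_all add: rep_deriv_id from_coords_rep_deriv) (metis blinfun_apply_blinfun_compose id_blinfun.rep_eq)+

text \<open>Both sides are the derivative of \<open>\<phi>\<close> from the chart \<open>c\<close>
  to the chart chosen at \<open>\<phi> p\<close>, factored once through a change of chart after
  \<open>\<phi>\<close> and once before it.\<close>

lemma from_coords_rep_deriv_comm:
  assumes "C1_map A \<phi>" "c \<in> A" "c' \<in> A" "p \<in> fst c" "\<phi> p \<in> fst c'"
  shows "from_coords A c' (\<phi> p) (rep_deriv \<phi> c c' (snd c p) v) = tangent_map A \<phi> p (from_coords A c p v)"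
proof -
  have "rep_deriv (id \<circ> \<phi>) c (chart_at A (\<phi> p)) (snd c p) v = from_coords A c' (\<phi> p) (rep_deriv \<phi> c c' (snd c p) v)"
    using rep_deriv_comp[OF assms(1) C1_map_id assms(2,3) chart_at(1), of p "\<phi> p"] assms chart_at
    by (simp add: from_coords_rep_deriv)
  moreover have "rep_deriv (\<phi> \<circ> id) c (chart_at A (\<phi> p)) (snd c p) v = tangent_map A \<phi> p (from_coords A c p v)"
    using rep_deriv_comp[OF C1_map_id assms(1) assms(2) chart_at(1) chart_at(1), of p p "\<phi> p"] assms chart_at
    by (simp add: from_coords_rep_deriv tangent_map_rep_deriv)
  ultimately show ?thesis by simp
qed

lemma tangent_map_comp:
  assumes "C1_map A \<phi>" "C1_map A \<psi>"
  shows "tangent_map A (\<psi> \<circ> \<phi>) p v = tangent_map A \<psi> (\<phi> p) (tangent_map A \<phi> p v)"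
  using rep_deriv_comp[OF assms chart_at(1) chart_at(1) chart_at(1), of p p "\<phi> p" "\<psi> (\<phi> p)"] assms chart_at
  by (simp add: tangent_map_rep_deriv C1_map_comp)

lemma tangent_map_id: "tangent_map A id p v = v"
  by (simp add: tangent_map_rep_deriv C1_map_id rep_deriv_id chart_at)

lemma tangent_map_linear: "C1_map A \<phi> \<Longrightarrow> linear (tangent_map A \<phi> p)"
  by (simp add: tangent_map_rep_deriv bounded_linear.linear blinfun.bounded_linear_right)

section \<open>The Riemannian norm in coordinates\<close>

lemma metric_bilinear: "bilinear (G p)"
  and metric_pos: "v \<noteq> 0 \<Longrightarrow> G p v v > 0"
  using metric by (auto simp: riemannian_metric_def)

lemma tangent_norm_zero: "tangent_norm G p 0 = 0"
  using metric_bilinear[of p] by (simp add: tangent_norm_def bilinear_lzero)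

lemma tangent_norm_pos: "v \<noteq> 0 \<Longrightarrow> tangent_norm G p v > 0"
  using metric_pos by (simp add: tangent_norm_def)

lemma tangent_norm_nonneg: "tangent_norm G p v \<ge> 0"
  using tangent_norm_pos[of v p] tangent_norm_zero[of p] by (cases "v = 0") auto

lemma tangent_norm_scale: "tangent_norm G p (a *\<^sub>R v) = \<bar>a\<bar> * tangent_norm G p v"
  using metric_bilinear[of p]
  by (simp add: tangent_norm_def bilinear_lmul bilinear_rmul real_sqrt_mult mult.assoc[symmetric])

text \<open>The parallelogram identity with one square dropped. It stands in for the triangle
  inequality; the factor 2 is harmless where norms are shown to tend to 0.\<close>

lemma tangent_norm_diff_le: "(tangent_norm G p (u - v))\<^sup>2 \<le> 2 * (tangent_norm G p u)\<^sup>2 + 2 * (tangent_norm G p v)\<^sup>2"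
proof -
  have nn: "G p w w \<ge> 0" for w
    using metric_pos[of w p] metric_bilinear[of p] by (cases "w = 0") (auto simp: bilinear_lzero)
  have "G p (u + v) (u + v) + G p (u - v) (u - v) = 2 * G p u u + 2 * G p v v"
    using metric_bilinear[of p]
    by (simp add: bilinear_ladd bilinear_radd bilinear_lsub bilinear_rsub)
  then have "G p (u - v) (u - v) \<le> 2 * G p u u + 2 * G p v v" using nn[of "u + v"] by linarith
  then show ?thesis using nn by (simp add: tangent_norm_def)
qed

text \<open>\<open>tangent_norm\<close> refers to the chart chosen at each point, and this choice
  may jump. Pulled back to one fixed chart, the norm becomes continuous in the point.\<close>

definition chart_norm :: "('m, 'e) chart \<Rightarrow> 'e \<Rightarrow> 'e \<Rightarrow> real" where
  "chart_norm c y w = tangent_norm G (chart_inv c y) (from_coords A c (chart_inv c y) w)"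

lemma chart_norm_continuous:
  assumes c: "c \<in> A"
  shows "continuous_on ((snd c ` fst c) \<times> UNIV) (\<lambda>(y, w). chart_norm c y w)"
proof -
  let ?g = "\<lambda>y u v. G (chart_inv c y) (from_coords A c (chart_inv c y) u) (from_coords A c (chart_inv c y) v)"
  have g: "continuous_on (snd c ` fst c) (\<lambda>y. ?g y u v)" for u v
  proof -
    have "smooth_on (\<lambda>y. ?g y u v) (snd c ` fst c)" using metric c by (auto simp: riemannian_metric_def)
    then show ?thesis unfolding smooth_on_def by (metis Ck_on.simps(1))
  qed
  \<comment> \<open>Smoothness of the metric is given for fixed vectors only; expansion in
    \<open>Basis\<close> turns it into joint continuity in point and vector.\<close>
  have ex: "?g y w w = (\<Sum>i\<in>Basis. \<Sum>j\<in>Basis. (w \<bullet> i) * (w \<bullet> j) * ?g y i j)" if y: "y \<in> snd c ` fst c" for y w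
  proof -
    let ?p = "chart_inv c y"
    have lin: "linear (from_coords A c ?p)" using c y chart_inv_mem by (intro from_coords_linear)
    have "from_coords A c ?p w = from_coords A c ?p (\<Sum>i\<in>Basis. (w \<bullet> i) *\<^sub>R i)" by (simp add: euclidean_representation)
    also have "\<dots> = (\<Sum>i\<in>Basis. (w \<bullet> i) *\<^sub>R from_coords A c ?p i)"
      using lin by (simp add: linear_sum linear_scale)
    finally have "?g y w w = G ?p (\<Sum>i\<in>Basis. (w \<bullet> i) *\<^sub>R from_coords A c ?p i) (\<Sum>i\<in>Basis. (w \<bullet> i) *\<^sub>R from_coords A c ?p i)"
      by simp
    also have "\<dots> = (\<Sum>(i, j)\<in>Basis \<times> Basis. G ?p ((w \<bullet> i) *\<^sub>R from_coords A c ?p i) ((w \<bullet> j) *\<^sub>R from_coords A c ?p j))"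
      by (rule bilinear_sum[OF metric_bilinear])
    also have "\<dots> = (\<Sum>i\<in>Basis. \<Sum>j\<in>Basis. (w \<bullet> i) * (w \<bullet> j) * ?g y i j)"
      using metric_bilinear[of ?p]
      by (simp add: sum.cartesian_product bilinear_lmul bilinear_rmul mult.assoc)
    finally show ?thesis .
  qed
  have "continuous_on ((snd c ` fst c) \<times> UNIV) (\<lambda>z. sqrt (\<Sum>i\<in>Basis. \<Sum>j\<in>Basis. (snd z \<bullet> i) * (snd z \<bullet> j) * ?g (fst z) i j))"
    by (intro continuous_intros continuous_on_compose2[OF g]) auto
  then show ?thesis
    by (rule continuous_on_eq) (auto simp: chart_norm_def tangent_norm_def ex)
qed

lemma chart_norm_scale: "c \<in> A \<Longrightarrow> y \<in> snd c ` fst c \<Longrightarrow> chart_norm c y (a *\<^sub>R w) = \<bar>a\<bar> * chart_norm c y w"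
  unfolding chart_norm_def by (subst linear_scale[OF from_coords_linear]) (auto simp: chart_inv_chart tangent_norm_scale)

lemma chart_norm_pos: "c \<in> A \<Longrightarrow> y \<in> snd c ` fst c \<Longrightarrow> w \<noteq> 0 \<Longrightarrow> chart_norm c y w > 0"
proof -
  assume a: "c \<in> A" "y \<in> snd c ` fst c" "w \<noteq> 0"
  have "from_coords A c (chart_inv c y) w \<noteq> 0"
    using from_coords_inverse(1)[OF a(1) chart_inv_mem[OF a(1,2)], of w] a(3) by (auto simp: blinfun.zero_right)
  then show ?thesis unfolding chart_norm_def by (rule tangent_norm_pos)
qed

text \<open>The norm has a positive minimum and a maximum on the compact product of \<open>K\<close>
  with the unit sphere; homogeneity extends the comparison to all vectors.\<close>

lemma chart_norm_bounds:
  assumes c: "c \<in> A" and K: "compact K" "K \<subseteq> snd c ` fst c"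
  obtains k where "k > 0" "\<And>y w. y \<in> K \<Longrightarrow> norm w \<le> k * chart_norm c y w"
    "\<And>y w. y \<in> K \<Longrightarrow> chart_norm c y w \<le> k * norm w"
proof -
  let ?S = "K \<times> sphere (0::'e) 1"
  have S: "compact ?S" using K by (intro compact_Times) auto
  have ct: "continuous_on ?S (\<lambda>(y, w). chart_norm c y w)"
    using K by (intro continuous_on_subset[OF chart_norm_continuous[OF c]]) auto
  have "\<exists>k>0. \<forall>z\<in>?S. 1 \<le> k * (\<lambda>(y, w). chart_norm c y w) z \<and> (\<lambda>(y, w). chart_norm c y w) z \<le> k"
  proof (cases "?S = {}")
    case True show ?thesis unfolding True by (auto intro: exI[of _ 1])
  next
    case False
    obtain z where z: "z \<in> ?S" "\<forall>x\<in>?S. (\<lambda>(y, w). chart_norm c y w) z \<le> (\<lambda>(y, w). chart_norm c y w) x"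
      using continuous_attains_inf[OF S False ct] by blast
    obtain z' where z': "z' \<in> ?S" "\<forall>x\<in>?S. (\<lambda>(y, w). chart_norm c y w) x \<le> (\<lambda>(y, w). chart_norm c y w) z'"
      using continuous_attains_sup[OF S False ct] by blast
    define a where "a = (\<lambda>(y, w). chart_norm c y w) z"
    define b where "b = (\<lambda>(y, w). chart_norm c y w) z'"
    have "snd z \<noteq> 0" "fst z \<in> snd c ` fst c" using z(1) K by auto
    then have a: "a > 0" unfolding a_def using chart_norm_pos[OF c] by (simp add: case_prod_unfold)
    show ?thesis
    proof (intro exI[of _ "max (1 / a) b"] conjI ballI)
      show "0 < max (1 / a) b" using a by (simp add: less_max_iff_disj)
      fix x assume x: "x \<in> ?S"
      have "1 = 1 / a * a" using a by simp
      also have "\<dots> \<le> max (1 / a) b * (\<lambda>(y, w). chart_norm c y w) x"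
        using a z(2) x by (intro mult_mono) (auto simp: a_def less_max_iff_disj le_max_iff_disj)
      finally show "1 \<le> max (1 / a) b * (\<lambda>(y, w). chart_norm c y w) x" .
      show "(\<lambda>(y, w). chart_norm c y w) x \<le> max (1 / a) b" using z'(2) x by (auto simp: b_def le_max_iff_disj)
    qed
  qed
  then obtain k where k: "k > 0" "\<And>y w. y \<in> K \<Longrightarrow> norm w = 1 \<Longrightarrow> 1 \<le> k * chart_norm c y w \<and> chart_norm c y w \<le> k"
    by auto
  have "norm w \<le> k * chart_norm c y w \<and> chart_norm c y w \<le> k * norm w" if y: "y \<in> K" for y w
  proof (cases "w = 0")
    case True
    have "chart_norm c y (0 *\<^sub>R 0) = 0" using chart_norm_scale[OF c, of y 0 0] y K by auto
    then show ?thesis using True by simp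
  next
    case False
    have "chart_norm c y w = norm w * chart_norm c y (w /\<^sub>R norm w)"
      using chart_norm_scale[OF c, of y "norm w" "w /\<^sub>R norm w"] y K False by auto
    moreover have "1 \<le> k * chart_norm c y (w /\<^sub>R norm w) \<and> chart_norm c y (w /\<^sub>R norm w) \<le> k"
      using k(2)[OF y] False by simp
    moreover have "norm w * 1 \<le> norm w * (k * chart_norm c y (w /\<^sub>R norm w))" "norm w * chart_norm c y (w /\<^sub>R norm w) \<le> norm w * k"
      using calculation(2) by (intro mult_left_mono; simp)+
    ultimately show ?thesis by (simp add: mult_ac)
  qed
  then show ?thesis using that k(1) by blast
qed

end

section \<open>The Riemannian distance and the topology\<close>

lemma finite_partition_gap:
  fixes T :: "real set"
  assumes "finite T" "{0, 1} \<subseteq> T" "t \<in> {0..1}" "t \<notin> T"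
  obtains a b where "a \<in> T" "b \<in> T" "a < t" "t < b" "{a<..<b} \<inter> T = {}"
proof -
  define a where "a = Max {s \<in> T. s < t}"
  define b where "b = Min {s \<in> T. t < s}"
  have 0: "0 \<in> {s \<in> T. s < t}" "1 \<in> {s \<in> T. t < s}"
    using assms by (auto simp: less_le)
  have a: "a \<in> {s \<in> T. s < t}" unfolding a_def using assms(1) 0 by (intro Max_in) auto
  have b: "b \<in> {s \<in> T. t < s}" unfolding b_def using assms(1) 0 by (intro Min_in) auto
  have "{a<..<b} \<inter> T = {}"
  proof (rule ccontr)
    assume "{a<..<b} \<inter> T \<noteq> {}"
    then obtain s where s: "a < s" "s < b" "s \<in> T" by auto
    then have "s < t \<or> t < s" using assms(4) by (metis linorder_neqE)
    then show False
      using s Max_ge[of "{s \<in> T. s < t}" s] Min_le[of "{s \<in> T. t < s}" s] assms(1)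
      by (auto simp: a_def[symmetric] b_def[symmetric])
  qed
  then show ?thesis using a b by (intro that) auto
qed

lemma finite_partition_induct:
  fixes T :: "real set"
  assumes T: "finite T" "0 \<in> T" "T \<subseteq> {0..}" and x: "x \<in> T" and base: "P 0"
    and step: "\<And>y x. y \<in> T \<Longrightarrow> x \<in> T \<Longrightarrow> y < x \<Longrightarrow> {y<..<x} \<inter> T = {} \<Longrightarrow> P y \<Longrightarrow> P x"
  shows "P x"
  using x
proof (induction "card {t \<in> T. t < x}" arbitrary: x rule: less_induct)
  case (less x)
  show ?case
  proof (cases "x = 0")
    case False
    define y where "y = Max {t \<in> T. t < x}"
    have fin: "finite {t \<in> T. t < x}" using T(1) by simp
    have "0 \<in> {t \<in> T. t < x}" using False less.prems T by (force simp: less_le)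
    then have y: "y \<in> T" "y < x" using Max_in[OF fin] by (auto simp: y_def)
    have "{y<..<x} \<inter> T = {}"
    proof (rule ccontr)
      assume "{y<..<x} \<inter> T \<noteq> {}"
      then obtain s where "y < s" "s < x" "s \<in> T" by auto
      then show False using Max_ge[OF fin, of s] by (simp add: y_def[symmetric])
    qed
    moreover have "card {t \<in> T. t < y} < card {t \<in> T. t < x}"
      using y by (intro psubset_card_mono fin) auto
    ultimately show ?thesis using less y step by blast
  qed (use base in simp)
qed

lemma piecewise_C1_curveE:
  assumes "piecewise_C1_curve A \<gamma>"
  obtains T where "finite T" "{0, 1} \<subseteq> T" "T \<subseteq> {0..1}"
    "\<And>a b. a \<in> T \<Longrightarrow> b \<in> T \<Longrightarrow> a < b \<Longrightarrow> {a<..<b} \<inter> T = {} \<Longrightarrow> C1_curve_on A {a..b} \<gamma>"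
proof -
  obtain T where T: "finite T \<and> {0, 1} \<subseteq> T \<and> T \<subseteq> {0..1} \<and>
        (\<forall>a\<in>T. \<forall>b\<in>T. a < b \<and> {a<..<b} \<inter> T = {} \<longrightarrow> C1_curve_on A {a..b} \<gamma>)"
    using assms unfolding piecewise_C1_curve_def by (rule exE)
  show ?thesis by (rule that[of T]) (use T in simp_all)
qed

context riemannian_manifold
begin

lemma chart_change_vector_derivative:
  assumes c: "c \<in> A" "c' \<in> A" and t: "t \<in> I" "\<gamma> t \<in> fst c" "\<gamma> t \<in> fst c'"
    and \<gamma>: "continuous (at t within I) \<gamma>"
    and D: "((snd c \<circ> \<gamma>) has_vector_derivative D) (at t within I)"
  shows "((snd c' \<circ> \<gamma>) has_vector_derivative rep_deriv id c c' (snd c (\<gamma> t)) D) (at t within I)"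
proof -
  let ?L = "rep_deriv id c c' (snd c (\<gamma> t))"
  have "(chart_rep id c c' has_derivative ?L) (at ((snd c \<circ> \<gamma>) t))"
    unfolding o_def using c t by (intro C1_map_derivative C1_map_id chart_in_rep_dom) auto
  from has_derivative_compose[OF D[unfolded has_vector_derivative_def] this]
  have d: "((\<lambda>s. chart_rep id c c' ((snd c \<circ> \<gamma>) s)) has_derivative (\<lambda>x. ?L (x *\<^sub>R D))) (at t within I)" .
  have "\<forall>\<^sub>F s in at t within I. \<gamma> s \<in> fst c"
    using \<gamma> open_chart[OF c(1)] t(2) unfolding continuous_within by (rule topological_tendstoD)
  then have ev: "\<forall>\<^sub>F s in at t within I. chart_rep id c c' ((snd c \<circ> \<gamma>) s) = (snd c' \<circ> \<gamma>) s"
    by (rule eventually_mono) (simp add: chart_rep_def chart_inv_chart c)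
  have "((snd c' \<circ> \<gamma>) has_derivative (\<lambda>x. ?L (x *\<^sub>R D))) (at t within I)"
    by (rule has_derivative_transform_eventually[OF d ev _ t(1)])
      (use t c in \<open>simp add: chart_rep_def chart_inv_chart\<close>)
  then show ?thesis by (simp add: has_vector_derivative_def blinfun.scaleR_right)
qed

lemma tangent_norm_chart_norm:
  "c \<in> A \<Longrightarrow> p \<in> fst c \<Longrightarrow> tangent_norm G p (from_coords A c p w) = chart_norm c (snd c p) w"
  by (simp add: chart_norm_def chart_inv_chart)

text \<open>With derivatives taken within \<open>{a..b}\<close>, the integrand is continuous, since
  near each time it is \<open>chart_norm\<close> of the coordinate velocity in one chart. The
  two-sided derivative used by \<open>velocity\<close> can differ from it only at the end
  points.\<close>

lemma velocity_integrable_piece: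
  assumes ab: "a < b" and C: "C1_curve_on A {a..b} \<gamma>"
  shows "(\<lambda>t. tangent_norm G (\<gamma> t) (velocity A \<gamma> t)) integrable_on {a..b}"
proof -
  define k where "k t = tangent_norm G (\<gamma> t) (vector_derivative (snd (chart_at A (\<gamma> t)) \<circ> \<gamma>) (at t within {a..b}))" for t
  have \<gamma>: "continuous_on {a..b} \<gamma>" using C by (simp add: C1_curve_on_def)
  have "continuous_on {a..b} k"
  proof (rule continuous_on_local)
    fix t assume t: "t \<in> {a..b}"
    define c where "c = chart_at A (\<gamma> t)"
    have c: "c \<in> A" "\<gamma> t \<in> fst c" by (auto simp: c_def chart_at)
    obtain D where D: "continuous_on ({a..b} \<inter> \<gamma> -` fst c) D"
      "\<And>s. s \<in> {a..b} \<inter> \<gamma> -` fst c \<Longrightarrow> ((snd c \<circ> \<gamma>) has_vector_derivative D s) (at s within {a..b})"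
      using C c(1) unfolding C1_curve_on_def by blast
    obtain U where U: "open U" "U \<inter> {a..b} = \<gamma> -` fst c \<inter> {a..b}"
      using \<gamma> open_chart[OF c(1)] continuous_on_open_invariant by metis
    have keq: "k s = chart_norm c (snd c (\<gamma> s)) (D s)" if s: "s \<in> {a..b} \<inter> U" for s
    proof -
      have s': "s \<in> {a..b}" "\<gamma> s \<in> fst c" using s U by auto
      let ?c = "chart_at A (\<gamma> s)"
      have "((snd ?c \<circ> \<gamma>) has_vector_derivative rep_deriv id c ?c (snd c (\<gamma> s)) (D s)) (at s within {a..b})"
        using s' c \<gamma> D(2)[of s] by (intro chart_change_vector_derivative chart_at)
          (auto simp: continuous_on_eq_continuous_within)
      then have "vector_derivative (snd ?c \<circ> \<gamma>) (at s within {a..b}) = rep_deriv id c ?c (snd c (\<gamma> s)) (D s)"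
        using s' by (intro vector_derivative_within_closed_interval[OF ab])
      then show ?thesis
        using s' c by (simp add: k_def tangent_norm_chart_norm[symmetric] from_coords_rep_deriv)
    qed
    have "continuous_on ({a..b} \<inter> U) (\<lambda>s. (snd c (\<gamma> s), D s))"
      using U by (intro continuous_on_Pair continuous_on_compose2[OF chart_cont[OF c(1)]]
          continuous_on_subset[OF \<gamma>] continuous_on_subset[OF D(1)]) auto
    then have "continuous_on ({a..b} \<inter> U) (\<lambda>s. (\<lambda>(y, w). chart_norm c y w) (snd c (\<gamma> s), D s))"
      using U by (intro continuous_on_compose2[OF chart_norm_continuous[OF c(1)]]) auto
    then have "continuous_on ({a..b} \<inter> U) k"
      by (rule continuous_on_eq) (simp add: keq)
    moreover have "t \<in> U" using U(2) t c(2) by blast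
    ultimately show "\<exists>U. open U \<and> t \<in> U \<and> continuous_on ({a..b} \<inter> U) k"
      using U(1) by blast
  qed
  then have "k integrable_on {a..b}" by (rule integrable_continuous_interval)
  then show ?thesis
  proof (rule integrable_spike_finite[of "{a, b}", rotated 2])
    fix t assume "t \<in> {a..b} - {a, b}"
    then have "t \<in> {a<..<b}" by auto
    then have "at t within {a..b} = at t" by (intro at_within_interior) simp
    then show "tangent_norm G (\<gamma> t) (velocity A \<gamma> t) = k t" by (simp add: k_def velocity_def)
  qed simp
qed

text \<open>Without integrability \<open>curve_length\<close> would be the default value 0, and no
  lower bound for lengths could hold.\<close>

lemma piecewise_C1_curve_props:
  assumes "piecewise_C1_curve A \<gamma>"
  shows velocity_integrable: "(\<lambda>t. tangent_norm G (\<gamma> t) (velocity A \<gamma> t)) integrable_on {0..1}"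
    and piecewise_C1_continuous: "continuous_on {0..1} \<gamma>"
proof -
  obtain T where T: "finite T" "{0, 1} \<subseteq> T" "T \<subseteq> {0..1}"
    and C: "\<And>a b. a \<in> T \<Longrightarrow> b \<in> T \<Longrightarrow> a < b \<Longrightarrow> {a<..<b} \<inter> T = {} \<Longrightarrow> C1_curve_on A {a..b} \<gamma>"
    by (rule piecewise_C1_curveE[OF assms]) (rule that)
  have "(\<lambda>t. tangent_norm G (\<gamma> t) (velocity A \<gamma> t)) integrable_on {0..1} \<and> continuous_on {0..1} \<gamma>"
  proof (rule finite_partition_induct[of T])
    fix y x assume yx: "y \<in> T" "x \<in> T" "y < x" "{y<..<x} \<inter> T = {}"
      and IH: "(\<lambda>t. tangent_norm G (\<gamma> t) (velocity A \<gamma> t)) integrable_on {0..y} \<and> continuous_on {0..y} \<gamma>"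
    have C': "C1_curve_on A {y..x} \<gamma>" using C yx by blast
    have "0 \<le> y" using yx T by auto
    then have "{0..x} = {0..y} \<union> {y..x}" using yx by auto
    then have "continuous_on {0..x} \<gamma>"
      using IH C' by (auto intro!: continuous_on_closed_Un simp: C1_curve_on_def)
    moreover have "(\<lambda>t. tangent_norm G (\<gamma> t) (velocity A \<gamma> t)) integrable_on {0..x}"
      using \<open>0 \<le> y\<close> yx IH velocity_integrable_piece[OF yx(3) C']
      by (intro Henstock_Kurzweil_Integration.integrable_combine[of 0 y x]) auto
    ultimately show "(\<lambda>t. tangent_norm G (\<gamma> t) (velocity A \<gamma> t)) integrable_on {0..x} \<and> continuous_on {0..x} \<gamma>" by blast
  qed (use T integrable_on_refl[of _ "0::real"] in \<open>auto simp: box_real\<close>)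
  then show "(\<lambda>t. tangent_norm G (\<gamma> t) (velocity A \<gamma> t)) integrable_on {0..1}" "continuous_on {0..1} \<gamma>" by auto
qed

text \<open>In coordinates the displacement is the integral of the velocity, whose Euclidean norm is
  at most \<open>k\<close> times the Riemannian speed. Only the initial part of the curve, up to
  \<open>t1\<close>, has to stay in the chart, so the estimate applies up to a first exit
  time.\<close>

lemma curve_length_lower_bound:
  assumes \<gamma>: "piecewise_C1_curve A \<gamma>" and c: "c \<in> A" and t1: "0 \<le> t1" "t1 \<le> 1"
    and inc: "\<And>t. t \<in> {0..t1} \<Longrightarrow> \<gamma> t \<in> fst c" and S: "\<And>t. t \<in> {0..t1} \<Longrightarrow> snd c (\<gamma> t) \<in> S"
    and k: "k > 0" "\<And>y w. y \<in> S \<Longrightarrow> norm w \<le> k * chart_norm c y w"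
  shows "norm (snd c (\<gamma> t1) - snd c (\<gamma> 0)) \<le> k * curve_length A G \<gamma>"
proof -
  obtain T where T: "finite T" "{0, 1} \<subseteq> T" "T \<subseteq> {0..1}"
    and C: "\<And>a b. a \<in> T \<Longrightarrow> b \<in> T \<Longrightarrow> a < b \<Longrightarrow> {a<..<b} \<inter> T = {} \<Longrightarrow> C1_curve_on A {a..b} \<gamma>"
    by (rule piecewise_C1_curveE[OF \<gamma>]) (rule that)
  define f where "f = snd c \<circ> \<gamma>"
  define v where "v t = tangent_norm G (\<gamma> t) (velocity A \<gamma> t)" for t
  have vint: "v integrable_on {0..1}" using velocity_integrable[OF \<gamma>] by (simp add: v_def[abs_def])
  have v0: "v t \<ge> 0" for t by (simp add: v_def tangent_norm_nonneg)
  have deriv: "\<exists>D. (f has_vector_derivative D) (at t) \<and> norm D \<le> k * v t" if t: "t \<in> {0..t1}" "t \<notin> T" for t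
  proof -
    obtain a b where ab: "a \<in> T" "b \<in> T" "a < t" "t < b" "{a<..<b} \<inter> T = {}"
      using finite_partition_gap[OF T(1,2), of t] t t1 by auto
    have C': "C1_curve_on A {a..b} \<gamma>" using C ab by fastforce
    have at: "at t within {a..b} = at t" using ab by (intro at_within_interior) simp
    have tc: "t \<in> {a..b} \<inter> \<gamma> -` fst c" using ab inc t by auto
    obtain D where D: "((snd c \<circ> \<gamma>) has_vector_derivative D) (at t)"
      using C' c tc unfolding C1_curve_on_def at[symmetric] by blast
    let ?c = "chart_at A (\<gamma> t)"
    have "((snd ?c \<circ> \<gamma>) has_vector_derivative rep_deriv id c ?c (snd c (\<gamma> t)) D) (at t within UNIV)"
    proof (rule chart_change_vector_derivative)
      have "continuous (at t within {a..b}) \<gamma>"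
        using C' tc by (simp add: C1_curve_on_def continuous_on_eq_continuous_within)
      then show "continuous (at t within UNIV) \<gamma>" by (simp only: at)
    qed (use c tc D chart_at in auto)
    then have "velocity A \<gamma> t = rep_deriv id c ?c (snd c (\<gamma> t)) D"
      unfolding velocity_def by (rule vector_derivative_at)
    then have "v t = chart_norm c (snd c (\<gamma> t)) D"
      using c tc by (simp add: v_def tangent_norm_chart_norm[symmetric] from_coords_rep_deriv)
    then show ?thesis using D k S[OF t(1)] by (auto simp: f_def)
  qed
  \<comment> \<open>The value 0 at the partition points keeps the bound by \<open>k * v t\<close>
    valid at every time, as the integral estimate requires.\<close>
  define f' where "f' t = (if t \<in> {0..t1} - T then vector_derivative f (at t) else 0)" for t
  have f': "(f has_vector_derivative f' t) (at t) \<and> norm (f' t) \<le> k * v t" if t: "t \<in> {0..t1}" "t \<notin> T" for t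
    using deriv[OF t] t by (auto simp: f'_def vector_derivative_at)
  have fc: "continuous_on {0..t1} f" unfolding f_def o_def
    using t1 inc by (intro continuous_on_compose2[OF chart_cont[OF c]]
        continuous_on_subset[OF piecewise_C1_continuous[OF \<gamma>]]) auto
  have int: "(f' has_integral (f t1 - f 0)) {0..t1}"
    using f' by (intro fundamental_theorem_of_calculus_interior_strong[OF T(1) t1(1) _ fc]) auto
  have vint': "v integrable_on {0..t1}" using vint t1 by (intro integrable_on_subinterval[OF vint]) auto
  have "norm (integral {0..t1} f') \<le> integral {0..t1} (\<lambda>t. k * v t)"
  proof (rule integral_norm_bound_integral)
    show "norm (f' t) \<le> k * v t" if "t \<in> {0..t1}" for t
      using f'[OF that] k(1) v0[of t] by (cases "t \<in> T") (auto simp: f'_def)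
    show "(\<lambda>t. k * v t) integrable_on {0..t1}" using vint' by (intro integrable_on_mult_right)
  qed (use int in blast)
  also have "\<dots> = k * integral {0..t1} v" by simp
  also have "\<dots> \<le> k * integral {0..1} v"
    using t1 vint vint' v0 k(1) by (intro mult_left_mono integral_subset_le) auto
  finally show ?thesis using integral_unique[OF int] by (simp add: f_def curve_length_def v_def[abs_def])
qed

text \<open>A curve from the coordinate ball of radius \<open>R\<close> to a point outside
  \<open>W\<close> must reach radius \<open>2 * R\<close>, so it has length at least
  \<open>R / k\<close>, wherever it goes afterwards.\<close>

lemma riem_dist_lower:
  assumes W: "open W" "p \<in> W"
  obtains W' e where "open W'" "p \<in> W'" "e > 0" "\<And>a b. a \<in> W' \<Longrightarrow> b \<notin> W \<Longrightarrow> riem_dist A G a b \<ge> ennreal e"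
proof -
  define c where "c = chart_at A p"
  have c: "c \<in> A" "p \<in> fst c" by (auto simp: c_def chart_at)
  define h where "h = snd c"
  have "open (h ` (fst c \<inter> W))" unfolding h_def
    by (intro open_chart_image_subset open_Int open_chart c W) auto
  then obtain R0 where R0: "R0 > 0" "cball (h p) R0 \<subseteq> h ` (fst c \<inter> W)"
    using W c unfolding open_contains_cball by blast
  define R where "R = R0 / 2"
  have R: "R > 0" "cball (h p) (2 * R) \<subseteq> h ` (fst c \<inter> W)" using R0 by (auto simp: R_def)
  have sub: "cball (h p) (2 * R) \<subseteq> snd c ` fst c" using R by (auto simp: h_def)
  obtain k where k: "k > 0" "\<And>y w. y \<in> cball (h p) (2 * R) \<Longrightarrow> norm w \<le> k * chart_norm c y w"
    using chart_norm_bounds[OF c(1) compact_cball sub] by metis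
  define W' where "W' = fst c \<inter> h -` ball (h p) R"
  define Z where "Z = fst c \<inter> h -` ball (h p) (2 * R)"
  have opn: "open W'" "open Z" unfolding W'_def Z_def h_def using c by (auto intro: open_chart_preimage)
  have ZW: "Z \<subseteq> W"
  proof
    fix z assume z: "z \<in> Z"
    then have "h z \<in> h ` (fst c \<inter> W)" using R by (auto simp: Z_def)
    then show "z \<in> W" using z chart_inv_chart[OF c(1)] by (auto simp: Z_def h_def) metis
  qed
  \<comment> \<open>A compact, hence closed, subset of the chart domain. It guarantees that the
    curve is still in the chart at its exit time from \<open>Z\<close>, which is a limit of times
    spent in \<open>Z\<close>.\<close>
  define CS where "CS = chart_inv c ` cball (h p) (2 * R)"
  have "compact CS" unfolding CS_def
    using sub by (intro compact_continuous_image continuous_on_subset[OF chart_inv_cont[OF c(1)]]) auto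
  then have clCS: "closed CS" by (rule compact_imp_closed)
  have CS: "q \<in> fst c \<and> h q \<in> cball (h p) (2 * R)" if "q \<in> CS" for q
    using that sub chart_inv_mem[OF c(1)] chart_chart_inv[OF c(1)] by (auto simp: CS_def h_def)
  have ZCS: "Z \<subseteq> CS"
  proof
    fix z assume "z \<in> Z"
    then have "z = chart_inv c (h z)" "h z \<in> cball (h p) (2 * R)"
      using chart_inv_chart[OF c(1)] by (auto simp: Z_def h_def)
    then show "z \<in> CS" unfolding CS_def by (rule image_eqI)
  qed
  have "ennreal (R / k) \<le> riem_dist A G a b" if ab: "a \<in> W'" "b \<notin> W" for a b
    unfolding riem_dist_def
  proof (rule INF_greatest)
    fix \<gamma> assume "\<gamma> \<in> {\<gamma>. piecewise_C1_curve A \<gamma> \<and> \<gamma> 0 = a \<and> \<gamma> 1 = b}"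
    then have \<gamma>: "piecewise_C1_curve A \<gamma>" "\<gamma> 0 = a" "\<gamma> 1 = b" by auto
    have cont: "continuous_on {0..1} \<gamma>" by (rule piecewise_C1_continuous[OF \<gamma>(1)])
    \<comment> \<open>Its infimum is the first time at which the curve is outside \<open>Z\<close>;
      the set contains 1 because the end point is outside \<open>W\<close>.\<close>
    define X where "X = {0..1} \<inter> \<gamma> -` (- Z)"
    have "closed X" unfolding X_def using cont opn by (intro continuous_closed_preimage) auto
    moreover have "1 \<in> X" using \<gamma> ab ZW by (auto simp: X_def)
    moreover have bdd: "bdd_below X" by (auto simp: X_def intro: bdd_belowI[of _ 0])
    ultimately have t1: "Inf X \<in> X" by (intro closed_contains_Inf) auto
    define t1 where "t1 = Inf X"
    have t1': "t1 \<in> {0..1}" "\<gamma> t1 \<notin> Z" using t1 by (auto simp: X_def t1_def)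
    have below: "\<gamma> t \<in> Z" if "0 \<le> t" "t < t1" for t
    proof (rule ccontr)
      assume "\<gamma> t \<notin> Z"
      then have "t \<in> X" using that t1' by (auto simp: X_def)
      then show False using that cInf_lower[OF _ bdd] by (force simp: t1_def)
    qed
    have "a \<in> Z" using ab R by (auto simp: W'_def Z_def)
    then have "t1 > 0" using t1' \<gamma> by (cases "t1 = 0") auto
    have "closed ({0..1} \<inter> \<gamma> -` CS)" using cont clCS by (intro continuous_closed_preimage) auto
    moreover have "{0..<t1} \<subseteq> {0..1} \<inter> \<gamma> -` CS" using below t1' by (auto intro!: subsetD[OF ZCS])
    ultimately have "closure {0..<t1} \<subseteq> {0..1} \<inter> \<gamma> -` CS" by (rule closure_minimal[rotated])
    then have inCS: "\<gamma> t \<in> CS" if "t \<in> {0..t1}" for t using that \<open>t1 > 0\<close> by auto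
    have "norm (snd c (\<gamma> t1) - snd c (\<gamma> 0)) \<le> k * curve_length A G \<gamma>"
      using t1' CS[OF inCS] k by (intro curve_length_lower_bound[OF \<gamma>(1) c(1), where S = "cball (h p) (2 * R)"])
        (auto simp: h_def)
    moreover have "dist (h p) (h (\<gamma> t1)) \<ge> 2 * R"
      using t1' CS[OF inCS, of t1] \<open>t1 > 0\<close> by (auto simp: Z_def)
    moreover have "dist (h p) (h a) < R" using ab by (auto simp: W'_def)
    ultimately have "R \<le> k * curve_length A G \<gamma>"
      using dist_triangle[of "h p" "h (\<gamma> t1)" "h a"] \<gamma>(2) by (simp add: h_def dist_norm norm_minus_commute)
    then have "R / k \<le> curve_length A G \<gamma>" using k by (simp add: field_simps)
    then show "ennreal (R / k) \<le> ennreal (curve_length A G \<gamma>)" by (rule ennreal_leI)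
  qed
  moreover have "p \<in> W'" using c R by (simp add: W'_def)
  ultimately show ?thesis using that[of W' "R / k"] opn k R by auto
qed

text \<open>Two points of a small coordinate ball are joined by the segment in coordinates, whose
  speed is at most \<open>k\<close> times its Euclidean speed.\<close>

lemma riem_dist_upper:
  assumes \<epsilon>: "\<epsilon> > 0"
  obtains W where "open W" "p \<in> W" "\<And>a b. a \<in> W \<Longrightarrow> b \<in> W \<Longrightarrow> riem_dist A G a b \<le> ennreal \<epsilon>"
proof -
  define c where "c = chart_at A p"
  have c: "c \<in> A" "p \<in> fst c" by (auto simp: c_def chart_at)
  define h where "h = snd c"
  obtain R where R: "R > 0" "cball (h p) R \<subseteq> h ` fst c"
    using open_chart_image[OF c(1)] c unfolding h_def by (meson imageI open_contains_cball)
  obtain k where k: "k > 0" "\<And>y w. y \<in> cball (h p) R \<Longrightarrow> chart_norm c y w \<le> k * norm w"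
    using chart_norm_bounds[OF c(1) compact_cball, of "h p" R] R(2) unfolding h_def by metis
  \<comment> \<open>Points of a ball of radius \<open>r\<close> are at most \<open>2 * r\<close>
    apart, so the segment has length at most \<open>k * (2 * r)\<close>, which is to be at most
    \<open>\<epsilon>\<close>.\<close>
  define r where "r = min R (\<epsilon> / (2 * k))"
  have r: "r > 0" "r \<le> R" "k * (2 * r) \<le> \<epsilon>"
  proof -
    have "k * (2 * r) \<le> k * (2 * (\<epsilon> / (2 * k)))" using k by (intro mult_left_mono) (auto simp: r_def)
    then show "k * (2 * r) \<le> \<epsilon>" using k by simp
  qed (use R \<epsilon> k in \<open>auto simp: r_def\<close>)
  define W where "W = fst c \<inter> h -` ball (h p) r"
  have "riem_dist A G a b \<le> ennreal \<epsilon>" if ab: "a \<in> W" "b \<in> W" for a b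
  proof -
    define l where "l t = h a + t *\<^sub>R (h b - h a)" for t :: real
    define w where "w = h b - h a"
    define \<gamma> where "\<gamma> t = chart_inv c (l t)" for t
    have lb: "l t \<in> ball (h p) r" if "t \<in> {0..1}" for t
    proof -
      have "l t = (1 - t) *\<^sub>R h a + t *\<^sub>R h b" by (simp add: l_def algebra_simps)
      then show ?thesis using that ab convexD[OF convex_ball, of "h a" "h p" r "h b" "1 - t" t] by (auto simp: W_def)
    qed
    then have lR: "l t \<in> cball (h p) R" if "t \<in> {0..1}" for t using r that by fastforce
    then have lin: "l t \<in> snd c ` fst c" if "t \<in> {0..1}" for t using R that by (auto simp: h_def)
    have \<gamma>l: "\<gamma> t \<in> fst c" "snd c (\<gamma> t) = l t" if "t \<in> {0..1}" for t
      using lin[OF that] c by (auto simp: \<gamma>_def chart_inv_mem chart_chart_inv)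
    have lc: "continuous_on S l" for S unfolding l_def by (intro continuous_intros)
    have ld: "(l has_vector_derivative w) (at t)" for t
      unfolding l_def w_def by (auto intro!: derivative_eq_intros)
    have \<gamma>c: "continuous_on {0..1} \<gamma>" unfolding \<gamma>_def
      using lin by (intro continuous_on_compose2[OF chart_inv_cont[OF c(1)] lc]) auto
    have \<gamma>d: "((snd c' \<circ> \<gamma>) has_vector_derivative rep_deriv id c c' (l t) w) (at t)"
      if "t \<in> {0..1}" "c' \<in> A" "\<gamma> t \<in> fst c'" for t c'
    proof -
      have "l t \<in> rep_dom id c c'" using that lin[OF that(1)] c by (simp add: rep_dom_iff \<gamma>_def[symmetric])
      then have "(chart_rep id c c' has_derivative rep_deriv id c c' (l t)) (at (l t))"
        using that c by (intro C1_map_derivative C1_map_id)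
      from has_derivative_compose[OF ld[of t, unfolded has_vector_derivative_def] this]
      have "((\<lambda>t. chart_rep id c c' (l t)) has_derivative (\<lambda>x. rep_deriv id c c' (l t) (x *\<^sub>R w))) (at t)" .
      moreover have "(\<lambda>t. chart_rep id c c' (l t)) = snd c' \<circ> \<gamma>" by (auto simp: chart_rep_def \<gamma>_def)
      ultimately show ?thesis by (simp add: has_vector_derivative_def blinfun.scaleR_right)
    qed
    have "C1_curve_on A {0..1} \<gamma>" unfolding C1_curve_on_def
    proof (intro conjI ballI \<gamma>c)
      fix c' assume c': "c' \<in> A"
      have "continuous_on ({0..1} \<inter> \<gamma> -` fst c') (\<lambda>t. rep_deriv id c c' (l t) w)"
        using c' c lin by (intro continuous_on_compose2[OF C1_map_derivative(2)[OF C1_map_id] lc] blinfun.continuous_on continuous_intros)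
          (auto simp: rep_dom_iff \<gamma>_def[symmetric])
      then show "\<exists>D. continuous_on ({0..1} \<inter> \<gamma> -` fst c') D \<and>
            (\<forall>t\<in>{0..1} \<inter> \<gamma> -` fst c'. (snd c' \<circ> \<gamma> has_vector_derivative D t) (at t within {0..1}))"
      proof (intro exI[of _ "\<lambda>t. rep_deriv id c c' (l t) w"] conjI ballI)
        fix t assume "t \<in> {0..1} \<inter> \<gamma> -` fst c'"
        then show "(snd c' \<circ> \<gamma> has_vector_derivative rep_deriv id c c' (l t) w) (at t within {0..1})"
          by (intro has_vector_derivative_at_within[OF \<gamma>d[OF _ c']]) auto
      qed
    qed
    then have "C1_curve_on A {s..u} \<gamma>" if "s \<in> {0, 1}" "u \<in> {0, 1}" "s < u" for s u :: real
    proof -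
      have "s = 0" "u = 1" using that by auto
      then show ?thesis using \<open>C1_curve_on A {0..1} \<gamma>\<close> by simp
    qed
    then have pw: "piecewise_C1_curve A \<gamma>"
      unfolding piecewise_C1_curve_def by (intro exI[of _ "{0, 1}"] conjI ballI impI) simp_all
    have ends: "\<gamma> 0 = a" "\<gamma> 1 = b" using ab c by (auto simp: \<gamma>_def l_def W_def h_def chart_inv_chart)
    have "norm w \<le> 2 * r"
      using ab dist_triangle3[of "h a" "h b" "h p"] by (auto simp: W_def w_def dist_norm norm_minus_commute)
    have "tangent_norm G (\<gamma> t) (velocity A \<gamma> t) \<le> \<epsilon>" if t: "t \<in> {0..1}" for t
    proof -
      have "velocity A \<gamma> t = rep_deriv id c (chart_at A (\<gamma> t)) (l t) w"
        unfolding velocity_def using \<gamma>d[OF t chart_at] by (rule vector_derivative_at)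
      then have "tangent_norm G (\<gamma> t) (velocity A \<gamma> t) = chart_norm c (l t) w"
        using c \<gamma>l[OF t] tangent_norm_chart_norm[of c "\<gamma> t" w] by (simp add: from_coords_rep_deriv)
      also have "\<dots> \<le> k * norm w" using k lR[OF t] by simp
      also have "\<dots> \<le> k * (2 * r)" using \<open>norm w \<le> 2 * r\<close> k by (intro mult_left_mono) auto
      finally show ?thesis using r by simp
    qed
    then have "curve_length A G \<gamma> \<le> integral {0..1} (\<lambda>t::real. \<epsilon>)"
      unfolding curve_length_def by (intro integral_le velocity_integrable[OF pw]) auto
    then have "ennreal (curve_length A G \<gamma>) \<le> ennreal \<epsilon>" by (intro ennreal_leI) simp
    then show ?thesis unfolding riem_dist_def using pw ends by (intro INF_lower2[of \<gamma>]) auto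
  qed
  moreover have "open W" "p \<in> W" using c r by (auto simp: W_def h_def open_chart_preimage)
  ultimately show ?thesis using that by blast
qed

end

section \<open>A compatible distance\<close>

text \<open>A metric as a plain function, because \<open>'m\<close> is only a topological type.
  Continuity of \<open>d\<close> and compactness together force \<open>d\<close> to induce the given
  topology; \<open>entourage\<close> is the uniform form of this.\<close>

locale compact_distance =
  fixes d :: "'m::t2_space \<Rightarrow> 'm \<Rightarrow> real"
  assumes compact_UNIV_space: "compact (UNIV :: 'm set)"
    and d_cont: "continuous_on UNIV (\<lambda>(p, q). d p q)"
    and d_nonneg: "d p q \<ge> 0" and d_sym: "d p q = d q p"
    and d_zero: "d p q = 0 \<longleftrightarrow> p = q" and d_triangle: "d p r \<le> d p q + d q r"
begin

lemma d_continuous_on: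
  assumes "continuous_on S f" "continuous_on S g" shows "continuous_on S (\<lambda>x. d (f x) (g x))"
  using continuous_on_compose2[OF d_cont continuous_on_Pair[OF assms]] by simp

lemma open_d_ball: "open {q. d p q < r}"
proof -
  have "open ((\<lambda>q. d p q) -` {..<r})"
    by (intro open_vimage d_continuous_on continuous_intros)
  then show ?thesis by (simp add: vimage_def)
qed

text \<open>On the compact complement of \<open>V\<close>, which misses the diagonal, the continuous
  function \<open>d\<close> has a positive minimum.\<close>

lemma entourage:
  assumes "open V" "\<And>p. (p, p) \<in> V"
  obtains \<delta> where "\<delta> > 0" "\<And>p q. d p q < \<delta> \<Longrightarrow> (p, q) \<in> V"
proof -
  have "compact (UNIV \<times> UNIV :: ('m \<times> 'm) set)" by (intro compact_Times compact_UNIV_space)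
  then have "compact (UNIV :: ('m \<times> 'm) set)" by simp
  then have cV: "compact (- V)" using assms(1) by (metis Compl_eq_Diff_UNIV compact_diff)
  have "\<exists>\<delta>>0. \<forall>z\<in>- V. \<delta> \<le> (\<lambda>(p, q). d p q) z"
  proof (cases "- V = {}")
    case True then show ?thesis by (auto intro: exI[of _ 1])
  next
    case False
    obtain z where z: "z \<in> - V" "\<forall>w\<in>- V. (\<lambda>(p, q). d p q) z \<le> (\<lambda>(p, q). d p q) w"
      using continuous_attains_inf[OF cV False continuous_on_subset[OF d_cont]] by blast
    have "fst z \<noteq> snd z" using z(1) assms(2) by (metis ComplD prod.collapse)
    then have "(\<lambda>(p, q). d p q) z > 0" using d_nonneg d_zero by (auto simp: case_prod_unfold less_le)
    then show ?thesis using z by blast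
  qed
  then obtain \<delta> where "\<delta> > 0" "\<forall>z\<in>- V. \<delta> \<le> (\<lambda>(p, q). d p q) z" by blast
  then show ?thesis by (intro that[of \<delta>]) (force dest: bspec[of _ _ "(p, q)" for p q])+
qed

text \<open>A Lebesgue number argument: the union of the squares \<open>W p \<times> W p\<close> is
  a neighbourhood of the diagonal.\<close>

lemma local_to_uniform:
  assumes "\<And>p. \<exists>W. open W \<and> p \<in> W \<and> (\<forall>a\<in>W. \<forall>b\<in>W. R a b)"
  obtains \<delta> where "\<delta> > 0" "\<And>a b. d a b < \<delta> \<Longrightarrow> R a b"
proof -
  obtain W where W: "\<And>p. open (W p)" "\<And>p. p \<in> W p" "\<And>p a b. a \<in> W p \<Longrightarrow> b \<in> W p \<Longrightarrow> R a b"
    using assms by metis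
  define V where "V = (\<Union>p. W p \<times> W p)"
  have "open V" unfolding V_def using W by (intro open_UN ballI open_Times) auto
  moreover have "(p, p) \<in> V" for p using W by (auto simp: V_def)
  ultimately obtain \<delta> where "\<delta> > 0" "\<And>p q. d p q < \<delta> \<Longrightarrow> (p, q) \<in> V" using entourage by blast
  then show ?thesis using W(3) by (intro that[of \<delta>]) (fastforce simp: V_def)+
qed

lemma uniform_continuity:
  assumes f: "continuous_on UNIV f" and "\<eta> > 0"
  obtains \<delta> where "\<delta> > 0" "\<And>a b. d a b < \<delta> \<Longrightarrow> d (f a) (f b) < \<eta>"
proof (rule local_to_uniform)
  fix p
  let ?W = "f -` {q. d (f p) q < \<eta> / 2}"
  have "open ?W" using f open_d_ball by (intro open_vimage)
  moreover have "p \<in> ?W" using assms(2) d_zero[of "f p" "f p"] by simp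
  moreover have "d (f a) (f b) < \<eta>" if "a \<in> ?W" "b \<in> ?W" for a b
    using that d_triangle[of "f a" "f b" "f p"] d_sym[of "f a" "f p"] by simp
  ultimately show "\<exists>W. open W \<and> p \<in> W \<and> (\<forall>a\<in>W. \<forall>b\<in>W. d (f a) (f b) < \<eta>)" by blast
qed (rule that)

lemma compact_coordinates_uniform:
  fixes h :: "'m \<Rightarrow> 'e::metric_space"
  assumes K: "compact K" "K \<subseteq> U" and U: "open U" and h: "continuous_on U h" and \<eta>: "\<eta> > 0"
  obtains \<delta> where "\<delta> > 0" "\<And>a b. a \<in> K \<Longrightarrow> d a b < \<delta> \<Longrightarrow> b \<in> U \<and> dist (h a) (h b) < \<eta>"
proof -
  obtain \<delta> where "\<delta> > 0" "\<And>a b. d a b < \<delta> \<Longrightarrow> a \<in> K \<longrightarrow> b \<in> U \<and> dist (h a) (h b) < \<eta>"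
  proof (rule local_to_uniform[of "\<lambda>a b. a \<in> K \<longrightarrow> b \<in> U \<and> dist (h a) (h b) < \<eta>"])
    fix p
    show "\<exists>W. open W \<and> p \<in> W \<and> (\<forall>a\<in>W. \<forall>b\<in>W. a \<in> K \<longrightarrow> b \<in> U \<and> dist (h a) (h b) < \<eta>)"
    proof (cases "p \<in> K")
      case True
      let ?W = "U \<inter> h -` ball (h p) (\<eta> / 2)"
      have "open ?W" using h U by (intro continuous_open_preimage) auto
      moreover have "p \<in> ?W" using True K \<eta> by auto
      moreover have "dist (h a) (h b) < \<eta>" if "a \<in> ?W" "b \<in> ?W" for a b
        using that dist_triangle_half_r[of "h p" "h a" \<eta> "h b"] by auto
      ultimately show ?thesis by blast
    next
      case False then show ?thesis using K compact_imp_closed[OF K(1)] by (intro exI[of _ "- K"]) auto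
    qed
  qed blast
  then show ?thesis using that by blast
qed

lemma parametrization_uniform:
  fixes \<theta> :: "'e::real_normed_vector \<Rightarrow> 'm"
  assumes S: "compact S" and \<theta>: "continuous_on S \<theta>" and \<eta>: "\<eta> > 0"
  obtains \<delta> where "\<delta> > 0" "\<And>y z. y \<in> S \<Longrightarrow> z \<in> S \<Longrightarrow> dist y z < \<delta> \<Longrightarrow> d (\<theta> y) (\<theta> z) < \<eta>"
proof -
  \<comment> \<open>Uniform continuity as an instance of \<open>strict_ineq_near_graph\<close>: the
    graph is the diagonal, and the third component is a dummy.\<close>
  let ?K = "S \<times> S \<times> {0::real}" and ?\<psi> = "\<lambda>(y, z, s). d (\<theta> y) (\<theta> z) - \<eta>"
  show ?thesis
  proof (rule strict_ineq_near_graph[of ?K S "\<lambda>y. y" ?\<psi>])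
    show "continuous_on ?K ?\<psi>" unfolding case_prod_unfold
      by (intro continuous_intros d_continuous_on continuous_on_compose2[OF \<theta>]) auto
    show "compact ?K" using S by (intro compact_Times) auto
    show "?\<psi> (y, y, s) < 0" for y s using \<eta> d_zero[of "\<theta> y" "\<theta> y"] by simp
    fix \<delta> :: real assume \<delta>: "\<delta> > 0" "\<And>y z s. (y, z, s) \<in> ?K \<Longrightarrow> dist y z < \<delta> \<Longrightarrow> ?\<psi> (y, z, s) < 0"
    show ?thesis
    proof (rule that[OF \<delta>(1)])
      fix y z assume "y \<in> S" "z \<in> S" "dist y z < \<delta>"
      then show "d (\<theta> y) (\<theta> z) < \<eta>" using \<delta>(2)[of y z 0] by simp
    qed
  qed (auto intro: continuous_on_id)
qed

end

section \<open>A finite cover by coordinate balls and a distance on the manifold\<close>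

context riemannian_manifold
begin

definition coord :: "'m \<Rightarrow> 'm \<Rightarrow> 'e" where "coord i = snd (chart_at A i)"
definition param :: "'m \<Rightarrow> 'e \<Rightarrow> 'm" where "param i = chart_inv (chart_at A i)"
definition cdom :: "'m \<Rightarrow> 'm set" where "cdom i = fst (chart_at A i)"

text \<open>The factor 3 leaves room: orbit points are placed in the ball of radius
  \<open>rad i\<close>, while the estimates around them take place in the ball of radius
  \<open>2 * rad i\<close>, still compactly inside the chart.\<close>

definition rad :: "'m \<Rightarrow> real" where
  "rad i = (SOME r. r > 0 \<and> cball (coord i i) (3 * r) \<subseteq> coord i ` cdom i)"

definition core :: "'m \<Rightarrow> real \<Rightarrow> 'm set" where
  "core i t = cdom i \<inter> coord i -` cball (coord i i) (t * rad i)"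

definition ocore :: "'m \<Rightarrow> real \<Rightarrow> 'm set" where
  "ocore i t = cdom i \<inter> coord i -` ball (coord i i) (t * rad i)"

lemma cdom_self: "i \<in> cdom i" by (simp add: cdom_def chart_at)

lemma rad: "rad i > 0" "cball (coord i i) (3 * rad i) \<subseteq> coord i ` cdom i"
proof -
  have "open (coord i ` cdom i)" using open_chart_image[OF chart_at(1)] by (simp add: coord_def cdom_def)
  then obtain r where "r > 0" "cball (coord i i) r \<subseteq> coord i ` cdom i"
    using cdom_self[of i] unfolding open_contains_cball by blast
  then have "\<exists>r. r > 0 \<and> cball (coord i i) (3 * r) \<subseteq> coord i ` cdom i"
    by (intro exI[of _ "r / 3"]) auto
  from someI_ex[OF this] show "rad i > 0" "cball (coord i i) (3 * rad i) \<subseteq> coord i ` cdom i"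
    by (auto simp: rad_def)
qed

lemma coord_cont: "continuous_on (cdom i) (coord i)"
  and param_cont: "continuous_on (coord i ` cdom i) (param i)"
  and open_cdom: "open (cdom i)"
  and param_coord: "p \<in> cdom i \<Longrightarrow> param i (coord i p) = p"
  and coord_param: "y \<in> coord i ` cdom i \<Longrightarrow> coord i (param i y) = y"
  and param_mem: "y \<in> coord i ` cdom i \<Longrightarrow> param i y \<in> cdom i"
  unfolding coord_def param_def cdom_def
  using chart_at(1)[of i] by (simp_all add: chart_cont chart_inv_cont open_chart chart_inv_chart chart_chart_inv chart_inv_mem)

lemma open_coord_preimage: "open S \<Longrightarrow> open (cdom i \<inter> coord i -` S)"
  using continuous_open_preimage[OF coord_cont open_cdom] .

lemma open_ocore: "open (ocore i t)"
  unfolding ocore_def by (intro open_coord_preimage) simp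

lemma cball_core_sub: "t \<le> 3 \<Longrightarrow> cball (coord i i) (t * rad i) \<subseteq> coord i ` cdom i"
  using rad[of i] by (meson less_imp_le mult_right_mono order_trans subset_cball)

lemma core_eq: "t \<le> 3 \<Longrightarrow> core i t = param i ` cball (coord i i) (t * rad i)"
proof (intro equalityI subsetI)
  fix p assume p: "p \<in> core i t"
  then show "p \<in> param i ` cball (coord i i) (t * rad i)"
    by (intro image_eqI[of _ _ "coord i p"]) (auto simp: core_def param_coord)
next
  fix p assume t: "t \<le> 3" and "p \<in> param i ` cball (coord i i) (t * rad i)"
  then obtain y where y: "p = param i y" "y \<in> cball (coord i i) (t * rad i)" by blast
  then have "y \<in> coord i ` cdom i" using cball_core_sub[OF t] by blast
  then show "p \<in> core i t" using y by (simp add: core_def coord_param param_mem)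
qed

lemma compact_core: "t \<le> 3 \<Longrightarrow> compact (core i t)"
  by (simp only: core_eq) (intro compact_continuous_image continuous_on_subset[OF param_cont] cball_core_sub compact_cball)

lemma core_sub: "core i t \<subseteq> cdom i" by (auto simp: core_def)

lemma core_mono: "s \<le> t \<Longrightarrow> core i s \<subseteq> core i t"
  using mult_right_mono[OF _ less_imp_le[OF rad(1)], of s t i] by (auto simp: core_def)

lemma finite_neighbourhood_cover:
  fixes V :: "'m \<Rightarrow> 'm set"
  assumes "\<And>p. open (V p)" "\<And>p. p \<in> V p"
  shows "\<exists>I. finite I \<and> (\<Union>p\<in>I. V p) = UNIV"
proof (rule compactE_image[OF compact_UNIV_manifold, of UNIV V])
  show "\<exists>I. finite I \<and> (\<Union>p\<in>I. V p) = UNIV" if "finite C'" "UNIV \<subseteq> (\<Union>c\<in>C'. V c)" for C'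
    using that by (intro exI[of _ C']) (simp add: top.extremum_unique)
qed (use assms in auto)

definition centres :: "'m set" where
  "centres = (SOME I. finite I \<and> (\<Union>i\<in>I. ocore i 1) = UNIV)"

lemma centres: "finite centres" "\<exists>i\<in>centres. p \<in> ocore i 1"
proof -
  have "i \<in> ocore i 1" for i using rad(1)[of i] cdom_self[of i] by (simp add: ocore_def)
  then have "\<exists>I. finite I \<and> (\<Union>i\<in>I. ocore i 1) = UNIV"
    by (intro finite_neighbourhood_cover open_ocore)
  from someI_ex[OF this] have *: "finite centres" "(\<Union>i\<in>centres. ocore i 1) = UNIV" by (auto simp: centres_def)
  show "finite centres" by fact
  have "p \<in> (\<Union>i\<in>centres. ocore i 1)" using *(2) by simp
  then show "\<exists>i\<in>centres. p \<in> ocore i 1" by blast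
qed

text \<open>A tent function supported in \<open>core i 2\<close>. Together with
  \<open>bump_coord\<close> it gives the usual embedding of a compact manifold into a Euclidean
  space: equal positive bumps put two points in the same chart, and equal scaled coordinates then
  identify them.\<close>

definition bump :: "'m \<Rightarrow> 'm \<Rightarrow> real" where
  "bump i p = (if p \<in> cdom i then max 0 (2 * rad i - dist (coord i i) (coord i p)) else 0)"

definition bump_coord :: "'m \<Rightarrow> 'm \<Rightarrow> 'e" where
  "bump_coord i p = (if p \<in> cdom i then bump i p *\<^sub>R coord i p else 0)"

text \<open>A distance inducing the topology of the manifold; only the uniform structure matters, and this
  one is easier to handle than the Riemannian distance.\<close>

definition mdist :: "'m \<Rightarrow> 'm \<Rightarrow> real" where
  "mdist p q = (\<Sum>i\<in>centres. \<bar>bump i p - bump i q\<bar> + norm (bump_coord i p - bump_coord i q))"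

lemma bump_zero_extension:
  fixes g :: "'m \<Rightarrow> 'x::real_normed_vector"
  assumes g: "continuous_on (cdom i) g" and z: "\<And>p. p \<in> cdom i - core i 2 \<Longrightarrow> g p = 0"
  shows "continuous_on UNIV (\<lambda>p. if p \<in> cdom i then g p else 0)"
proof -
  have "continuous_on (cdom i \<union> - core i 2) (\<lambda>p. if p \<in> cdom i then g p else 0)"
  proof (rule continuous_on_open_Un)
    show "continuous_on (cdom i) (\<lambda>p. if p \<in> cdom i then g p else 0)"
      by (rule continuous_on_eq[OF g]) simp
    show "continuous_on (- core i 2) (\<lambda>p. if p \<in> cdom i then g p else 0)"
      by (rule continuous_on_eq[OF continuous_on_const[of _ 0]]) (simp add: z)
    show "open (- core i 2)" using compact_imp_closed[OF compact_core[of 2 i]] by (simp add: open_Compl)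
  qed (rule open_cdom)
  moreover have "cdom i \<union> - core i 2 = UNIV" using core_sub[of i 2] by blast
  ultimately show ?thesis by simp
qed

lemma bump_cont: "continuous_on UNIV (bump i)"
proof -
  have "continuous_on (cdom i) (\<lambda>p. max 0 (2 * rad i - dist (coord i i) (coord i p)))"
    by (intro continuous_intros coord_cont)
  then show ?thesis unfolding bump_def[abs_def] by (rule bump_zero_extension) (auto simp: core_def)
qed

lemma bump_coord_cont: "continuous_on UNIV (bump_coord i)"
proof -
  have "continuous_on (cdom i) (\<lambda>p. bump i p *\<^sub>R coord i p)"
    by (intro continuous_intros coord_cont continuous_on_subset[OF bump_cont]) auto
  then show ?thesis unfolding bump_coord_def[abs_def] by (rule bump_zero_extension) (auto simp: core_def bump_def)
qed

sublocale mdist: compact_distance mdist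
proof
  show "compact (UNIV :: 'm set)" by (rule compact_UNIV_manifold)
  have "continuous_on UNIV (\<lambda>z. \<Sum>i\<in>centres. \<bar>bump i (fst z) - bump i (snd z)\<bar> + norm (bump_coord i (fst z) - bump_coord i (snd z)))"
    by (intro continuous_intros continuous_on_compose2[OF bump_cont] continuous_on_compose2[OF bump_coord_cont]) auto
  then show "continuous_on UNIV (\<lambda>(p, q). mdist p q)" by (simp add: mdist_def case_prod_unfold)
  fix p q r
  show "mdist p q \<ge> 0" unfolding mdist_def by (intro sum_nonneg) simp
  show "mdist p q = mdist q p" unfolding mdist_def
    by (intro sum.cong refl) (simp add: norm_minus_commute abs_minus_commute)
  show "mdist p r \<le> mdist p q + mdist q r" unfolding mdist_def sum.distrib[symmetric]
  proof (rule sum_mono)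
    fix i
    have "norm (bump_coord i p - bump_coord i r) \<le> norm (bump_coord i p - bump_coord i q) + norm (bump_coord i q - bump_coord i r)"
      using norm_triangle_ineq[of "bump_coord i p - bump_coord i q" "bump_coord i q - bump_coord i r"] by simp
    then show "\<bar>bump i p - bump i r\<bar> + norm (bump_coord i p - bump_coord i r)
         \<le> \<bar>bump i p - bump i q\<bar> + norm (bump_coord i p - bump_coord i q) +
           (\<bar>bump i q - bump i r\<bar> + norm (bump_coord i q - bump_coord i r))" by linarith
  qed
  show "mdist p q = 0 \<longleftrightarrow> p = q"
  proof
    assume z: "mdist p q = 0"
    obtain i where i: "i \<in> centres" "p \<in> ocore i 1" using centres by blast
    have "\<bar>bump i p - bump i q\<bar> + norm (bump_coord i p - bump_coord i q) = 0"
      using z i(1) centres(1) unfolding mdist_def by (subst (asm) sum_nonneg_eq_0_iff) auto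
    then have eq: "bump i p = bump i q" "bump_coord i p = bump_coord i q"
      using add_nonneg_eq_0_iff[OF abs_ge_zero norm_ge_zero, of "bump i p - bump i q" "bump_coord i p - bump_coord i q"] by auto
    have pos: "bump i p > 0" using i rad(1)[of i] by (auto simp: bump_def ocore_def)
    then have q: "q \<in> cdom i" using eq(1) by (auto simp: bump_def split: if_splits)
    have p: "p \<in> cdom i" using i by (simp add: ocore_def)
    have "coord i p = coord i q" using eq pos p q by (simp add: bump_coord_def)
    then show "p = q" using p q param_coord by metis
  qed (simp add: mdist_def)
qed

text \<open>Here \<open>riem_dist\<close> is the controlled quantity, so the local lower bounds of
  \<open>riem_dist_lower\<close> are made uniform by a finite cover. It converts a small
  \<open>dist_C0\<close> into closeness for \<open>mdist\<close>.\<close>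

lemma riem_dist_small_imp:
  assumes "\<eta> > 0"
  obtains e where "e > 0" "\<And>a b. riem_dist A G a b \<le> ennreal e \<Longrightarrow> mdist a b < \<eta>"
proof -
  let ?W = "\<lambda>p. {q. mdist p q < \<eta> / 2}"
  have "\<forall>p. \<exists>W' e. open W' \<and> p \<in> W' \<and> e > 0 \<and> (\<forall>a b. a \<in> W' \<longrightarrow> b \<notin> ?W p \<longrightarrow> riem_dist A G a b \<ge> ennreal e)"
  proof
    fix p
    have "p \<in> ?W p" using assms mdist.d_zero[of p p] by simp
    then show "\<exists>W' e. open W' \<and> p \<in> W' \<and> e > 0 \<and> (\<forall>a b. a \<in> W' \<longrightarrow> b \<notin> ?W p \<longrightarrow> riem_dist A G a b \<ge> ennreal e)"
      using riem_dist_lower[OF mdist.open_d_ball] by metis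
  qed
  then obtain W' e where W: "\<And>p. open (W' p)" "\<And>p. p \<in> W' p" "\<And>p. e p > 0"
    "\<And>p a b. a \<in> W' p \<Longrightarrow> b \<notin> ?W p \<Longrightarrow> riem_dist A G a b \<ge> ennreal (e p)"
    by metis
  define V where "V p = W' p \<inter> ?W p" for p
  have "open (V p)" for p unfolding V_def by (intro open_Int W mdist.open_d_ball)
  moreover have "p \<in> V p" for p using W assms mdist.d_zero[of p p] by (auto simp: V_def)
  ultimately obtain I where I: "finite I" "(\<Union>p\<in>I. V p) = UNIV"
    using finite_neighbourhood_cover[of V] by blast
  have "I \<noteq> {}" using I by auto
  \<comment> \<open>Halving makes \<open>e0\<close> strictly smaller than every local bound, so that
    a distance at most \<open>e0\<close> contradicts the weak inequality there.\<close>
  define e0 where "e0 = Min (e ` I) / 2"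
  have m: "Min (e ` I) > 0" using I W \<open>I \<noteq> {}\<close> by simp
  have "mdist a b < \<eta>" if r: "riem_dist A G a b \<le> ennreal e0" for a b
  proof -
    obtain p where p: "p \<in> I" "a \<in> V p" using I by blast
    have "Min (e ` I) \<le> e p" using I p by (intro Min_le) auto
    then have "e0 < e p" using m by (simp add: e0_def)
    then have "ennreal e0 < ennreal (e p)" using m by (intro ennreal_lessI) (auto simp: e0_def W)
    then have "\<not> ennreal (e p) \<le> riem_dist A G a b" using r by (meson leD order_trans)
    then have "b \<in> ?W p" using W(4)[of a p b] p by (auto simp: V_def)
    then show ?thesis using p mdist.d_triangle[of a b p] mdist.d_sym[of a p] by (auto simp: V_def)
  qed
  then show ?thesis using that[of e0] m by (simp add: e0_def)
qed

lemma mdist_small_imp: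
  assumes "\<epsilon> > 0"
  obtains \<eta> where "\<eta> > 0" "\<And>a b. mdist a b < \<eta> \<Longrightarrow> riem_dist A G a b \<le> ennreal \<epsilon>"
proof (rule mdist.local_to_uniform)
  show "\<exists>W. open W \<and> p \<in> W \<and> (\<forall>a\<in>W. \<forall>b\<in>W. riem_dist A G a b \<le> ennreal \<epsilon>)" for p
    using riem_dist_upper[OF assms, of p] by metis
qed (rule that)

end

section \<open>Methods, attraction to the nonwandering set, surjectivity\<close>

primrec method_comp :: "(nat \<Rightarrow> 'm \<Rightarrow> 'm) \<Rightarrow> nat \<Rightarrow> nat \<Rightarrow> 'm \<Rightarrow> 'm" where
  "method_comp g k 0 y = y"
| "method_comp g k (Suc i) y = g (k + i) (method_comp g k i y)"

lemma method_comp_add: "method_comp g k (i + j) y = method_comp g (k + i) j (method_comp g k i y)"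
  by (induction j) (simp_all add: add.assoc)

lemma method_comp_cont:
  assumes "is_method g" shows "continuous_on UNIV (method_comp g k i)"
proof (induction i)
  case (Suc i)
  then show ?case
    using assms by (auto simp: is_method_def intro: continuous_on_compose2[where t = UNIV])
qed (simp add: continuous_on_id)

lemma method_comp_surj:
  assumes "\<And>k. surj (g k)" shows "surj (method_comp g k i)"
proof (induction i)
  case (Suc i)
  have "method_comp g k (Suc i) = g (k + i) \<circ> method_comp g k i" by auto
  then show ?case using Suc assms comp_surj by metis
qed (simp add: surj_def)

lemma is_trajectory_method_comp: "is_trajectory g (\<lambda>k. method_comp g 0 k y)"
  by (simp add: is_trajectory_def)

text \<open>A wandering point has a neighbourhood which no orbit visits twice. Finitely many such
  neighbourhoods cover the complement of \<open>V\<close>, so an orbit spends finitely many times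
  there; \<open>N\<close> depends on \<open>x\<close>.\<close>

lemma nonwandering_attracts:
  fixes f :: "'m::topological_space \<Rightarrow> 'm"
  assumes cpt: "compact (UNIV :: 'm set)" and V: "open V" "nonwandering_set f \<subseteq> V"
  obtains N where "\<And>k. k \<ge> N \<Longrightarrow> (f ^^ k) x \<in> V"
proof -
  have "\<forall>q\<in>- V. \<exists>U. open U \<and> q \<in> U \<and> (\<forall>n\<ge>1. (f ^^ n) ` U \<inter> U = {})"
  proof
    fix q assume "q \<in> - V"
    then have "q \<notin> nonwandering_set f" using V(2) by blast
    then show "\<exists>U. open U \<and> q \<in> U \<and> (\<forall>n\<ge>1. (f ^^ n) ` U \<inter> U = {})"
      by (simp add: nonwandering_set_def)
  qed
  from bchoice[OF this] obtain U
    where U': "\<forall>q\<in>- V. open (U q) \<and> q \<in> U q \<and> (\<forall>n\<ge>1. (f ^^ n) ` U q \<inter> U q = {})" ..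
  then have U: "open (U q)" "q \<in> U q" "n \<ge> 1 \<Longrightarrow> (f ^^ n) ` U q \<inter> U q = {}" if "q \<in> - V" for q n
    using that by simp_all
  have "compact (- V)" using compact_diff[OF cpt V(1)] by (simp add: Compl_eq_Diff_UNIV)
  then obtain I where I: "I \<subseteq> - V" "finite I" "- V \<subseteq> (\<Union>q\<in>I. U q)"
    by (rule compactE_image[of "- V" "- V" U]) (use U in auto)
  have "finite {k. (f ^^ k) x \<in> U q}" if "q \<in> - V" for q
  proof -
    have no: "\<not> j < k" if "(f ^^ j) x \<in> U q" "(f ^^ k) x \<in> U q" for j k
    proof
      assume "j < k"
      then have "(f ^^ k) x = (f ^^ (k - j)) ((f ^^ j) x)" by (simp add: funpow_add[symmetric, THEN fun_cong, simplified])
      then have "(f ^^ k) x \<in> (f ^^ (k - j)) ` U q \<inter> U q" using that by blast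
      moreover have "(f ^^ (k - j)) ` U q \<inter> U q = {}" using \<open>j < k\<close> by (intro U(3)[OF \<open>q \<in> - V\<close>]) simp
      ultimately show False by simp
    qed
    have "{k. (f ^^ k) x \<in> U q} \<subseteq> {k}" if "(f ^^ k) x \<in> U q" for k
      using no that by (auto intro: linorder_neqE_nat)
    then show ?thesis by (cases "{k. (f ^^ k) x \<in> U q} = {}") (auto intro: finite_subset)
  qed
  then have "finite (\<Union>q\<in>I. {k. (f ^^ k) x \<in> U q})" using I by (intro finite_UN_I) auto
  moreover have "{k. (f ^^ k) x \<notin> V} \<subseteq> (\<Union>q\<in>I. {k. (f ^^ k) x \<in> U q})" using I(3) by auto
  ultimately have "finite {k. (f ^^ k) x \<notin> V}" by (rule finite_subset[rotated])
  then obtain N where "\<forall>k\<in>{k. (f ^^ k) x \<notin> V}. k < N" using finite_nat_set_iff_bounded by blast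
  then show ?thesis by (intro that[of N]) force
qed

context compact_distance
begin

text \<open>The number of steps is bounded by \<open>m\<close>, so errors accumulate in a controlled
  way, and one \<open>\<delta>\<close> serves every method and every starting index.\<close>

lemma method_comp_close:
  assumes f: "continuous_on UNIV f" and \<eta>: "\<eta> > 0"
  shows "\<exists>\<delta>>0. \<forall>g. (\<forall>k y. d (g k y) (f y) < \<delta>) \<longrightarrow>
     (\<forall>k y y'. \<forall>i\<le>m. d y y' < \<delta> \<longrightarrow> d (method_comp g k i y) ((f ^^ i) y') < \<eta>)"
  using \<eta>
proof (induction m arbitrary: \<eta>)
  case 0 then show ?case by auto
next
  case (Suc m)
  have h: "\<eta> / 2 > 0" using Suc.prems by simp
  obtain \<delta>1 where d1: "\<delta>1 > 0" "\<And>a b. d a b < \<delta>1 \<Longrightarrow> d (f a) (f b) < \<eta> / 2"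
    using uniform_continuity[OF f h] by blast
  define \<eta>' where "\<eta>' = min \<eta> \<delta>1"
  have "\<eta>' > 0" using d1 Suc.prems by (simp add: \<eta>'_def)
  from Suc.IH[OF this] obtain \<delta>0 where d0: "\<delta>0 > 0"
    "\<And>(g :: nat \<Rightarrow> 'm \<Rightarrow> 'm) k y y' i. (\<forall>k y. d (g k y) (f y) < \<delta>0) \<Longrightarrow> i \<le> m \<Longrightarrow> d y y' < \<delta>0 \<Longrightarrow> d (method_comp g k i y) ((f ^^ i) y') < \<eta>'"
    by metis
  show ?case
  proof (intro exI[of _ "min \<delta>0 (\<eta> / 2)"] conjI allI impI)
    fix g :: "nat \<Rightarrow> 'm \<Rightarrow> 'm" and k y y' i assume g: "\<forall>k y. d (g k y) (f y) < min \<delta>0 (\<eta> / 2)" and i: "i \<le> Suc m" and y: "d y y' < min \<delta>0 (\<eta> / 2)"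
    have ih: "d (method_comp g k j y) ((f ^^ j) y') < \<eta>'" if "j \<le> m" for j
      using d0(2)[of g j y y' k] that g y by simp
    show "d (method_comp g k i y) ((f ^^ i) y') < \<eta>"
    proof (cases "i \<le> m")
      case True then show ?thesis using ih by (simp add: \<eta>'_def)
    next
      case False
      then have i: "i = Suc m" using i by simp
      let ?z = "method_comp g k m y"
      have "d (f ?z) (f ((f ^^ m) y')) < \<eta> / 2" using d1(2) ih[of m] by (simp add: \<eta>'_def)
      moreover have "d (g (k + m) ?z) (f ?z) < \<eta> / 2" using g by simp
      ultimately show ?thesis using d_triangle[of "g (k + m) ?z" "f ((f ^^ m) y')" "f ?z"] by (simp add: i)
    qed
  qed (use d0 h in simp)
qed

end

context riemannian_manifold
begin

text \<open>In a chart a map close to the identity moves points by less than the radius of a ball, so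
  Brouwer's theorem on that ball shows that its centre is attained.\<close>

lemma near_homeomorphism_surj:
  assumes f: "bij f" "continuous_on UNIV (inv f)"
  obtains \<delta> where "\<delta> > 0" "\<And>g. continuous_on UNIV g \<Longrightarrow> (\<And>y. mdist (g y) (f y) < \<delta>) \<Longrightarrow> surj g"
proof -
  have "\<exists>\<delta>>0. \<forall>i\<in>centres. \<forall>a b. a \<in> core i 2 \<longrightarrow> mdist a b < \<delta> \<longrightarrow> b \<in> cdom i \<and> dist (coord i a) (coord i b) < rad i"
  proof (rule finite_uniform[OF centres(1)])
    fix i
    show "\<exists>\<delta>>0. \<forall>a b. a \<in> core i 2 \<longrightarrow> mdist a b < \<delta> \<longrightarrow> b \<in> cdom i \<and> dist (coord i a) (coord i b) < rad i"
      by (rule mdist.compact_coordinates_uniform[OF compact_core[of 2 i] core_sub open_cdom coord_cont rad(1)]) auto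
  qed auto
  then obtain \<delta> where \<delta>: "\<delta> > 0" "\<And>i a b. i \<in> centres \<Longrightarrow> a \<in> core i 2 \<Longrightarrow> mdist a b < \<delta> \<Longrightarrow>
      b \<in> cdom i \<and> dist (coord i a) (coord i b) < rad i" by blast
  have "surj g" if g: "continuous_on UNIV g" "\<And>y. mdist (g y) (f y) < \<delta>" for g
  proof -
    have "\<exists>p. g p = q" for q
    proof -
      obtain i where i: "i \<in> centres" "q \<in> ocore i 1" using centres by blast
      \<comment> \<open>Precomposition with the inverse reduces the claim to a map uniformly close
        to the identity, with the same \<open>\<delta>\<close>.\<close>
      define h where "h a = g (inv f a)" for a
      have hc: "continuous_on UNIV h" unfolding h_def by (intro continuous_on_compose2[OF g(1) f(2)]) auto
      have hd: "mdist a (h a) < \<delta>" for a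
        using g(2)[of "inv f a"] f(1) by (simp add: h_def bij_is_surj surj_f_inv_f mdist.d_sym)
      \<comment> \<open>Since \<open>q\<close> lies within \<open>rad i\<close> of the centre, this
        ball stays within radius \<open>2 * rad i\<close>, where coordinates are controlled.\<close>
      define B where "B = cball (coord i q) (rad i)"
      have "B \<subseteq> cball (coord i i) (2 * rad i)" 
      proof
        fix y assume "y \<in> B"
        then show "y \<in> cball (coord i i) (2 * rad i)"
          using i(2) dist_triangle[of "coord i i" y "coord i q"] by (simp add: B_def ocore_def)
      qed
      then have pc: "param i y \<in> core i 2" if "y \<in> B" for y using that core_eq[of 2 i] by auto
      have BU: "B \<subseteq> coord i ` cdom i" using \<open>B \<subseteq> _\<close> cball_core_sub[of 2 i] by auto
      have near: "h (param i y) \<in> cdom i \<and> dist y (coord i (h (param i y))) < rad i" if "y \<in> B" for y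
        using \<delta>(2)[OF i(1) pc[OF that] hd] coord_param[of y i] BU that by auto
      \<comment> \<open>A fixed point of this map is exactly a point whose image under
        \<open>h\<close> has the coordinates of \<open>q\<close>; the ball is preserved because
        \<open>h\<close> displaces by less than \<open>rad i\<close> in coordinates.\<close>
      obtain y where y: "y \<in> B" "coord i q + y - coord i (h (param i y)) = y"
      proof (rule brouwer[of B "\<lambda>y. coord i q + y - coord i (h (param i y))"])
        show "compact B" "convex B" "B \<noteq> {}" using rad(1)[of i] by (auto simp: B_def)
        show "continuous_on B (\<lambda>y. coord i q + y - coord i (h (param i y)))"
          using BU near by (intro continuous_intros continuous_on_compose2[OF coord_cont] continuous_on_compose2[OF hc]
              continuous_on_subset[OF param_cont]) auto
        show "(\<lambda>y. coord i q + y - coord i (h (param i y))) \<in> B \<rightarrow> B"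
        proof
          fix y assume "y \<in> B"
          then have "dist y (coord i (h (param i y))) < rad i" using near by blast
          moreover have "dist (coord i q) (coord i q + y - coord i (h (param i y))) = dist y (coord i (h (param i y)))"
            by (simp add: dist_norm algebra_simps norm_minus_commute)
          ultimately show "coord i q + y - coord i (h (param i y)) \<in> B" by (simp add: B_def)
        qed
      qed blast
      have "coord i (h (param i y)) = coord i q" using y(2) by (simp add: algebra_simps)
      then have "h (param i y) = q" using near[OF y(1)] i param_coord by (metis IntE ocore_def)
      then show ?thesis by (auto simp: h_def)
    qed
    then show ?thesis by (metis surjI surj_def)
  qed
  then show ?thesis using that \<delta>(1) by blast
qed

end

section \<open>Hyperbolic sets in coordinates\<close>

lemma funpow_inv_funpow:
  fixes f :: "'a \<Rightarrow> 'a"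
  shows "bij f \<Longrightarrow> (inv f ^^ n) ((f ^^ n) x) = x"
proof (induction n arbitrary: x)
  case (Suc n)
  have "(inv f ^^ Suc n) ((f ^^ Suc n) x) = (inv f ^^ n) (inv f (f ((f ^^ n) x)))"
    by (simp add: funpow_swap1)
  then show ?case using Suc by (simp add: bij_is_inj)
qed simp

text \<open>The assumptions are symmetric under replacing \<open>f\<close> by its inverse and
  exchanging \<open>Es\<close> with \<open>Eu\<close>; thus each fact on the stable bundle can be
  transferred by \<open>hyperbolic_system_inverse\<close>.\<close>

locale hyperbolic_system = riemannian_manifold A G
  for A :: "('m::t2_space, 'e::euclidean_space) chart set" and G :: "'m \<Rightarrow> 'e \<Rightarrow> 'e \<Rightarrow> real" +
  fixes f :: "'m \<Rightarrow> 'm" and \<Lambda> :: "'m set" and Es Eu :: "'m \<Rightarrow> 'e set" and C \<mu> :: real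
  assumes bij: "bij f" and C1: "C1_map A f" and C1_inv: "C1_map A (inv f)"
    and compact_\<Lambda>: "compact \<Lambda>" and inv_\<Lambda>: "f ` \<Lambda> = \<Lambda>"
    and C_pos: "C > 0" and \<mu>: "0 < \<mu>" "\<mu> < 1"
    and split: "\<And>p. p \<in> \<Lambda> \<Longrightarrow> splitting (Es p) (Eu p)"
    and Es_inv: "\<And>p. p \<in> \<Lambda> \<Longrightarrow> tangent_map A f p ` Es p = Es (f p)"
    and Eu_inv: "\<And>p. p \<in> \<Lambda> \<Longrightarrow> tangent_map A f p ` Eu p = Eu (f p)"
    and contr: "\<And>p n v. p \<in> \<Lambda> \<Longrightarrow> v \<in> Es p \<Longrightarrow>
        tangent_norm G ((f ^^ n) p) (tangent_map A (f ^^ n) p v) \<le> C * \<mu> ^ n * tangent_norm G p v"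
    and contr_inv: "\<And>p n v. p \<in> \<Lambda> \<Longrightarrow> v \<in> Eu p \<Longrightarrow>
        tangent_norm G ((inv f ^^ n) p) (tangent_map A (inv f ^^ n) p v) \<le> C * \<mu> ^ n * tangent_norm G p v"
begin

lemma \<Lambda>_step: "p \<in> \<Lambda> \<Longrightarrow> f p \<in> \<Lambda>" using inv_\<Lambda> by blast

lemma \<Lambda>_funpow: "p \<in> \<Lambda> \<Longrightarrow> (f ^^ n) p \<in> \<Lambda>"
  by (induction n) (auto intro: \<Lambda>_step)

lemma C1_funpow: "C1_map A (f ^^ n)" "C1_map A (inv f ^^ n)"
  by (auto intro: C1_map_funpow C1 C1_inv)

lemma tangent_map_funpow_image:
  assumes "p \<in> \<Lambda>"
  shows "tangent_map A (f ^^ n) p ` Es p = Es ((f ^^ n) p)" "tangent_map A (f ^^ n) p ` Eu p = Eu ((f ^^ n) p)"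
proof (induction n)
  case 0
  show "tangent_map A (f ^^ 0) p ` Es p = Es ((f ^^ 0) p)" "tangent_map A (f ^^ 0) p ` Eu p = Eu ((f ^^ 0) p)"
    using tangent_map_id by (simp_all add: image_def id_def[symmetric])
next
  case (Suc n)
  have "tangent_map A (f ^^ Suc n) p v = tangent_map A f ((f ^^ n) p) (tangent_map A (f ^^ n) p v)" for v
    unfolding funpow.simps by (rule tangent_map_comp[OF C1_funpow(1) C1])
  then have "tangent_map A (f ^^ Suc n) p ` E = tangent_map A f ((f ^^ n) p) ` (tangent_map A (f ^^ n) p ` E)" for E
    by (simp add: image_image)
  then show "tangent_map A (f ^^ Suc n) p ` Es p = Es ((f ^^ Suc n) p)" "tangent_map A (f ^^ Suc n) p ` Eu p = Eu ((f ^^ Suc n) p)"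
    using Suc Es_inv Eu_inv \<Lambda>_funpow[OF assms] by simp_all
qed

text \<open>The derivative of the inverse iterate undoes that of the iterate; this turns backward
  contraction, read at the image point, into forward expansion.\<close>

lemma tangent_map_inv_funpow:
  "tangent_map A (inv f ^^ n) ((f ^^ n) p) (tangent_map A (f ^^ n) p v) = v"
proof -
  have "(inv f ^^ n) \<circ> (f ^^ n) = id" using funpow_inv_funpow[OF bij] by auto
  then show ?thesis using tangent_map_comp[OF C1_funpow, of n n p v] by (simp add: tangent_map_id)
qed

lemma expa:
  assumes "p \<in> \<Lambda>" "v \<in> Eu p"
  shows "tangent_norm G p v \<le> C * \<mu> ^ n * tangent_norm G ((f ^^ n) p) (tangent_map A (f ^^ n) p v)"
proof -
  have "tangent_map A (f ^^ n) p v \<in> Eu ((f ^^ n) p)" using tangent_map_funpow_image(2)[OF assms(1), of n] assms(2) by blast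
  from contr_inv[OF \<Lambda>_funpow[OF assms(1)] this, of n] show ?thesis
    by (simp add: funpow_inv_funpow[OF bij] tangent_map_inv_funpow)
qed

text \<open>If \<open>v\<close> satisfies the decay estimates, so does its unstable part up to a
  constant. As that part also expands, its square norm is at most a constant times
  \<open>(C * \<mu> ^ n) ^ 4\<close> for every \<open>n\<close>, hence it vanishes. The point is
  that membership becomes a family of closed conditions.\<close>

lemma Es_iff:
  assumes p: "p \<in> \<Lambda>"
  shows "v \<in> Es p \<longleftrightarrow> (\<forall>n. tangent_norm G ((f ^^ n) p) (tangent_map A (f ^^ n) p v) \<le> C * \<mu> ^ n * tangent_norm G p v)"
proof
  assume bd: "\<forall>n. tangent_norm G ((f ^^ n) p) (tangent_map A (f ^^ n) p v) \<le> C * \<mu> ^ n * tangent_norm G p v"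
  obtain s u where su: "s \<in> Es p" "u \<in> Eu p" "v = s + u" using split[OF p] unfolding splitting_def by blast
  define K where "K = (tangent_norm G p v)\<^sup>2 + (tangent_norm G p s)\<^sup>2"
  have le: "(tangent_norm G p u)\<^sup>2 \<le> 2 * (C * \<mu> ^ n) ^ 4 * K" for n
  proof -
    let ?N = "\<lambda>w. tangent_norm G ((f ^^ n) p) (tangent_map A (f ^^ n) p w)"
    let ?c = "C * \<mu> ^ n"
    have c0: "?c \<ge> 0" using C_pos \<mu> by simp
    have "tangent_map A (f ^^ n) p u = tangent_map A (f ^^ n) p v - tangent_map A (f ^^ n) p s"
      using tangent_map_linear[OF C1_funpow(1), of n p] su(3) by (simp add: linear_add)
    then have "(?N u)\<^sup>2 \<le> 2 * (?N v)\<^sup>2 + 2 * (?N s)\<^sup>2" by (simp add: tangent_norm_diff_le)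
    also have "\<dots> \<le> 2 * (?c * tangent_norm G p v)\<^sup>2 + 2 * (?c * tangent_norm G p s)\<^sup>2"
      using bd contr[OF p su(1)] tangent_norm_nonneg by (intro add_mono mult_left_mono power_mono) auto
    also have "\<dots> = 2 * ?c\<^sup>2 * K" by (simp add: K_def power_mult_distrib algebra_simps)
    finally have Nu: "(?N u)\<^sup>2 \<le> 2 * ?c\<^sup>2 * K" .
    have "(tangent_norm G p u)\<^sup>2 \<le> (?c * ?N u)\<^sup>2"
      using expa[OF p su(2), of n] tangent_norm_nonneg by (intro power_mono) auto
    also have "\<dots> = ?c\<^sup>2 * (?N u)\<^sup>2" by (simp add: power_mult_distrib)
    also have "\<dots> \<le> ?c\<^sup>2 * (2 * ?c\<^sup>2 * K)" using Nu by (intro mult_left_mono) auto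
    also have "\<dots> = 2 * ?c ^ 4 * K" by (simp add: power4_eq_xxxx power2_eq_square)
    finally show ?thesis .
  qed
  have "(\<lambda>n. 2 * (C * \<mu> ^ n) ^ 4 * K) \<longlonglongrightarrow> 2 * (C * 0) ^ 4 * K"
    using \<mu> by (intro tendsto_intros) simp
  then have "(tangent_norm G p u)\<^sup>2 \<le> 0" using le LIMSEQ_le_const by fastforce
  then have "u = 0" using tangent_norm_pos[of u p] by (cases "u = 0") auto
  then show "v \<in> Es p" using su by simp
qed (use contr[OF p] in blast)

definition chart_Es :: "'m \<Rightarrow> 'e \<Rightarrow> 'e set" where
  "chart_Es i y = {v. from_coords A (chart_at A i) (param i y) v \<in> Es (param i y)}"

definition chart_Eu :: "'m \<Rightarrow> 'e \<Rightarrow> 'e set" where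
  "chart_Eu i y = {v. from_coords A (chart_at A i) (param i y) v \<in> Eu (param i y)}"

text \<open>Radius 2 instead of 1, because the points of \<Lambda> chosen near an orbit point of
  \<open>core i 1\<close> may lie slightly outside it.\<close>

definition \<Lambda>_coords :: "'m \<Rightarrow> 'e set" where
  "\<Lambda>_coords i = coord i ` (\<Lambda> \<inter> core i 2)"

lemma \<Lambda>_coordsD: "y \<in> \<Lambda>_coords i \<Longrightarrow> param i y \<in> \<Lambda> \<and> param i y \<in> core i 2 \<and> y \<in> coord i ` cdom i \<and> coord i (param i y) = y"
  using core_sub by (auto simp: \<Lambda>_coords_def param_coord subset_iff)

lemma closed_\<Lambda>: "closed \<Lambda>" by (rule compact_imp_closed[OF compact_\<Lambda>])

lemma compact_\<Lambda>_coords: "compact (\<Lambda>_coords i)"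
  unfolding \<Lambda>_coords_def using compact_Int_closed[OF compact_core[of 2 i] closed_\<Lambda>] core_sub
  by (intro compact_continuous_image continuous_on_subset[OF coord_cont]) (auto simp: Int_commute)

lemma chart_splitting:
  assumes "y \<in> \<Lambda>_coords i" shows "splitting (chart_Es i y) (chart_Eu i y)"
proof -
  let ?p = "param i y" and ?c = "chart_at A i"
  have p: "?p \<in> \<Lambda>" "?p \<in> fst ?c" using \<Lambda>_coordsD[OF assms] core_sub by (auto simp: cdom_def)
  define L where "L = from_coords A ?c ?p"
  have lin: "linear L" unfolding L_def using p by (intro from_coords_linear chart_at)
  have inj: "L v = 0 \<Longrightarrow> v = 0" for v
    using from_coords_inverse(1)[OF chart_at(1) p(2), of v] by (simp add: L_def blinfun.zero_right)
  have surj: "\<exists>v. L v = w" for w using from_coords_inverse(2)[OF chart_at(1) p(2), of w] by (auto simp: L_def)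
  have sp: "subspace (Es ?p)" "subspace (Eu ?p)" "Es ?p \<inter> Eu ?p = {0}" using split[OF p(1)] by (auto simp: splitting_def)
  have e: "chart_Es i y = L -` Es ?p" "chart_Eu i y = L -` Eu ?p" by (auto simp: chart_Es_def chart_Eu_def L_def)
  have "\<exists>u\<in>L -` Es ?p. \<exists>v\<in>L -` Eu ?p. w = u + v" for w
  proof -
    obtain a b where ab: "a \<in> Es ?p" "b \<in> Eu ?p" "L w = a + b" using split[OF p(1)] unfolding splitting_def by blast
    obtain u where u: "L u = a" using surj by blast
    have "L (w - u) = b" using ab u lin by (simp add: linear_diff)
    then show ?thesis using ab u by (intro bexI[of _ u] bexI[of _ "w - u"]) auto
  qed
  moreover have "L -` Es ?p \<inter> L -` Eu ?p = {0}"
  proof -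
    have "v = 0" if "L v \<in> Es ?p" "L v \<in> Eu ?p" for v using inj sp(3) that by blast
    then show ?thesis using sp lin by (auto simp: linear_0 subspace_0)
  qed
  ultimately show ?thesis
    unfolding e splitting_def using sp lin by (auto intro: linear_subspace_vimage)
qed

text \<open>The charts in the definition of \<open>tangent_map\<close> may jump with the point. Near
  a given point the expression is rewritten as \<open>chart_norm\<close> in one target chart, where
  everything is continuous.\<close>

lemma iterate_norm_continuous:
  assumes c: "c \<in> A" and \<phi>: "C1_map A \<phi>"
  shows "continuous_on ((snd c ` fst c) \<times> UNIV)
    (\<lambda>(y, v). tangent_norm G (\<phi> (chart_inv c y)) (tangent_map A \<phi> (chart_inv c y) (from_coords A c (chart_inv c y) v)))"
    (is "continuous_on ?S ?N")
proof (rule continuous_on_local)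
  fix z :: "'e \<times> 'e" assume "z \<in> ?S"
  then obtain y v where z: "z = (y, v)" "y \<in> snd c ` fst c" by auto
  define c' where "c' = chart_at A (\<phi> (chart_inv c y))"
  have c': "c' \<in> A" "\<phi> (chart_inv c y) \<in> fst c'" by (auto simp: c'_def chart_at)
  let ?U = "rep_dom \<phi> c c'"
  have \<phi>c: "continuous_on UNIV \<phi>" using \<phi> by (simp add: C1_map_def)
  have U: "open ?U" "y \<in> ?U" using c c' z \<phi>c by (auto intro: open_rep_dom simp: rep_dom_iff)
  have im: "chart_rep \<phi> c c' w \<in> snd c' ` fst c'" if "w \<in> ?U" for w
    using that c by (auto simp: chart_rep_def rep_dom_iff)
  have "continuous_on (?U \<times> UNIV) (\<lambda>z. (chart_rep \<phi> c c' (fst z), rep_deriv \<phi> c c' (fst z) (snd z)))"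
    using c c' \<phi> \<phi>c
    by (intro continuous_intros blinfun.continuous_on continuous_on_compose2[OF continuous_on_chart_rep]
        continuous_on_compose2[OF C1_map_derivative(2)]) auto
  then have "continuous_on (?U \<times> UNIV) (\<lambda>z. (\<lambda>(y, w). chart_norm c' y w) (chart_rep \<phi> c c' (fst z), rep_deriv \<phi> c c' (fst z) (snd z)))"
    using im by (intro continuous_on_compose2[OF chart_norm_continuous[OF c'(1)]]) auto
  then have c1: "continuous_on (?U \<times> UNIV) ?N"
  proof (rule continuous_on_eq)
    fix z :: "'e \<times> 'e" assume "z \<in> ?U \<times> UNIV"
    then obtain w v where zz: "z = (w, v)" "w \<in> ?U" by auto
    define q where "q = chart_inv c w"
    have q: "q \<in> fst c" "\<phi> q \<in> fst c'" "snd c q = w"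
      using zz c by (auto simp: q_def rep_dom_iff chart_inv_mem chart_chart_inv chart_inv_chart)
    have "tangent_norm G (\<phi> q) (tangent_map A \<phi> q (from_coords A c q v))
        = tangent_norm G (\<phi> q) (from_coords A c' (\<phi> q) (rep_deriv \<phi> c c' w v))"
      using from_coords_rep_deriv_comm[OF \<phi> c c'(1) q(1,2), of v] q(3) by simp
    also have "\<dots> = chart_norm c' (snd c' (\<phi> q)) (rep_deriv \<phi> c c' w v)"
      using c' q by (intro tangent_norm_chart_norm)
    finally show "(\<lambda>(y, w). chart_norm c' y w) (chart_rep \<phi> c c' (fst z), rep_deriv \<phi> c c' (fst z) (snd z)) = ?N z"
      by (simp add: zz q_def chart_rep_def)
  qed
  show "\<exists>U. open U \<and> z \<in> U \<and> continuous_on (?S \<inter> U) ?N"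
  proof (intro exI[of _ "?U \<times> UNIV"] conjI)
    show "open (?U \<times> (UNIV :: 'e set))" using U by (intro open_Times open_UNIV)
    show "z \<in> ?U \<times> UNIV" using U z by simp
    show "continuous_on (?S \<inter> ?U \<times> UNIV) ?N" by (rule continuous_on_subset[OF c1]) auto
  qed
qed

text \<open>By \<open>Es_iff\<close> the bundle is an intersection over \<open>n\<close> of closed
  conditions. Continuity of the splitting rests on this closedness.\<close>

lemma closed_chart_Es: "closed {(y, v). y \<in> \<Lambda>_coords i \<and> v \<in> chart_Es i y}"
proof -
  let ?c = "chart_at A i"
  let ?N = "\<lambda>n z. tangent_norm G ((f ^^ n) (param i (fst z)))
     (tangent_map A (f ^^ n) (param i (fst z)) (from_coords A ?c (param i (fst z)) (snd z)))"
  have cont: "continuous_on (\<Lambda>_coords i \<times> UNIV) (?N n)" for n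
    using iterate_norm_continuous[OF chart_at(1) C1_funpow(1), of i n] \<Lambda>_coordsD[of _ i]
    unfolding case_prod_unfold param_def[symmetric] coord_def[symmetric] cdom_def[symmetric]
    by (auto intro: continuous_on_subset)
  have N0: "?N 0 z = tangent_norm G (param i (fst z)) (from_coords A ?c (param i (fst z)) (snd z))" for z
    unfolding funpow.simps tangent_map_id id_apply ..
  have "{(y, v). y \<in> \<Lambda>_coords i \<and> v \<in> chart_Es i y} =
      (\<Inter>n. {z \<in> \<Lambda>_coords i \<times> UNIV. ?N n z \<le> C * \<mu> ^ n * ?N 0 z})" (is "?L = ?R")
  proof (rule set_eqI)
    fix z
    have "z \<in> ?L \<longleftrightarrow> fst z \<in> \<Lambda>_coords i \<and> snd z \<in> chart_Es i (fst z)" by (simp add: case_prod_unfold)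
    also have "\<dots> \<longleftrightarrow> fst z \<in> \<Lambda>_coords i \<and> (\<forall>n. ?N n z \<le> C * \<mu> ^ n * ?N 0 z)"
    proof (rule conj_cong[OF refl])
      assume "fst z \<in> \<Lambda>_coords i"
      then have "param i (fst z) \<in> \<Lambda>" using \<Lambda>_coordsD by blast
      then show "snd z \<in> chart_Es i (fst z) \<longleftrightarrow> (\<forall>n. ?N n z \<le> C * \<mu> ^ n * ?N 0 z)"
        unfolding N0 chart_Es_def mem_Collect_eq by (rule Es_iff)
    qed
    also have "\<dots> \<longleftrightarrow> z \<in> ?R" by (simp add: mem_Times_iff)
    finally show "z \<in> ?L \<longleftrightarrow> z \<in> ?R" .
  qed
  moreover have "closed {z \<in> \<Lambda>_coords i \<times> UNIV. ?N n z \<le> C * \<mu> ^ n * ?N 0 z}" for n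
    using compact_imp_closed[OF compact_\<Lambda>_coords, of i]
    by (intro continuous_on_closed_Collect_le continuous_intros cont closed_Times) auto
  ultimately show ?thesis by (simp only:) (intro closed_INT ballI)
qed

lemma hyperbolic_system_inverse: "hyperbolic_system A G (inv f) \<Lambda> Eu Es C \<mu>"
proof unfold_locales
  have ii: "inv (inv f) = f" using bij by (rule inv_inv_eq)
  show "bij (inv f)" using bij by (rule bij_imp_bij_inv)
  show "C1_map A (inv f)" "C1_map A (inv (inv f))" using C1 C1_inv by (simp_all add: ii)
  show "inv f ` \<Lambda> = \<Lambda>" using inv_\<Lambda> bij by (metis bij_is_inj image_inv_f_f)
  have bwd: "tangent_map A (inv f) p ` E p = E (inv f p)" if p: "p \<in> \<Lambda>" and E: "\<And>p. p \<in> \<Lambda> \<Longrightarrow> tangent_map A f p ` E p = E (f p)" for p :: 'm and E :: "'m \<Rightarrow> 'e set"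
  proof -
    define q where "q = inv f p"
    have q: "f q = p" "q \<in> \<Lambda>"
      using p inv_\<Lambda> bij \<open>inv f ` \<Lambda> = \<Lambda>\<close> by (auto simp: q_def bij_is_surj surj_f_inv_f)
    have "tangent_map A (inv f) (f q) (tangent_map A f q v) = v" for v
      using tangent_map_inv_funpow[of 1 q v] by simp
    then have "tangent_map A (inv f) (f q) ` (tangent_map A f q ` E q) = E q" by (simp add: image_image)
    then show ?thesis using E[OF q(2)] q by (simp add: q_def)
  qed
  show "p \<in> \<Lambda> \<Longrightarrow> tangent_map A (inv f) p ` Eu p = Eu (inv f p)" for p using bwd Eu_inv by blast
  show "p \<in> \<Lambda> \<Longrightarrow> tangent_map A (inv f) p ` Es p = Es (inv f p)" for p using bwd Es_inv by blast
  show "splitting (Eu p) (Es p)" if "p \<in> \<Lambda>" for p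
    using split[OF that] unfolding splitting_def by (metis add.commute inf_commute)
qed (use compact_\<Lambda> C_pos \<mu> contr contr_inv inv_inv_eq[OF bij] in auto)

lemma closed_chart_Eu: "closed {(y, v). y \<in> \<Lambda>_coords i \<and> v \<in> chart_Eu i y}"
proof -
  interpret inverse: hyperbolic_system A G "inv f" \<Lambda> Eu Es C \<mu> by (rule hyperbolic_system_inverse)
  show ?thesis
    using inverse.closed_chart_Es[of i] by (simp add: inverse.chart_Es_def chart_Eu_def inverse.\<Lambda>_coords_def \<Lambda>_coords_def)
qed

end

section \<open>Uniform estimates for iterates in the finite cover\<close>

text \<open>A Lebesgue number for a cover of \<open>K\<close> by small open subsets of
  \<open>U\<close>; unlike in uniform continuity on \<open>K\<close>, the second point may leave
  \<open>K\<close>.\<close>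

lemma compact_uniform_neighbourhood:
  fixes \<Psi> :: "'a::euclidean_space \<Rightarrow> 'b::metric_space"
  assumes K: "compact K" "K \<subseteq> U" and U: "open U" and \<Psi>: "continuous_on U \<Psi>" and \<eta>: "\<eta> > 0"
  obtains r where "r > 0" "\<And>x w. x \<in> K \<Longrightarrow> dist x w < r \<Longrightarrow> w \<in> U \<and> dist (\<Psi> x) (\<Psi> w) < \<eta>"
proof -
  define \<G> where "\<G> = {V. open V \<and> V \<subseteq> U \<and> (\<forall>a\<in>V. \<forall>b\<in>V. dist (\<Psi> a) (\<Psi> b) < \<eta>)}"
  have "K \<subseteq> \<Union>\<G>"
  proof
    fix x assume x: "x \<in> K"
    let ?V = "U \<inter> \<Psi> -` ball (\<Psi> x) (\<eta> / 2)"
    have "open ?V" using \<Psi> U by (intro continuous_open_preimage) auto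
    moreover have "dist (\<Psi> a) (\<Psi> b) < \<eta>" if "a \<in> ?V" "b \<in> ?V" for a b
      using that dist_triangle_half_r[of "\<Psi> x" "\<Psi> a" \<eta> "\<Psi> b"] by auto
    ultimately have "?V \<in> \<G>" unfolding \<G>_def mem_Collect_eq by (intro conjI ballI) simp_all
    moreover have "x \<in> ?V" using x K \<eta> by auto
    ultimately show "x \<in> \<Union>\<G>" by blast
  qed
  then obtain e where e: "e > 0" "\<forall>x\<in>K. \<exists>V\<in>\<G>. ball x e \<subseteq> V"
    by (rule Heine_Borel_lemma[OF K(1)]) (auto simp: \<G>_def)
  show ?thesis
  proof (rule that[OF e(1)])
    fix x w assume xw: "x \<in> K" "dist x w < e"
    then obtain V where V: "V \<in> \<G>" "ball x e \<subseteq> V" using e by blast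
    have "x \<in> V" "w \<in> V" using V xw e(1) by auto
    then show "w \<in> U \<and> dist (\<Psi> x) (\<Psi> w) < \<eta>" using V by (auto simp: \<G>_def)
  qed
qed

text \<open>The mean value inequality, with the derivative taken at a third point \<open>q\<close>:
  in the application the expansion is around an orbit point, while the linear part belongs to a
  point of \<Lambda>. Comparing two derivatives through the one at \<open>x\<close> costs the factor
  2.\<close>

lemma linear_approximation_on_ball:
  fixes T :: "'a::real_normed_vector \<Rightarrow> 'b::real_normed_vector" and D :: "'a \<Rightarrow> 'a \<Rightarrow>\<^sub>L 'b"
  assumes d: "\<And>w. w \<in> ball x r \<Longrightarrow> (T has_derivative D w) (at w)"
    and near: "\<And>w. w \<in> ball x r \<Longrightarrow> dist (D x) (D w) \<le> \<eta>"
    and w: "w \<in> ball x r" "q \<in> ball x r"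
  shows "norm (T w - T x - D q (w - x)) \<le> 2 * \<eta> * norm (w - x)"
proof -
  have r: "r > 0" using w(1) by (metis ball_eq_empty empty_iff not_le)
  let ?g = "\<lambda>z. T z - D q z"
  have "norm (?g w - ?g x) \<le> (2 * \<eta>) * norm (w - x)"
  proof (rule differentiable_bound[of "ball x r" ?g "\<lambda>z v. D z v - D q v"])
    show "(?g has_derivative (\<lambda>v. D z v - D q v)) (at z within ball x r)" if "z \<in> ball x r" for z
      by (rule has_derivative_diff[OF has_derivative_at_withinI[OF d[OF that]]
            bounded_linear_imp_has_derivative[OF blinfun.bounded_linear_right]])
    show "onorm (\<lambda>v. D z v - D q v) \<le> 2 * \<eta>" if "z \<in> ball x r" for z
    proof -
      have "onorm (\<lambda>v. D z v - D q v) = norm (D z - D q)"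
        by (simp add: norm_blinfun.rep_eq minus_blinfun.rep_eq)
      also have "\<dots> \<le> dist (D x) (D z) + dist (D x) (D q)"
        using dist_triangle3[of "D z" "D q" "D x"] by (simp add: dist_norm)
      also have "\<dots> \<le> 2 * \<eta>" using near[OF that] near[OF w(2)] by simp
      finally show ?thesis .
    qed
  qed (use w r in auto)
  then show ?thesis by (simp add: blinfun.diff_right algebra_simps)
qed

context hyperbolic_system
begin

abbreviation cha :: "'m \<Rightarrow> ('m, 'e) chart" where "cha \<equiv> chart_at A"

definition stable_proj :: "'m \<Rightarrow> 'e \<Rightarrow> 'e \<Rightarrow> 'e" where
  "stable_proj i y = split_proj (chart_Es i y) (chart_Eu i y)"

lemma funpow_funpow_inv: "(f ^^ n) ((inv f ^^ n) x) = x"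
  using funpow_inv_funpow[OF bij_imp_bij_inv[OF bij], of n x] by (simp add: inv_inv_eq[OF bij])

text \<open>The constant multiplies the smaller side, so the estimates survive shrinking it, which
  is the monotonicity that \<open>finite_uniform\<close> asks for.\<close>

lemma chart_norm_uniform_bounds:
  obtains \<kappa> where "\<kappa> > 0"
    "\<And>i y w. i \<in> centres \<Longrightarrow> y \<in> cball (coord i i) (2 * rad i) \<Longrightarrow> \<kappa> * norm w \<le> chart_norm (cha i) y w"
    "\<And>i y w. i \<in> centres \<Longrightarrow> y \<in> cball (coord i i) (2 * rad i) \<Longrightarrow> \<kappa> * chart_norm (cha i) y w \<le> norm w"
proof -
  have "\<exists>\<kappa>>0. \<forall>i\<in>centres. \<forall>y\<in>cball (coord i i) (2 * rad i). \<forall>w. \<kappa> * norm w \<le> chart_norm (cha i) y w \<and> \<kappa> * chart_norm (cha i) y w \<le> norm w"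
  proof (rule finite_uniform[OF centres(1)])
    fix i
    obtain k where k: "k > 0" "\<And>y w. y \<in> cball (coord i i) (2 * rad i) \<Longrightarrow> norm w \<le> k * chart_norm (cha i) y w"
      "\<And>y w. y \<in> cball (coord i i) (2 * rad i) \<Longrightarrow> chart_norm (cha i) y w \<le> k * norm w"
      by (rule chart_norm_bounds[OF chart_at(1) compact_cball cball_core_sub[of 2 i, unfolded coord_def cdom_def], folded coord_def]) auto
    then show "\<exists>\<kappa>>0. \<forall>y\<in>cball (coord i i) (2 * rad i). \<forall>w. \<kappa> * norm w \<le> chart_norm (cha i) y w \<and> \<kappa> * chart_norm (cha i) y w \<le> norm w"
      by (intro exI[of _ "1 / k"]) (auto simp: field_simps)
  next
    fix i \<kappa> \<kappa>' assume q: "\<forall>y\<in>cball (coord i i) (2 * rad i). \<forall>w. \<kappa> * norm w \<le> chart_norm (cha i) y w \<and> \<kappa> * chart_norm (cha i) y w \<le> norm w"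
      and k: "0 < \<kappa>'" "\<kappa>' \<le> (\<kappa>::real)"
    have cn: "chart_norm (cha i) y w \<ge> 0" for y w by (simp add: chart_norm_def tangent_norm_nonneg)
    show "\<forall>y\<in>cball (coord i i) (2 * rad i). \<forall>w. \<kappa>' * norm w \<le> chart_norm (cha i) y w \<and> \<kappa>' * chart_norm (cha i) y w \<le> norm w"
      using q mult_right_mono[OF k(2) norm_ge_zero] mult_right_mono[OF k(2) cn] by (meson order_trans)
  qed
  then show ?thesis using that by blast
qed

lemma stable_proj_uniform_bound:
  obtains K where "K > 0" "\<And>i y v. i \<in> centres \<Longrightarrow> y \<in> \<Lambda>_coords i \<Longrightarrow> norm (stable_proj i y v) \<le> K * norm v"
    "\<And>i y v. i \<in> centres \<Longrightarrow> y \<in> \<Lambda>_coords i \<Longrightarrow> norm (v - stable_proj i y v) \<le> K * norm v"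
proof -
  have "\<exists>\<kappa>>0. \<forall>i\<in>centres. \<forall>y\<in>\<Lambda>_coords i. \<forall>v. \<kappa> * norm (stable_proj i y v) \<le> norm v"
  proof (rule finite_uniform[OF centres(1)])
    fix i
    obtain k where k: "k > 0" "\<And>y v. y \<in> \<Lambda>_coords i \<Longrightarrow> norm (split_proj (chart_Es i y) (chart_Eu i y) v) \<le> k * norm v"
      by (rule split_proj_bounded[OF compact_\<Lambda>_coords chart_splitting closed_chart_Es closed_chart_Eu]) auto
    then show "\<exists>\<kappa>>0. \<forall>y\<in>\<Lambda>_coords i. \<forall>v. \<kappa> * norm (stable_proj i y v) \<le> norm v"
      by (intro exI[of _ "1 / k"]) (auto simp: field_simps stable_proj_def)
  next
    fix i \<kappa> \<kappa>' assume q: "\<forall>y\<in>\<Lambda>_coords i. \<forall>v. \<kappa> * norm (stable_proj i y v) \<le> norm v" and k: "0 < \<kappa>'" "\<kappa>' \<le> (\<kappa>::real)"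
    show "\<forall>y\<in>\<Lambda>_coords i. \<forall>v. \<kappa>' * norm (stable_proj i y v) \<le> norm v"
      using q mult_right_mono[OF k(2) norm_ge_zero] by (meson order_trans)
  qed
  then obtain \<kappa> where \<kappa>: "\<kappa> > 0" "\<And>i y v. i \<in> centres \<Longrightarrow> y \<in> \<Lambda>_coords i \<Longrightarrow> \<kappa> * norm (stable_proj i y v) \<le> norm v" by blast
  have 1: "norm (stable_proj i y v) \<le> 1 / \<kappa> * norm v" if "i \<in> centres" "y \<in> \<Lambda>_coords i" for i y v
    using \<kappa>(2)[OF that, of v] \<kappa>(1) by (simp add: field_simps)
  show ?thesis
  proof (rule that[of "1 + 1 / \<kappa>"])
    fix i y and v :: 'e assume iy: "i \<in> centres" "y \<in> \<Lambda>_coords i"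
    have "(1 + 1 / \<kappa>) * norm v = norm v + 1 / \<kappa> * norm v" by (simp add: algebra_simps)
    then show "norm (stable_proj i y v) \<le> (1 + 1 / \<kappa>) * norm v" "norm (v - stable_proj i y v) \<le> (1 + 1 / \<kappa>) * norm v"
      using 1[OF iy, of v] norm_triangle_ineq4[of v "stable_proj i y v"] norm_ge_zero[of v] by linarith+
  qed (use \<kappa>(1) in \<open>simp add: add_pos_pos\<close>)
qed

text \<open>Passing from coordinate norms to the Riemannian norm and back costs one factor
  \<open>\<kappa>\<close> each way, hence the square; the 4 is the rate required by
  \<open>hyp_block\<close>. Vectors over points of \<Lambda> then contract and expand by
  \<open>l < 1/4\<close> in coordinates.\<close>

lemma rep_deriv_block:
  assumes \<kappa>: "\<kappa> > 0" and m: "C * \<mu> ^ m < \<kappa>\<^sup>2 / 4"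
    and k1: "\<And>i y w. i \<in> centres \<Longrightarrow> y \<in> cball (coord i i) (2 * rad i) \<Longrightarrow> \<kappa> * norm w \<le> chart_norm (cha i) y w"
    and k2: "\<And>i y w. i \<in> centres \<Longrightarrow> y \<in> cball (coord i i) (2 * rad i) \<Longrightarrow> \<kappa> * chart_norm (cha i) y w \<le> norm w"
    and i: "i \<in> centres" "i' \<in> centres"
  shows "\<exists>\<eta>>0. \<forall>y\<in>\<Lambda>_coords i. \<forall>y'\<in>\<Lambda>_coords i'. (f ^^ m) (param i y) \<in> core i' 2 \<longrightarrow>
    dist (coord i' ((f ^^ m) (param i y))) y' < \<eta> \<longrightarrow>
    hyp_block (stable_proj i y) (stable_proj i' y') (rep_deriv (f ^^ m) (cha i) (cha i') y)"
proof -
  let ?F = "f ^^ m" and ?Fi = "inv f ^^ m"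
  \<comment> \<open>Only points whose image can be read in the target chart are relevant; requiring
    the image in a compact core keeps this set compact.\<close>
  define X where "X = {y \<in> \<Lambda>_coords i. ?F (param i y) \<in> core i' 2}"
  have Fc: "continuous_on UNIV ?F" using C1_funpow(1) by (simp add: C1_map_def)
  have pX: "param i y \<in> \<Lambda>" "param i y \<in> fst (cha i)" "?F (param i y) \<in> \<Lambda>" "?F (param i y) \<in> fst (cha i')"
    "snd (cha i) (param i y) = y" "y \<in> cball (coord i i) (2 * rad i)"
    "coord i' (?F (param i y)) \<in> cball (coord i' i') (2 * rad i')" if "y \<in> X" for y
    using that \<Lambda>_coordsD[of y i] core_sub[of i 2] core_sub[of i' 2] \<Lambda>_funpow[of "param i y" m]
    by (auto simp: X_def cdom_def[symmetric] coord_def[symmetric] core_def)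
  have TX: "chart_rep ?F (cha i) (cha i') y = coord i' (?F (param i y))" for y
    by (simp add: chart_rep_def coord_def param_def)
  have Xdom: "X \<subseteq> rep_dom ?F (cha i) (cha i')"
    using chart_in_rep_dom[OF chart_at(1), of _ i ?F "cha i'"] pX by (metis subsetI)
  have cX: "compact X"
  proof -
    have "X = \<Lambda>_coords i \<inter> (\<lambda>y. ?F (param i y)) -` core i' 2" by (auto simp: X_def)
    moreover have "continuous_on (\<Lambda>_coords i) (\<lambda>y. ?F (param i y))"
      using \<Lambda>_coordsD[of _ i] by (intro continuous_on_compose2[OF Fc] continuous_on_subset[OF param_cont]) auto
    ultimately have "closed X"
      using compact_imp_closed[OF compact_\<Lambda>_coords] compact_imp_closed[OF compact_core[of 2 i']]
      by (simp add: continuous_closed_preimage)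
    moreover have "X = \<Lambda>_coords i \<inter> X" by (auto simp: X_def)
    ultimately show ?thesis using compact_Int_closed[OF compact_\<Lambda>_coords] by metis
  qed
  have gX: "closed {(y, v). y \<in> X \<and> v \<in> E y}" if "closed {(y, v). y \<in> \<Lambda>_coords i \<and> v \<in> E y}" for E :: "'e \<Rightarrow> 'e set"
  proof -
    have "{(y, v). y \<in> X \<and> v \<in> E y} = {(y, v). y \<in> \<Lambda>_coords i \<and> v \<in> E y} \<inter> (X \<times> UNIV)" by (auto simp: X_def)
    then show ?thesis using that compact_imp_closed[OF cX] by (simp only:) (intro closed_Int closed_Times closed_UNIV)
  qed
  let ?A = "rep_deriv ?F (cha i) (cha i')"
  let ?B = "\<lambda>y. rep_deriv ?Fi (cha i') (cha i) (chart_rep ?F (cha i) (cha i') y)"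
  have cA: "continuous_on X ?A"
    using C1_map_derivative(2)[OF C1_funpow(1) chart_at(1) chart_at(1)] Xdom by (rule continuous_on_subset)
  have cT: "continuous_on X (chart_rep ?F (cha i) (cha i'))"
    using continuous_on_chart_rep[OF chart_at(1) chart_at(1) Fc] Xdom by (rule continuous_on_subset)
  have iF: "?Fi \<circ> ?F = id" "?F \<circ> ?Fi = id" using funpow_inv_funpow[OF bij] funpow_funpow_inv by auto
  have cB: "continuous_on X ?B"
  proof (rule continuous_on_compose2[OF C1_map_derivative(2)[OF C1_funpow(2) chart_at(1) chart_at(1)] cT])
    show "chart_rep ?F (cha i) (cha i') ` X \<subseteq> rep_dom ?Fi (cha i') (cha i)"
    proof
      fix z assume "z \<in> chart_rep ?F (cha i) (cha i') ` X"
      then obtain y where y: "y \<in> X" "z = snd (cha i') (?F (param i y))" by (auto simp: TX coord_def)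
      then show "z \<in> rep_dom ?Fi (cha i') (cha i)"
        using pX[OF y(1)] funpow_inv_funpow[OF bij, of m] by (simp add: chart_in_rep_dom chart_at)
    qed
  qed
  have BA: "?B y (?A y w) = w" and AB: "?A y (?B y w) = w" if y: "y \<in> X" for y w
  proof -
    note p = pX[OF y]
    have fi: "?Fi (?F (param i y)) = param i y" by (rule funpow_inv_funpow[OF bij])
    have T: "chart_rep ?F (cha i) (cha i') y = snd (cha i') (?F (param i y))" by (simp add: TX coord_def)
    have idy: "rep_deriv id (cha i) (cha i) y = id_blinfun"
      using rep_deriv_id[OF chart_at(1) p(2)] p(5) by simp
    have "?B y o\<^sub>L ?A y = id_blinfun"
      using rep_deriv_comp[OF C1_funpow chart_at(1) chart_at(1) chart_at(1), of "param i y" i m i' m i] p fi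
      by (simp add: iF T idy)
    then show "?B y (?A y w) = w" by (metis blinfun_apply_blinfun_compose id_blinfun.rep_eq id_apply)
    have "?A y o\<^sub>L ?B y = id_blinfun"
      using rep_deriv_comp[OF C1_funpow(2) C1_funpow(1) chart_at(1) chart_at(1) chart_at(1), of "?F (param i y)" i' m i m i'] p fi
      by (simp add: iF T rep_deriv_id chart_at)
    then show "?A y (?B y w) = w" by (metis blinfun_apply_blinfun_compose id_blinfun.rep_eq id_apply)
  qed
  have conj: "from_coords A (cha i') (?F (param i y)) (?A y v) = tangent_map A ?F (param i y) (from_coords A (cha i) (param i y) v)"
    if y: "y \<in> X" for y v
    using from_coords_rep_deriv_comm[OF C1_funpow(1) chart_at(1) chart_at(1), of "param i y" i m i' v] pX[OF y] by simp
  have T_in: "chart_rep ?F (cha i) (cha i') y \<in> \<Lambda>_coords i'" if "y \<in> X" for y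
    using pX[OF that] that by (auto simp: TX \<Lambda>_coords_def X_def)
  have parT: "param i' (chart_rep ?F (cha i) (cha i') y) = ?F (param i y)" if "y \<in> X" for y
    using pX[OF that] by (simp add: TX param_coord cdom_def)
  have norms: "chart_norm (cha i) y v = tangent_norm G (param i y) (from_coords A (cha i) (param i y) v)"
    "chart_norm (cha i') (coord i' (?F (param i y))) (?A y v) = tangent_norm G (?F (param i y)) (tangent_map A ?F (param i y) (from_coords A (cha i) (param i y) v))"
    if y: "y \<in> X" for y v
    using parT[OF y] unfolding TX by (simp_all add: chart_norm_def param_def[symmetric] conj[OF y])
  have c0: "C * \<mu> ^ m > 0" using C_pos \<mu> by simp
  \<comment> \<open>The rate of contraction in coordinates, with both chart distortions
    included.\<close>
  define l where "l = C * \<mu> ^ m / \<kappa>\<^sup>2"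
  have l: "0 < l" "l < 1/4" using c0 m \<kappa> by (auto simp: l_def field_simps)
  have lk: "a \<le> l * b" if "\<kappa> * a \<le> C * \<mu> ^ m * c" "\<kappa> * c \<le> b" for a b c
  proof -
    have "\<kappa>\<^sup>2 * a = \<kappa> * (\<kappa> * a)" by (simp add: power2_eq_square)
    also have "\<dots> \<le> \<kappa> * (C * \<mu> ^ m * c)" using that(1) \<kappa> by (intro mult_left_mono) auto
    also have "\<dots> = C * \<mu> ^ m * (\<kappa> * c)" by simp
    also have "\<dots> \<le> C * \<mu> ^ m * b" using that(2) c0 by (intro mult_left_mono) auto
    finally show ?thesis using \<kappa> by (simp add: l_def field_simps)
  qed
  obtain \<eta> where \<eta>: "\<eta> > 0" "\<And>y y'. y \<in> X \<Longrightarrow> y' \<in> \<Lambda>_coords i' \<Longrightarrow> dist (chart_rep ?F (cha i) (cha i') y) y' < \<eta> \<Longrightarrow>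
     hyp_block (split_proj (chart_Es i y) (chart_Eu i y)) (split_proj (chart_Es i' y') (chart_Eu i' y')) (?A y)"
  proof (rule near_hyp_block[of X "chart_Es i" "chart_Eu i" "\<Lambda>_coords i'" "chart_Es i'" "chart_Eu i'" "chart_rep ?F (cha i) (cha i')" ?A ?B l])
    show "splitting (chart_Es i y) (chart_Eu i y)" if "y \<in> X" for y using chart_splitting that by (auto simp: X_def)
    fix y v assume y: "y \<in> X"
    show "v \<in> chart_Es i y \<Longrightarrow> ?A y v \<in> chart_Es i' (chart_rep ?F (cha i) (cha i') y)"
      using tangent_map_funpow_image(1)[OF pX(1)[OF y], of m] by (auto simp: chart_Es_def parT[OF y] conj[OF y])
    show "v \<in> chart_Eu i y \<Longrightarrow> ?A y v \<in> chart_Eu i' (chart_rep ?F (cha i) (cha i') y)"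
      using tangent_map_funpow_image(2)[OF pX(1)[OF y], of m] by (auto simp: chart_Eu_def parT[OF y] conj[OF y])
    show "norm (?A y v) \<le> l * norm v" if "v \<in> chart_Es i y"
    proof (rule lk)
      have "\<kappa> * norm (?A y v) \<le> chart_norm (cha i') (coord i' (?F (param i y))) (?A y v)"
        using k1[OF i(2)] pX[OF y] by blast
      also have "\<dots> \<le> C * \<mu> ^ m * chart_norm (cha i) y v"
        unfolding norms[OF y] using that by (intro contr[OF pX(1)[OF y]]) (simp add: chart_Es_def)
      finally show "\<kappa> * norm (?A y v) \<le> C * \<mu> ^ m * chart_norm (cha i) y v" .
      show "\<kappa> * chart_norm (cha i) y v \<le> norm v" using k2[OF i(1)] pX[OF y] by blast
    qed
    show "norm v \<le> l * norm (?A y v)" if "v \<in> chart_Eu i y"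
    proof (rule lk)
      have "\<kappa> * norm v \<le> chart_norm (cha i) y v" using k1[OF i(1)] pX[OF y] by blast
      also have "\<dots> \<le> C * \<mu> ^ m * chart_norm (cha i') (coord i' (?F (param i y))) (?A y v)"
        unfolding norms[OF y] using that by (intro expa[OF pX(1)[OF y]]) (simp add: chart_Eu_def)
      finally show "\<kappa> * norm v \<le> C * \<mu> ^ m * chart_norm (cha i') (coord i' (?F (param i y))) (?A y v)" .
      show "\<kappa> * chart_norm (cha i') (coord i' (?F (param i y))) (?A y v) \<le> norm (?A y v)"
        using k2[OF i(2)] pX[OF y] by blast
    qed
  qed (use l in \<open>auto intro: cX gX closed_chart_Es closed_chart_Eu compact_\<Lambda>_coords chart_splitting T_in cA cB cT BA AB\<close>)
  then show ?thesis by (intro exI[of _ \<eta>]) (auto simp: X_def TX stable_proj_def)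
qed

end

section \<open>Inverse shadowing near a hyperbolic set\<close>

context riemannian_manifold
begin

lemma core_coordinates_uniform:
  assumes "e > 0"
  obtains \<delta> where "\<delta> > 0" "\<And>i a b. i \<in> centres \<Longrightarrow> a \<in> core i 2 \<Longrightarrow> mdist a b < \<delta> \<Longrightarrow>
      b \<in> cdom i \<and> dist (coord i a) (coord i b) < e"
proof -
  have "\<exists>\<delta>>0. \<forall>i\<in>centres. \<forall>a b. a \<in> core i 2 \<longrightarrow> mdist a b < \<delta> \<longrightarrow> b \<in> cdom i \<and> dist (coord i a) (coord i b) < e"
  proof (rule finite_uniform[OF centres(1)])
    fix i
    show "\<exists>\<delta>>0. \<forall>a b. a \<in> core i 2 \<longrightarrow> mdist a b < \<delta> \<longrightarrow> b \<in> cdom i \<and> dist (coord i a) (coord i b) < e"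
      by (rule mdist.compact_coordinates_uniform[OF compact_core[of 2 i] core_sub open_cdom coord_cont assms]) auto
  qed auto
  then show ?thesis using that by blast
qed

lemma param_uniform:
  assumes "e > 0"
  obtains \<delta> where "\<delta> > 0" "\<And>i y z. i \<in> centres \<Longrightarrow> y \<in> cball (coord i i) (2 * rad i) \<Longrightarrow>
      z \<in> cball (coord i i) (2 * rad i) \<Longrightarrow> dist y z < \<delta> \<Longrightarrow> mdist (param i y) (param i z) < e"
proof -
  have "\<exists>\<delta>>0. \<forall>i\<in>centres. \<forall>y z. y \<in> cball (coord i i) (2 * rad i) \<longrightarrow> z \<in> cball (coord i i) (2 * rad i) \<longrightarrow>
      dist y z < \<delta> \<longrightarrow> mdist (param i y) (param i z) < e"
  proof (rule finite_uniform[OF centres(1)])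
    fix i
    have "continuous_on (cball (coord i i) (2 * rad i)) (param i)"
      using cball_core_sub[of 2 i] by (intro continuous_on_subset[OF param_cont]) auto
    from mdist.parametrization_uniform[OF compact_cball this assms]
    show "\<exists>\<delta>>0. \<forall>y z. y \<in> cball (coord i i) (2 * rad i) \<longrightarrow> z \<in> cball (coord i i) (2 * rad i) \<longrightarrow>
      dist y z < \<delta> \<longrightarrow> mdist (param i y) (param i z) < e" by metis
  qed auto
  then show ?thesis using that by blast
qed

text \<open>The points of one core of radius 1 sent into another form a compact set. The gap between
  radii 1 and 2, at source and target, leaves room for a common \<open>r\<close>, and continuity of
  the derivative gives the rest.\<close>

lemma chart_rep_uniform_C1:
  assumes F: "C1_map A F" and \<eta>: "\<eta> > 0"
  shows "\<exists>r>0. \<forall>i\<in>centres. \<forall>i'\<in>centres. \<forall>x w. x \<in> core i 1 \<longrightarrow> F x \<in> core i' 1 \<longrightarrow> dist (coord i x) w < r \<longrightarrow>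
     w \<in> ball (coord i i) (2 * rad i) \<and> F (param i w) \<in> core i' 2 \<and> w \<in> rep_dom F (chart_at A i) (chart_at A i') \<and>
     dist (rep_deriv F (chart_at A i) (chart_at A i') (coord i x)) (rep_deriv F (chart_at A i) (chart_at A i') w) < \<eta>"
    (is "\<exists>r>0. \<forall>i\<in>_. \<forall>i'\<in>_. ?Q i i' r")
proof -
  have Fc: "continuous_on UNIV F" using F by (simp add: C1_map_def)
  have pair: "\<exists>r>0. ?Q i i' r" for i i'
  proof -
    define K where "K = coord i ` (core i 1 \<inter> F -` core i' 1)"
    define U where "U = ball (coord i i) (2 * rad i) \<inter> (\<lambda>w. F (param i w)) -` ocore i' 2"
    have bsub: "ball (coord i i) (2 * rad i) \<subseteq> coord i ` cdom i" using cball_core_sub[of 2 i] by auto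
    have cF: "continuous_on (ball (coord i i) (2 * rad i)) (\<lambda>w. F (param i w))"
      using bsub by (intro continuous_on_compose2[OF Fc continuous_on_subset[OF param_cont]]) auto
    have oU: "open U" unfolding U_def by (intro continuous_open_preimage[OF cF] open_ocore open_ball)
    have "closed (F -` core i' 1)" using compact_imp_closed[OF compact_core[of 1 i']] Fc by (intro closed_vimage) auto
    then have cK: "compact K" unfolding K_def
      using compact_core[of 1 i] core_sub[of i 1]
      by (intro compact_continuous_image continuous_on_subset[OF coord_cont] compact_Int_closed) auto
    have KU: "K \<subseteq> U"
    proof
      fix w assume "w \<in> K"
      then obtain x where x: "w = coord i x" "x \<in> core i 1" "F x \<in> core i' 1" by (auto simp: K_def)
      then show "w \<in> U" using rad(1)[of i] rad(1)[of i'] param_coord[of x i] by (auto simp: U_def core_def ocore_def)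
    qed
    have Udom: "U \<subseteq> rep_dom F (chart_at A i) (chart_at A i')"
      using bsub by (auto simp: U_def rep_dom_iff chart_at param_def ocore_def cdom_def coord_def)
    obtain r where r: "r > 0" "\<And>y w. y \<in> K \<Longrightarrow> dist y w < r \<Longrightarrow> w \<in> U \<and>
        dist (rep_deriv F (chart_at A i) (chart_at A i') y) (rep_deriv F (chart_at A i) (chart_at A i') w) < \<eta>"
      by (rule compact_uniform_neighbourhood[OF cK KU oU continuous_on_subset[OF C1_map_derivative(2)[OF F chart_at(1) chart_at(1)] Udom] \<eta>]) auto
    have "ocore i' 2 \<subseteq> core i' 2" by (auto simp: ocore_def core_def)
    then have "?Q i i' r" using r(2) Udom by (fastforce simp: K_def U_def)
    then show ?thesis using r(1) by blast
  qed
  have "\<exists>r>0. \<forall>z\<in>centres \<times> centres. ?Q (fst z) (snd z) r"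
  proof (rule finite_uniform)
    show "finite (centres \<times> centres)" using centres(1) by simp
    show "\<exists>r>0. ?Q (fst z) (snd z) r" for z by (rule pair)
    show "?Q (fst z) (snd z) r \<Longrightarrow> 0 < r' \<Longrightarrow> r' \<le> r \<Longrightarrow> ?Q (fst z) (snd z) r'" for z r r'
      by (meson less_le_trans)
  qed
  then show ?thesis by auto
qed

end

context hyperbolic_system
begin

lemma stable_proj:
  assumes "y \<in> \<Lambda>_coords i"
  shows "linear (stable_proj i y)" and "stable_proj i y (stable_proj i y v) = stable_proj i y v"
  unfolding stable_proj_def
  using split_proj_linear[OF chart_splitting[OF assms]] split_proj(1)[OF chart_splitting[OF assms]]
    split_proj_id[OF chart_splitting[OF assms]] by auto

text \<open>The iterate \<open>m\<close> is fixed first, then \<delta> and \<open>V\<close> from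
  \<eta>; none of them depends on the number \<open>n\<close> of steps, which permits the passage to
  infinite time. Around the orbit, in charts of the finite cover, the maps \<open>g j\<close>
  satisfy the hypotheses of \<open>hyperbolic_segment_exists\<close>.\<close>

lemma segment_shadowing:
  obtains m where "m \<ge> 1"
    "\<And>\<eta>. \<eta> > 0 \<Longrightarrow> \<exists>\<delta>>0. \<exists>V. open V \<and> \<Lambda> \<subseteq> V \<and>
      (\<forall>x g. (\<forall>j. (f ^^ (j * m)) x \<in> V) \<longrightarrow> (\<forall>j. continuous_on UNIV (g j)) \<longrightarrow>
         (\<forall>j y. mdist (g j y) ((f ^^ m) y) < \<delta>) \<longrightarrow>
         (\<forall>n. \<exists>y. (\<forall>j<n. y (Suc j) = g j (y j)) \<and> (\<forall>j\<le>n. mdist (y j) ((f ^^ (j * m)) x) < \<eta>)))"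
proof -
  obtain \<kappa> where \<kappa>: "\<kappa> > 0"
    "\<And>i y w. i \<in> centres \<Longrightarrow> y \<in> cball (coord i i) (2 * rad i) \<Longrightarrow> \<kappa> * norm w \<le> chart_norm (cha i) y w"
    "\<And>i y w. i \<in> centres \<Longrightarrow> y \<in> cball (coord i i) (2 * rad i) \<Longrightarrow> \<kappa> * chart_norm (cha i) y w \<le> norm w"
    using chart_norm_uniform_bounds by metis
  have "(\<lambda>n. C * \<mu> ^ n) \<longlonglongrightarrow> C * 0" using \<mu> by (intro tendsto_intros) simp
  then have "\<forall>\<^sub>F n in sequentially. C * \<mu> ^ n < \<kappa>\<^sup>2 / 4" using \<kappa>(1) by (intro order_tendstoD(2)) auto
  then have "\<forall>\<^sub>F n in sequentially. C * \<mu> ^ n < \<kappa>\<^sup>2 / 4 \<and> n \<ge> 1" using eventually_ge_at_top by (rule eventually_conj)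
  then obtain m where m: "C * \<mu> ^ m < \<kappa>\<^sup>2 / 4" "m \<ge> 1" using eventually_happens by force
  let ?F = "f ^^ m"
  have FC1: "C1_map A ?F" by (rule C1_funpow)
  have Fc: "continuous_on UNIV ?F" using FC1 by (simp add: C1_map_def)
  show ?thesis
  proof (rule that[OF m(2)])
    fix \<eta> :: real assume \<eta>: "\<eta> > 0"
    obtain K where K: "K > 0" "\<And>i y v. i \<in> centres \<Longrightarrow> y \<in> \<Lambda>_coords i \<Longrightarrow> norm (stable_proj i y v) \<le> K * norm v"
      "\<And>i y v. i \<in> centres \<Longrightarrow> y \<in> \<Lambda>_coords i \<Longrightarrow> norm (v - stable_proj i y v) \<le> K * norm v"
      using stable_proj_uniform_bound by metis
    have "\<exists>\<eta>B>0. \<forall>z\<in>centres \<times> centres. \<forall>y\<in>\<Lambda>_coords (fst z). \<forall>y'\<in>\<Lambda>_coords (snd z). ?F (param (fst z) y) \<in> core (snd z) 2 \<longrightarrow>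
      dist (coord (snd z) (?F (param (fst z) y))) y' < \<eta>B \<longrightarrow>
      hyp_block (stable_proj (fst z) y) (stable_proj (snd z) y') (rep_deriv ?F (cha (fst z)) (cha (snd z)) y)"
    proof (rule finite_uniform)
      show "finite (centres \<times> centres)" using centres(1) by simp
    qed (use rep_deriv_block[OF \<kappa>(1) m(1) \<kappa>(2,3)] in \<open>auto intro: less_le_trans\<close>)
    then obtain \<eta>B where \<eta>B: "\<eta>B > 0" "\<And>i i' y y'. i \<in> centres \<Longrightarrow> i' \<in> centres \<Longrightarrow> y \<in> \<Lambda>_coords i \<Longrightarrow> y' \<in> \<Lambda>_coords i' \<Longrightarrow>
        ?F (param i y) \<in> core i' 2 \<Longrightarrow> dist (coord i' (?F (param i y))) y' < \<eta>B \<Longrightarrow>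
        hyp_block (stable_proj i y) (stable_proj i' y') (rep_deriv ?F (cha i) (cha i') y)" by auto
    \<comment> \<open>Vectors of the boxes have norm at most \<open>2 * r\<close>, so the
      linearisation error is at most \<open>2 * \<eta>0 * (2 * r) = r / (8 * K)\<close>.\<close>
    define \<eta>0 where "\<eta>0 = 1 / (32 * K)"
    have \<eta>0: "\<eta>0 > 0" using K(1) by (simp add: \<eta>0_def)
    obtain r0 where r0: "r0 > 0" and NL: "\<And>i i' x w. i \<in> centres \<Longrightarrow> i' \<in> centres \<Longrightarrow> x \<in> core i 1 \<Longrightarrow> ?F x \<in> core i' 1 \<Longrightarrow>
        dist (coord i x) w < r0 \<Longrightarrow>
        w \<in> ball (coord i i) (2 * rad i) \<and> ?F (param i w) \<in> core i' 2 \<and> w \<in> rep_dom ?F (cha i) (cha i') \<and>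
        dist (rep_deriv ?F (cha i) (cha i') (coord i x)) (rep_deriv ?F (cha i) (cha i') w) < \<eta>0"
      using chart_rep_uniform_C1[OF FC1 \<eta>0] by blast
    obtain \<delta>p where \<delta>p: "\<delta>p > 0" "\<And>i y z. i \<in> centres \<Longrightarrow> y \<in> cball (coord i i) (2 * rad i) \<Longrightarrow>
      z \<in> cball (coord i i) (2 * rad i) \<Longrightarrow> dist y z < \<delta>p \<Longrightarrow> mdist (param i y) (param i z) < \<eta>"
      using param_uniform[OF \<eta>] by metis
    \<comment> \<open>The boxes have to fit into the domain of the estimates, of radius
      \<open>r0\<close>, and displacements inside them must stay below \<open>\<eta>\<close> for
      \<open>mdist\<close>.\<close>
    define r where "r = min r0 \<delta>p / 4"
    have r: "r > 0" "2 * r < r0" "2 * r < \<delta>p" using r0 \<delta>p by (auto simp: r_def)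
    \<comment> \<open>The other half of the error budget, for replacing \<open>f ^^ m\<close> by
      \<open>g j\<close>. Both halves make \<open>r / (4 * K)\<close>, and a projection of norm at
      most \<open>K\<close> turns this into \<open>r / 4\<close>.\<close>
    define e1 where "e1 = r / (8 * K)"
    have e1: "e1 > 0" using r K by (simp add: e1_def)
    obtain \<delta> where \<delta>: "\<delta> > 0" "\<And>i a b. i \<in> centres \<Longrightarrow> a \<in> core i 2 \<Longrightarrow> mdist a b < \<delta> \<Longrightarrow> b \<in> cdom i \<and> dist (coord i a) (coord i b) < e1"
      using core_coordinates_uniform[OF e1] by metis
    obtain \<eta>3 where \<eta>3: "\<eta>3 > 0" "\<And>i a b. i \<in> centres \<Longrightarrow> a \<in> core i 2 \<Longrightarrow> mdist a b < \<eta>3 \<Longrightarrow> b \<in> cdom i \<and> dist (coord i a) (coord i b) < \<eta>B"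
      using core_coordinates_uniform[OF \<eta>B(1)] by metis
    obtain \<eta>4 where \<eta>4: "\<eta>4 > 0" "\<And>i a b. i \<in> centres \<Longrightarrow> a \<in> core i 2 \<Longrightarrow> mdist a b < \<eta>4 \<Longrightarrow> b \<in> cdom i \<and> dist (coord i a) (coord i b) < r0"
      using core_coordinates_uniform[OF r0] by metis
    have "\<eta>3 / 2 > 0" using \<eta>3 by simp
    then obtain \<delta>F where \<delta>F: "\<delta>F > 0" "\<And>a b. mdist a b < \<delta>F \<Longrightarrow> mdist (?F a) (?F b) < \<eta>3 / 2"
      using mdist.uniform_continuity[OF Fc] by metis
    \<comment> \<open>How close the orbit must be to \<Lambda>: \<open>\<eta>4\<close> puts the
      nearby point into the same chart, while \<open>\<delta>F\<close> and
      \<open>\<eta>3 / 2\<close> make the image of one nearby point close enough to the next one for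
      \<open>\<eta>B\<close>.\<close>
    define \<eta>1 where "\<eta>1 = min \<eta>4 (min \<delta>F (\<eta>3 / 2))"
    have \<eta>1: "\<eta>1 > 0" "\<eta>1 \<le> \<eta>4" "\<eta>1 \<le> \<delta>F" "\<eta>1 \<le> \<eta>3 / 2" using \<eta>3 \<eta>4 \<delta>F by (auto simp: \<eta>1_def)
    define V where "V = (\<Union>q\<in>\<Lambda>. {x. mdist q x < \<eta>1})"
    have V: "open V" unfolding V_def by (intro open_UN ballI mdist.open_d_ball)
    have \<Lambda>V: "\<Lambda> \<subseteq> V"
    proof
      fix p assume "p \<in> \<Lambda>"
      moreover have "mdist p p < \<eta>1" using mdist.d_zero[of p p] \<eta>1(1) by simp
      ultimately show "p \<in> V" unfolding V_def by blast
    qed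
    show "\<exists>\<delta>>0. \<exists>V. open V \<and> \<Lambda> \<subseteq> V \<and>
      (\<forall>x g. (\<forall>j. (f ^^ (j * m)) x \<in> V) \<longrightarrow> (\<forall>j. continuous_on UNIV (g j)) \<longrightarrow>
         (\<forall>j y. mdist (g j y) ((f ^^ m) y) < \<delta>) \<longrightarrow>
         (\<forall>n. \<exists>y. (\<forall>j<n. y (Suc j) = g j (y j)) \<and> (\<forall>j\<le>n. mdist (y j) ((f ^^ (j * m)) x) < \<eta>)))"
    proof (rule exI[of _ \<delta>], intro conjI, rule \<delta>(1), rule exI[of _ V], intro conjI allI impI)
      fix x and g :: "nat \<Rightarrow> 'm \<Rightarrow> 'm" and n
      assume xV: "\<forall>j. (f ^^ (j * m)) x \<in> V" and gc: "\<forall>j. continuous_on UNIV (g j)" and gd: "\<forall>j y. mdist (g j y) (?F y) < \<delta>"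
      define X where "X j = (f ^^ (j * m)) x" for j
      have XS: "X (Suc j) = ?F (X j)" for j by (simp add: X_def funpow_add)
      have "\<forall>j. \<exists>i. i \<in> centres \<and> X j \<in> ocore i 1" using centres(2) by blast
      then obtain idx where idx: "\<And>j. idx j \<in> centres" "\<And>j. X j \<in> ocore (idx j) 1" by metis
      have "\<forall>j. \<exists>q. q \<in> \<Lambda> \<and> mdist q (X j) < \<eta>1" using xV by (auto simp: V_def X_def)
      \<comment> \<open>The points \<open>q j\<close> lend their splittings; they need not form an
        orbit, since each is chosen separately.\<close>
      then obtain q where q: "\<And>j. q j \<in> \<Lambda>" "\<And>j. mdist (q j) (X j) < \<eta>1" by metis
      have X1: "X j \<in> core (idx j) 1" for j using idx(2)[of j] by (auto simp: core_def ocore_def)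
      then have X2: "X j \<in> core (idx j) 2" for j using core_mono[of 1 2 "idx j"] by auto
      have FX1: "?F (X j) \<in> core (idx (Suc j)) 1" for j using X1[of "Suc j"] by (simp add: XS)
      define c where "c j = coord (idx j) (X j)" for j
      define yq where "yq j = coord (idx j) (q j)" for j
      have cX: "param (idx j) (c j) = X j" for j using X1[of j] by (simp add: c_def core_def param_coord)
      have qd: "q j \<in> cdom (idx j)" "dist (c j) (yq j) < r0" for j
        using \<eta>4(2)[OF idx(1) X2, of j "q j"] q(2)[of j] \<eta>1(2) mdist.d_sym[of "X j" "q j"] by (auto simp: c_def yq_def)
      note NLj = NL[OF idx(1) idx(1) X1 FX1, folded c_def]
      have pq: "param (idx j) (yq j) = q j" for j using qd(1) by (simp add: yq_def param_coord)
      have q2: "q j \<in> core (idx j) 2" "?F (q j) \<in> core (idx (Suc j)) 2" for j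
        using NLj[OF qd(2)[of j]] qd(1)[of j] pq[of j] by (simp_all add: core_def[of "idx j"] yq_def)
      have yL: "yq j \<in> \<Lambda>_coords (idx j)" for j using q2 q(1) by (auto simp: yq_def \<Lambda>_coords_def)
      define P where "P j = stable_proj (idx j) (yq j)" for j
      define D where "D j = rep_deriv ?F (cha (idx j)) (cha (idx (Suc j)))" for j
      have block: "hyp_block (P j) (P (Suc j)) (D j (yq j))" for j
        unfolding P_def D_def
      proof (rule \<eta>B(2)[OF idx(1) idx(1) yL yL])
        show "?F (param (idx j) (yq j)) \<in> core (idx (Suc j)) 2" using q2(2) by (simp add: pq)
        have "mdist (?F (q j)) (?F (X j)) < \<eta>3 / 2" using q(2)[of j] \<eta>1(3) by (intro \<delta>F(2)) simp
        moreover have "mdist (?F (X j)) (q (Suc j)) < \<eta>3 / 2"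
          using q(2)[of "Suc j"] \<eta>1(4) mdist.d_sym[of "?F (X j)" "q (Suc j)"] by (simp add: XS)
        ultimately have "mdist (?F (q j)) (q (Suc j)) < \<eta>3" using mdist.d_triangle[of "?F (q j)" "q (Suc j)" "?F (X j)"] by simp
        then show "dist (coord (idx (Suc j)) (?F (param (idx j) (yq j)))) (yq (Suc j)) < \<eta>B"
          unfolding pq unfolding yq_def using \<eta>3(2)[OF idx(1) q2(2)] by blast
      qed
      \<comment> \<open>Coordinates are centred at the orbit points \<open>c j\<close>, so that a
        solution in the boxes stays close to the orbit, while the linear part
        \<open>D j (yq j)\<close> is taken at the point of \<Lambda>.\<close>
      define \<Phi> where "\<Phi> j v = coord (idx (Suc j)) (g j (param (idx j) (c j + v))) - c (Suc j)" for j v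
      have loc: "c j + v \<in> ball (coord (idx j) (idx j)) (2 * rad (idx j))" "c j + v \<in> coord (idx j) ` cdom (idx j)"
        "g j (param (idx j) (c j + v)) \<in> cdom (idx (Suc j))"
        "norm (\<Phi> j v - D j (yq j) v) \<le> r / (4 * K)" if v: "norm v \<le> 2 * r" for j v
      proof -
        let ?w = "c j + v" and ?T = "chart_rep ?F (cha (idx j)) (cha (idx (Suc j)))"
        have dw: "dist (c j) ?w < r0" using v r by (simp add: dist_norm)
        note w = NLj[OF dw]
        show "?w \<in> ball (coord (idx j) (idx j)) (2 * rad (idx j))" using w by blast
        then show "?w \<in> coord (idx j) ` cdom (idx j)" using cball_core_sub[of 2 "idx j"] by auto
        have TT: "?T z = coord (idx (Suc j)) (?F (param (idx j) z))" for z by (simp add: chart_rep_def coord_def param_def)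
        have gw: "g j (param (idx j) ?w) \<in> cdom (idx (Suc j)) \<and> dist (?T ?w) (coord (idx (Suc j)) (g j (param (idx j) ?w))) < e1"
          unfolding TT using w gd mdist.d_sym by (intro \<delta>(2) idx(1)) metis+
        then show "g j (param (idx j) ?w) \<in> cdom (idx (Suc j))" by blast
        have Tc: "?T (c j) = c (Suc j)" by (simp only: TT cX XS[symmetric]) (simp only: c_def)
        have "norm (?T ?w - ?T (c j) - D j (yq j) (?w - c j)) \<le> 2 * \<eta>0 * norm (?w - c j)"
        proof (rule linear_approximation_on_ball[of "c j" r0])
          fix z assume "z \<in> ball (c j) r0"
          then have z: "dist (c j) z < r0" by simp
          show "(?T has_derivative D j z) (at z)" unfolding D_def
            using NLj[OF z] by (intro C1_map_derivative FC1 chart_at) blast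
          show "dist (D j (c j)) (D j z) \<le> \<eta>0" unfolding D_def using NLj[OF z] by (intro less_imp_le) blast
        qed (use dw qd in auto)
        also have "\<dots> \<le> 2 * \<eta>0 * (2 * r)" using v \<eta>0 by (intro mult_left_mono) auto
        also have "\<dots> = r / (8 * K)" using K(1) by (simp add: \<eta>0_def)
        finally have l1: "norm (?T ?w - c (Suc j) - D j (yq j) v) \<le> r / (8 * K)" by (simp add: Tc)
        have l2: "norm (\<Phi> j v - (?T ?w - c (Suc j))) \<le> r / (8 * K)"
          using gw by (simp add: \<Phi>_def dist_norm norm_minus_commute e1_def)
        have "norm (\<Phi> j v - D j (yq j) v) \<le> norm (\<Phi> j v - (?T ?w - c (Suc j))) + norm (?T ?w - c (Suc j) - D j (yq j) v)"
          using norm_triangle_ineq[of "\<Phi> j v - (?T ?w - c (Suc j))" "?T ?w - c (Suc j) - D j (yq j) v"] by simp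
        also have "\<dots> \<le> r / (8 * K) + r / (8 * K)" using l1 l2 by (rule add_mono[rotated])
        also have "\<dots> = r / (4 * K)" by (simp add: field_simps)
        finally show "norm (\<Phi> j v - D j (yq j) v) \<le> r / (4 * K)" .
      qed
      have K4: "K * norm u \<le> r / 4" if "norm u \<le> r / (4 * K)" for u :: 'e
      proof -
        have "K * norm u \<le> K * (r / (4 * K))" using that K(1) by (intro mult_left_mono) auto
        then show ?thesis using K(1) by simp
      qed
      have "\<exists>v. (\<forall>j\<le>n. v j \<in> split_box (P j) r) \<and> (\<forall>j<n. v (Suc j) = \<Phi> j (v j))"
      proof (rule hyperbolic_segment_exists[where A = "\<lambda>j. blinfun_apply (D j (yq j))"])
        show "linear (P j)" "P j (P j v) = P j v" for j v using stable_proj[OF yL] by (auto simp: P_def)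
        show "linear (blinfun_apply (D j (yq j)))" for j by (intro bounded_linear.linear blinfun.bounded_linear_right)
        show "continuous_on (split_box (P j) r) (\<Phi> j)" for j
        proof -
          have "continuous_on (split_box (P j) r) (\<lambda>v. param (idx j) (c j + v))"
            by (rule continuous_on_compose2[OF param_cont]) (auto intro!: continuous_intros loc(2) split_box_norm)
          then have "continuous_on (split_box (P j) r) (\<lambda>v. g j (param (idx j) (c j + v)))"
            by (rule continuous_on_compose2[OF gc[rule_format, of j]]) (rule subset_UNIV)
          then have "continuous_on (split_box (P j) r) (\<lambda>v. coord (idx (Suc j)) (g j (param (idx j) (c j + v))))"
            by (rule continuous_on_compose2[OF coord_cont]) (auto intro!: loc(3) split_box_norm)
          then show ?thesis unfolding \<Phi>_def by (intro continuous_on_diff continuous_on_const)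
        qed
        fix j v assume "v \<in> split_box (P j) r"
        then have e: "norm (\<Phi> j v - D j (yq j) v) \<le> r / (4 * K)" using loc(4) split_box_norm by blast
        show "norm (P (Suc j) (\<Phi> j v - D j (yq j) v)) \<le> r / 4"
          using K(2)[OF idx(1) yL] K4[OF e] unfolding P_def by (rule order_trans)
        show "norm (\<Phi> j v - D j (yq j) v - P (Suc j) (\<Phi> j v - D j (yq j) v)) \<le> r / 4"
          using K(3)[OF idx(1) yL] K4[OF e] unfolding P_def by (rule order_trans)
      qed (use r(1) block in \<open>auto simp: hyp_block_def\<close>)
      then obtain v where v: "\<And>j. j \<le> n \<Longrightarrow> v j \<in> split_box (P j) r" "\<And>j. j < n \<Longrightarrow> v (Suc j) = \<Phi> j (v j)" by blast
      have vn: "norm (v j) \<le> 2 * r" if "j \<le> n" for j using split_box_norm[OF v(1)[OF that]] .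
      define y where "y j = param (idx j) (c j + v j)" for j
      have "y (Suc j) = g j (y j)" if "j < n" for j
      proof -
        have "c (Suc j) + v (Suc j) = coord (idx (Suc j)) (g j (y j))" using v(2)[OF that] by (simp add: \<Phi>_def y_def)
        then have "y (Suc j) = param (idx (Suc j)) (coord (idx (Suc j)) (g j (y j)))" unfolding y_def[of "Suc j"] by simp
        also have "\<dots> = g j (y j)" using loc(3)[OF vn[of j]] that by (intro param_coord) (simp add: y_def)
        finally show ?thesis .
      qed
      moreover have "mdist (y j) (X j) < \<eta>" if "j \<le> n" for j
      proof -
        have "mdist (param (idx j) (c j + v j)) (param (idx j) (c j)) < \<eta>"
        proof (rule \<delta>p(2)[OF idx(1)])
          show "c j + v j \<in> cball (coord (idx j) (idx j)) (2 * rad (idx j))" using loc(1)[OF vn[OF that], of j] by simp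
          show "c j \<in> cball (coord (idx j) (idx j)) (2 * rad (idx j))" using X2[of j] by (simp add: core_def c_def)
          show "dist (c j + v j) (c j) < \<delta>p" using vn[OF that] r by (simp add: dist_norm)
        qed
        then show ?thesis by (simp add: y_def cX)
      qed
      ultimately show "\<exists>y. (\<forall>j<n. y (Suc j) = g j (y j)) \<and> (\<forall>j\<le>n. mdist (y j) ((f ^^ (j * m)) x) < \<eta>)"
        by (intro exI[of _ y]) (simp add: X_def)
    qed (use V \<Lambda>V in auto)
  qed
qed

end

section \<open>Ergodic inverse shadowing\<close>

text \<open>The first \<open>N\<close> terms contribute at most \<open>B / n\<close> to the average,
  which tends to 0.\<close>

lemma limsup_average_le:
  fixes a :: "nat \<Rightarrow> real"
  assumes "\<And>k. k \<ge> N \<Longrightarrow> a k \<le> \<epsilon>" "\<epsilon> \<ge> 0"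
  shows "limsup (\<lambda>n. ereal (1 / real n * (\<Sum>k=1..n. a k))) \<le> ereal \<epsilon>"
proof -
  define B where "B = (\<Sum>k<N. \<bar>a k\<bar>)"
  have le: "1 / real n * (\<Sum>k=1..n. a k) \<le> B / real n + \<epsilon>" if n: "n \<ge> 1" for n
  proof -
    have "(\<Sum>k=1..n. a k) \<le> (\<Sum>k=1..n. (if k < N then \<bar>a k\<bar> else 0) + \<epsilon>)"
      using assms by (intro sum_mono) (auto intro: order_trans[OF abs_ge_self])
    also have "\<dots> = (\<Sum>k=1..n. if k < N then \<bar>a k\<bar> else 0) + real n * \<epsilon>"
      by (simp add: sum.distrib)
    also have "(\<Sum>k=1..n. if k < N then \<bar>a k\<bar> else 0) = (\<Sum>k\<in>{1..n} \<inter> {..<N}. \<bar>a k\<bar>)"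
      by (simp add: sum.inter_restrict lessThan_def)
    also have "\<dots> \<le> B" unfolding B_def by (intro sum_mono2) auto
    finally have "(\<Sum>k=1..n. a k) \<le> B + real n * \<epsilon>" by simp
    then show ?thesis using n by (simp add: field_simps)
  qed
  have "limsup (\<lambda>n. ereal (1 / real n * (\<Sum>k=1..n. a k))) \<le> limsup (\<lambda>n. ereal (B / real n + \<epsilon>))"
    using le by (intro Limsup_mono eventually_mono[OF eventually_ge_at_top[of 1]]) simp
  also have "(\<lambda>n. B / real n + \<epsilon>) \<longlonglongrightarrow> 0 + \<epsilon>"
    by (intro tendsto_intros lim_const_over_n)
  then have "(\<lambda>n. ereal (B / real n + \<epsilon>)) \<longlonglongrightarrow> ereal \<epsilon>" by simp
  then have "limsup (\<lambda>n. ereal (B / real n + \<epsilon>)) = ereal \<epsilon>" by (intro lim_imp_Limsup) auto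
  finally show ?thesis .
qed

lemma compact_decreasing_Inter:
  fixes S :: "nat \<Rightarrow> 'm::t2_space set"
  assumes "compact (UNIV :: 'm set)" "\<And>n. closed (S n)" "\<And>n. S n \<noteq> {}" "\<And>n. S (Suc n) \<subseteq> S n"
  shows "\<exists>z. \<forall>n. z \<in> S n"
proof -
  have dec: "S n \<subseteq> S k" if "k \<le> n" for k n using that assms(4) by (rule lift_Suc_antimono_le[rotated])
  have "UNIV \<inter> (\<Inter>n\<in>UNIV. S n) \<noteq> {}"
  proof (rule compact_imp_fip_image[OF assms(1)])
    fix I :: "nat set" assume "finite I" "I \<subseteq> UNIV"
    then obtain n where "\<And>k. k \<in> I \<Longrightarrow> k \<le> n" by (metis finite_nat_set_iff_bounded_le)
    then have "S n \<subseteq> (\<Inter>k\<in>I. S k)" using dec by blast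
    then show "UNIV \<inter> (\<Inter>k\<in>I. S k) \<noteq> {}" using assms(3)[of n] by blast
  qed (rule assms(2))
  then show ?thesis by blast
qed

context hyperbolic_system
begin

lemma EIS_of_nonwandering:
  assumes \<Lambda>: "nonwandering_set f \<subseteq> \<Lambda>"
  shows "EIS (riem_dist A G) f"
proof -
  have fc: "continuous_on UNIV f" "continuous_on UNIV (inv f)" using C1 C1_inv by (auto simp: C1_map_def)
  show ?thesis unfolding EIS_def
  proof (intro conjI allI impI)
    show "surj f" using bij by (rule bij_is_surj)
    show "continuous_on UNIV f" by (rule fc)
    fix \<epsilon> :: real assume \<epsilon>: "\<epsilon> > 0"
    obtain \<eta>0 where \<eta>0: "\<eta>0 > 0" "\<And>a b. mdist a b < \<eta>0 \<Longrightarrow> riem_dist A G a b \<le> ennreal \<epsilon>"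
      using mdist_small_imp[OF \<epsilon>] by metis
    \<comment> \<open>The sets \<open>S n\<close> below use \<open>\<le> \<eta>\<close> to be
      closed; \<open>\<eta> < \<eta>0\<close> restores the strict inequality in the limit.\<close>
    define \<eta> where "\<eta> = \<eta>0 / 2"
    have \<eta>: "\<eta> > 0" "\<eta> < \<eta>0" using \<eta>0 by (auto simp: \<eta>_def)
    obtain m where m: "m \<ge> 1" and seg: "\<And>\<eta>. \<eta> > 0 \<Longrightarrow> \<exists>\<delta>>0. \<exists>V. open V \<and> \<Lambda> \<subseteq> V \<and>
      (\<forall>x g. (\<forall>j. (f ^^ (j * m)) x \<in> V) \<longrightarrow> (\<forall>j. continuous_on UNIV (g j)) \<longrightarrow>
         (\<forall>j y. mdist (g j y) ((f ^^ m) y) < \<delta>) \<longrightarrow>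
         (\<forall>n. \<exists>y. (\<forall>j<n. y (Suc j) = g j (y j)) \<and> (\<forall>j\<le>n. mdist (y j) ((f ^^ (j * m)) x) < \<eta>)))"
      by (rule segment_shadowing) blast
    \<comment> \<open>Closeness at multiples of \<open>m\<close> within \<open>\<delta>1\<close>
      gives closeness within \<open>\<eta>\<close> at the times in between.\<close>
    obtain \<delta>1 where \<delta>1: "\<delta>1 > 0" "\<And>(g :: nat \<Rightarrow> 'm \<Rightarrow> 'm) k y y' i. \<forall>k y. mdist (g k y) (f y) < \<delta>1 \<Longrightarrow> i \<le> m \<Longrightarrow>
        mdist y y' < \<delta>1 \<Longrightarrow> mdist (method_comp g k i y) ((f ^^ i) y') < \<eta>"
      using mdist.method_comp_close[OF fc(1) \<eta>(1), of m] by blast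
    obtain \<delta>2 V where \<delta>2: "\<delta>2 > 0" and V: "open V" "\<Lambda> \<subseteq> V" and
      seg': "\<And>x g n. (\<forall>j. (f ^^ (j * m)) x \<in> V) \<Longrightarrow> (\<forall>j. continuous_on UNIV (g j)) \<Longrightarrow>
         (\<forall>j y. mdist (g j y) ((f ^^ m) y) < \<delta>2) \<Longrightarrow>
         \<exists>y. (\<forall>j<n. y (Suc j) = g j (y j)) \<and> (\<forall>j\<le>n. mdist (y j) ((f ^^ (j * m)) x) < \<delta>1)"
      using seg[OF \<delta>1(1)] by metis
    \<comment> \<open>This makes blocks of \<open>m\<close> maps of the method close enough to
      \<open>f ^^ m\<close> for the segment result.\<close>
    obtain \<delta>3 where \<delta>3: "\<delta>3 > 0" "\<And>(g :: nat \<Rightarrow> 'm \<Rightarrow> 'm) k y y' i. \<forall>k y. mdist (g k y) (f y) < \<delta>3 \<Longrightarrow> i \<le> m \<Longrightarrow>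
        mdist y y' < \<delta>3 \<Longrightarrow> mdist (method_comp g k i y) ((f ^^ i) y') < \<delta>2"
      using mdist.method_comp_close[OF fc(1) \<delta>2, of m] by blast
    obtain \<delta>4 where \<delta>4: "\<delta>4 > 0" "\<And>g. continuous_on UNIV g \<Longrightarrow> (\<And>y. mdist (g y) (f y) < \<delta>4) \<Longrightarrow> surj g"
      using near_homeomorphism_surj[OF bij fc(2)] by metis
    have "min \<delta>1 (min \<delta>3 \<delta>4) > 0" using \<delta>1 \<delta>3 \<delta>4 by simp
    then obtain d where d: "d > 0" "\<And>a b. riem_dist A G a b \<le> ennreal d \<Longrightarrow> mdist a b < min \<delta>1 (min \<delta>3 \<delta>4)"
      using riem_dist_small_imp by metis
    show "\<exists>d>0. \<forall>x g. d_method (riem_dist A G) d f g \<longrightarrow> (\<exists>y. is_trajectory g y \<and>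
              (\<forall>\<phi>\<in>Lip1 (riem_dist A G).
                 limsup (\<lambda>n. ereal (1 / real n * (\<Sum>k=1..n. \<phi> ((f ^^ k) x) - \<phi> (y k)))) \<le> ereal \<epsilon>))"
    proof (intro exI[of _ d] conjI allI impI d(1))
      fix x g assume g: "d_method (riem_dist A G) d f g"
      have meth: "is_method g" using g by (simp add: d_method_def)
      have gc: "continuous_on UNIV (g k)" for k using meth by (simp add: is_method_def)
      have gd: "mdist (g k y) (f y) < min \<delta>1 (min \<delta>3 \<delta>4)" for k y
      proof (rule d(2))
        have "riem_dist A G (g k y) (f y) \<le> dist_C0 (riem_dist A G) (g k) f"
          unfolding dist_C0_def by (rule SUP_upper) simp
        also have "\<dots> \<le> ennreal d" using g by (simp add: d_method_def)
        finally show "riem_dist A G (g k y) (f y) \<le> ennreal d" .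
      qed
      have g1: "\<forall>k y. mdist (g k y) (f y) < \<delta>1" and g3: "\<forall>k y. mdist (g k y) (f y) < \<delta>3"
        and g4: "\<And>k y. mdist (g k y) (f y) < \<delta>4" using gd by auto
      have surj: "surj (method_comp g k i)" for k i
        using \<delta>4(2)[OF gc g4] by (rule method_comp_surj)
      obtain N where N: "\<And>k. k \<ge> N \<Longrightarrow> (f ^^ k) x \<in> V"
        using nonwandering_attracts[OF compact_UNIV_manifold V(1), of f x] V(2) \<Lambda> by (metis order_trans)
      \<comment> \<open>Initial points whose trajectory is close to the given one from time
        \<open>N\<close> to time \<open>n\<close>. The value of \<open>N\<close> depends on
        \<open>x\<close>, but \<open>d\<close> has been fixed before.\<close>
      define S where "S n = {z. \<forall>k\<le>n. N \<le> k \<longrightarrow> mdist (method_comp g 0 k z) ((f ^^ k) x) \<le> \<eta>}" for n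
      have "\<exists>z. \<forall>n. z \<in> S n"
      proof (rule compact_decreasing_Inter[OF compact_UNIV_manifold])
        fix n
        have "closed {z. mdist (method_comp g 0 k z) ((f ^^ k) x) \<le> \<eta>}" for k
          by (intro closed_Collect_le mdist.d_continuous_on method_comp_cont[OF meth] continuous_on_const)
        then have "closed (\<Inter>k\<in>{k. k \<le> n \<and> N \<le> k}. {z. mdist (method_comp g 0 k z) ((f ^^ k) x) \<le> \<eta>})" by blast
        moreover have "S n = (\<Inter>k\<in>{k. k \<le> n \<and> N \<le> k}. {z. mdist (method_comp g 0 k z) ((f ^^ k) x) \<le> \<eta>})"
          by (auto simp: S_def)
        ultimately show "closed (S n)" by simp
        show "S (Suc n) \<subseteq> S n" by (auto simp: S_def)
        define gm where "gm j = method_comp g (N + j * m) m" for j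
        have xj: "(f ^^ (j * m)) ((f ^^ N) x) = (f ^^ (N + j * m)) x" for j
          by (simp add: funpow_add add.commute[of N])
        obtain y where y: "\<And>j. j < n \<Longrightarrow> y (Suc j) = gm j (y j)"
          "\<And>j. j \<le> n \<Longrightarrow> mdist (y j) ((f ^^ (N + j * m)) x) < \<delta>1"
        proof -
          have "\<exists>y. (\<forall>j<n. y (Suc j) = gm j (y j)) \<and> (\<forall>j\<le>n. mdist (y j) ((f ^^ (j * m)) ((f ^^ N) x)) < \<delta>1)"
          proof (rule seg')
            show "\<forall>j. (f ^^ (j * m)) ((f ^^ N) x) \<in> V" using N by (simp add: xj)
            show "\<forall>j. continuous_on UNIV (gm j)" by (simp add: gm_def method_comp_cont[OF meth])
            have "mdist y y < \<delta>3" for y using \<delta>3(1) mdist.d_zero[of y y] by simp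
            then show "\<forall>j y. mdist (gm j y) ((f ^^ m) y) < \<delta>2"
              unfolding gm_def using \<delta>3(2)[OF g3 order_refl] by blast
          qed
          then show ?thesis using that by (auto simp: xj)
        qed
        \<comment> \<open>The segment found near the nonwandering set starts at time
          \<open>N\<close>; surjectivity of the first \<open>N\<close> maps pulls its first point
          back to time 0.\<close>
        obtain z where z: "method_comp g 0 N z = y 0" using surj[of 0 N] by (metis surjD)
        have yz: "method_comp g 0 (N + j * m) z = y j" if "j \<le> n" for j
          using that
        proof (induction j)
          case (Suc j)
          have "method_comp g 0 (N + Suc j * m) z = method_comp g (N + j * m) m (method_comp g 0 (N + j * m) z)"
            using method_comp_add[of g 0 "N + j * m" m z] by (simp add: algebra_simps)
          then show ?case using Suc y(1)[of j] by (simp add: gm_def)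
        qed (simp add: z)
        have "mdist (method_comp g 0 k z) ((f ^^ k) x) < \<eta>" if k: "k \<le> n" "N \<le> k" for k
        proof -
          define j where "j = (k - N) div m"
          define i where "i = (k - N) mod m"
          have kk: "k = N + j * m + i" using k by (simp add: j_def i_def)
          \<comment> \<open>A segment of \<open>n\<close> blocks reaches time
            \<open>N + n * m\<close>, which is more than enough for times up to \<open>n\<close>, as
            \<open>m \<ge> 1\<close>.\<close>
          have "j \<le> n" using k m by (simp add: j_def) (meson diff_le_self div_le_dividend order_trans)
          have "i \<le> m" using m by (simp add: i_def)
          have "mdist (method_comp g (N + j * m) i (y j)) ((f ^^ i) ((f ^^ (N + j * m)) x)) < \<eta>"
            using \<delta>1(2)[OF g1 \<open>i \<le> m\<close> y(2)[OF \<open>j \<le> n\<close>]] .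
          moreover have "method_comp g 0 k z = method_comp g (N + j * m) i (y j)"
            unfolding kk using method_comp_add[of g 0 "N + j * m" i z] yz[OF \<open>j \<le> n\<close>] by simp
          moreover have "(f ^^ i) ((f ^^ (N + j * m)) x) = (f ^^ k) x"
            unfolding kk by (metis add.commute comp_apply funpow_add)
          ultimately show ?thesis by simp
        qed
        then have "z \<in> S n" by (auto simp: S_def intro: less_imp_le)
        then show "S n \<noteq> {}" by blast
      qed
      then obtain z where z: "\<And>n. z \<in> S n" by blast
      define y where "y k = method_comp g 0 k z" for k
      have "is_trajectory g y" unfolding y_def by (rule is_trajectory_method_comp)
      moreover have "limsup (\<lambda>n. ereal (1 / real n * (\<Sum>k=1..n. \<phi> ((f ^^ k) x) - \<phi> (y k)))) \<le> ereal \<epsilon>"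
        if \<phi>: "\<phi> \<in> Lip1 (riem_dist A G)" for \<phi>
      proof (rule limsup_average_le[of N])
        fix k assume "k \<ge> N"
        then have "mdist (y k) ((f ^^ k) x) \<le> \<eta>" using z[of k] by (simp add: S_def y_def)
        then have "mdist ((f ^^ k) x) (y k) < \<eta>0" using \<eta>(2) mdist.d_sym by (metis le_less_trans)
        then have "riem_dist A G ((f ^^ k) x) (y k) \<le> ennreal \<epsilon>" by (rule \<eta>0(2))
        moreover have "ennreal \<bar>\<phi> ((f ^^ k) x) - \<phi> (y k)\<bar> \<le> riem_dist A G ((f ^^ k) x) (y k)"
          using \<phi> by (simp add: Lip1_def)
        ultimately have "ennreal \<bar>\<phi> ((f ^^ k) x) - \<phi> (y k)\<bar> \<le> ennreal \<epsilon>" by (rule order_trans[rotated])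
        then have "\<bar>\<phi> ((f ^^ k) x) - \<phi> (y k)\<bar> \<le> \<epsilon>" using \<epsilon> by (simp add: ennreal_le_iff)
        then show "\<phi> ((f ^^ k) x) - \<phi> (y k) \<le> \<epsilon>" by linarith
      qed (use \<epsilon> in simp)
      ultimately show "\<exists>y. is_trajectory g y \<and> (\<forall>\<phi>\<in>Lip1 (riem_dist A G).
                 limsup (\<lambda>n. ereal (1 / real n * (\<Sum>k=1..n. \<phi> ((f ^^ k) x) - \<phi> (y k)))) \<le> ereal \<epsilon>)" by blast
    qed
  qed
qed

end

theorem proposition3p5:
  fixes A :: "('m::t2_space, 'e::euclidean_space) chart set"
    and G :: "'m \<Rightarrow> 'e \<Rightarrow> 'e \<Rightarrow> real"
    and f :: "'m \<Rightarrow> 'm"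
  assumes "closed_smooth_manifold A"
    and "riemannian_metric A G"
    and "diffeomorphism A f"
    and "hyperbolic_set A G f (nonwandering_set f)"
  shows "EIS (riem_dist A G) f"
proof -
  obtain Es Eu C \<mu> where cpt: "compact (nonwandering_set f)" "f ` nonwandering_set f = nonwandering_set f"
    and c: "C > 0" "0 < \<mu>" "\<mu> < 1" and h: "\<forall>p\<in>nonwandering_set f.
           subspace (Es p) \<and> subspace (Eu p) \<and>
           Es p \<inter> Eu p = {0} \<and> (\<forall>w. \<exists>u\<in>Es p. \<exists>v\<in>Eu p. w = u + v) \<and>
           tangent_map A f p ` Es p = Es (f p) \<and>
           tangent_map A f p ` Eu p = Eu (f p) \<and>
           (\<forall>n. \<forall>v\<in>Es p. tangent_norm G ((f ^^ n) p) (tangent_map A (f ^^ n) p v) \<le> C * \<mu> ^ n * tangent_norm G p v) \<and>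
           (\<forall>n. \<forall>v\<in>Eu p. tangent_norm G ((inv f ^^ n) p) (tangent_map A (inv f ^^ n) p v) \<le> C * \<mu> ^ n * tangent_norm G p v)"
    using assms(4) unfolding hyperbolic_set_def by (elim conjE exE) (rule that)
  have "hyperbolic_system A G f (nonwandering_set f) Es Eu C \<mu>"
    using assms(1-3) cpt c h
    by unfold_locales (simp_all add: diffeomorphism_def splitting_def)
  then show ?thesis by (rule hyperbolic_system.EIS_of_nonwandering) simp
qed

end
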